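(* Let $t_0<T$ and $c_0>0$, and let $H_0,C_c,C_1,\dots,C_8>0$ be constants independent of $\tilde\omega$. Let $C_E\in\mathbb R^{M\times N}$, $C_B\in\mathbb R^{N\times M}$ and $\Omega\in\mathbb R^{N\times N}$ be such that (i) $C_BC_E=:-G=-G^T$ is symmetric positive semidefinite; (ii) $\Omega=\begin{bmatrix}0&0\\0&\tilde\omega\,\mathrm{Id}\end{bmatrix}$ is diagonal, with a large parameter $\tilde\omega\gg 1$; (iii) $\|C_E\|\le C_c$ and $\|C_B\|\le C_c$ (so that $\|G\|\le C_g:=C_c^2$). Suppose that the initial values $p_0,e_0,b_0$ satisfy $$\|\Omega e_0\|^2\le \tfrac23H_0,\qquad \|C_Bb_0\|^2\le\tfrac13\min\{1,\tfrac4{C_4^2}\}H_0,\qquad \|\Omega^2p_0\|^2\le\tfrac13H_0,$$ $$-\langle e_0,Ge_0\rangle=\|C_Ee_0\|^2\le 2H_0,\qquad \|e_0\|^2\le H_0,\qquad \|b_0\|^2\le H_0,\qquad \|\Omega^2C_Bb_0\|^2\le H_0 .$$ Suppose that the filter functions $\psi_E,\phi_E$ satisfy, for all real $z$, $$|(\cos z+1)\psi_E(\tfrac12z)|\le C_1\,\mathrm{sinc}^2(\tfrac12z),\qquad |\phi_E(\tfrac12z)|\le C_2\,|\mathrm{sinc}(\tfrac12z)|,$$ $$|(\cos z+1)\psi_E(\tfrac12z)\phi_E(\tfrac12z)|\le C_3\,|\mathrm{sinc}(z)|,\qquad |(\cos z+1)\psi_E(\tfrac12z)|\le C_4\,|\mathrm{sinc}(z)|,$$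 $$\left|\mathrm{sinc}(z)-\tfrac12(\cos z+1)\psi_E(\tfrac12z)\right|\le C_5\,z^2\,|\mathrm{sinc}(z)|,\qquad |\mathrm{sinc}(z)-\phi_E(\tfrac12z)|\le C_6\,|z\sin(\tfrac12z)|,$$ $$|\psi_E(z)|\le C_7,\qquad |\mathrm{sinc}^2(\tfrac12z)-\mathrm{sinc}(z)\phi_E(\tfrac12z)|\le C_8\sin^2(\tfrac12z),$$ and that $\phi_B\equiv\psi_B\equiv1$. Let $(p(t),e(t),b(t))$ be the exact solution of the linear system $\partial_tp=e$, $\partial_te=C_Bb-\Omega^2p$, $\partial_tb=-C_Ee$ with initial values $(p_0,e_0,b_0)$ at $t_0$, and let $(p_n,e_n,b_n)$ be the numerical solution produced from the same initial values by the triple splitting scheme (described in the context) with step size $\tau>0$. Then there are $\tau_0>0$ (sufficiently small, independent of $\tilde\omega$) and a constant $C$ such that, whenever $\tau\le\tau_0$ and $\tau\tilde\omega\ge c_0$, for all $n\ge0$ with $t_n:=t_0+n\tau\le T$, $$\|p_n-p(t_n)\|\le C\tau^2,\qquad \|e_n-e(t_n)\|\le C\tau^2,\qquad \|b_n-b(t_n)\|\le C\tau^2 .$$ The constant $C$ is independent of $\tilde\omega$, $\tau$, $n$ and derivatives of the solution, but depends on $T-t_0$, on $C_1,\dots,C_8$, on $C_c$ and on $H_0$.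
   Context: Norms are Euclidean norms of vectors and the induced matrix norms; $\langle\cdot,\cdot\rangle$ is the Euclidean inner product. $\mathrm{sinc}(z)=\sin(z)/z$ with $\mathrm{sinc}(0)=1$. Here $p,e\in\mathbb R^N$ and $b\in\mathbb R^M$. For an even analytic function $f$, $f(\tau\Omega)$ is the usual matrix function; since $\Omega$ is diagonal, it is applied to the diagonal entries. Filter functions: $\psi_E,\phi_E$ (and $\psi_B,\phi_B$) are even, entire analytic functions, real-valued on the real line, with value $1$ at $z=0$. They are fixed independently of $\tilde\omega$ and $\tau$. Triple splitting scheme (with $\phi_B\equiv\psi_B\equiv1$, so that the matrix functions $\phi_B(\tfrac\tau2\Omega),\psi_B(\tfrac\tau2\Omega)$ that would otherwise multiply $b_{n+1/2}$ on the right of $C_B$ and $C_E$ on the left, respectively, are identities). Given $(p_n,e_n,b_n)$, compute $$b_{n+1/2}=b_n-\tfrac\tau2\,C_E\,\phi_E(\tfrac\tau2\Omega)\,e_n,$$ $$e_n^+=e_n+\tfrac\tau2\,\psi_E(\tfrac\tau2\Omega)\,C_B\,b_{n+1/2},$$ $$\begin{bmatrix}p_{n+1}\\ e_{n+1}^-\end{bmatrix}=\begin{bmatrix}\cos(\tau\Omega)&\tau\,\mathrm{sinc}(\tau\Omega)\\-\Omega\sin(\tau\Omega)&\cos(\tau\Omega)\end{bmatrix}\begin{bmatrix}p_n\\ e_n^+\end{bmatrix},$$ $$e_{n+1}=e_{n+1}^-+\tfrac\tau2\,\psi_E(\tfrac\tau2\Omega)\,C_B\,b_{n+1/2},$$ $$b_{n+1}=b_{n+1/2}-\tfrac\tau2\,C_E\,\phi_E(\tfrac\tau2\Omega)\,e_{n+1}.$$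 *)

theory Defs
  imports
    "HOL-Probability.Sinc_Integral"
    "Jordan_Normal_Form.Matrix"
begin

unbundle no inner_syntax
unbundle no vec_syntax

definition vec_norm :: "real Matrix.vec \<Rightarrow> real" where
  "vec_norm v = sqrt (v \<bullet> v)"

text \<open>The matrix norm induced by the Euclidean norms. Taking the supremum over the closed unit
  ball rather than the unit sphere also covers matrices without columns.\<close>

definition mat_norm :: "real Matrix.mat \<Rightarrow> real" where
  "mat_norm A = Sup {vec_norm (A *\<^sub>v v) | v. v \<in> carrier_vec (dim_col A) \<and> vec_norm v \<le> 1}"

definition sym_pos_semidef :: "real Matrix.mat \<Rightarrow> bool" where
  "sym_pos_semidef A \<longleftrightarrow> square_mat A \<and> transpose_mat A = A \<and>
     (\<forall>v \<in> carrier_vec (dim_col A). 0 \<le> v \<bullet> (A *\<^sub>v v))"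

text \<open>The matrix function \<open>f(A)\<close>, used for diagonal \<open>A\<close> only.\<close>

definition diag_fun :: "(real \<Rightarrow> real) \<Rightarrow> real Matrix.mat \<Rightarrow> real Matrix.mat" where
  "diag_fun f A = mat_diag (dim_row A) (\<lambda>i. f (A $$ (i, i)))"

definition block_Omega :: "nat \<Rightarrow> nat \<Rightarrow> real \<Rightarrow> real Matrix.mat" where
  "block_Omega N0 N1 \<omega> =
     four_block_mat (0\<^sub>m N0 N0) (0\<^sub>m N0 N1) (0\<^sub>m N1 N0) (\<omega> \<cdot>\<^sub>m 1\<^sub>m N1)"

definition filter_function :: "(complex \<Rightarrow> complex) \<Rightarrow> bool" where
  "filter_function f \<longleftrightarrow>
     f holomorphic_on UNIV \<and> (\<forall>z. f (- z) = f z) \<and> (\<forall>x. f (complex_of_real x) \<in> \<real>) \<and> f 0 = 1"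

definition on_reals :: "(complex \<Rightarrow> complex) \<Rightarrow> real \<Rightarrow> real" where
  "on_reals f x = Re (f (complex_of_real x))"

definition filter_bounds ::
  "real \<Rightarrow> real \<Rightarrow> real \<Rightarrow> real \<Rightarrow> real \<Rightarrow> real \<Rightarrow> real \<Rightarrow> real \<Rightarrow> (real \<Rightarrow> real) \<Rightarrow> (real \<Rightarrow> real) \<Rightarrow> bool"
  where
  "filter_bounds C1 C2 C3 C4 C5 C6 C7 C8 \<psi> \<phi> \<longleftrightarrow> (\<forall>z.
     \<bar>(cos z + 1) * \<psi> (z / 2)\<bar> \<le> C1 * (sinc (z / 2))\<^sup>2 \<and>
     \<bar>\<phi> (z / 2)\<bar> \<le> C2 * \<bar>sinc (z / 2)\<bar> \<and>
     \<bar>(cos z + 1) * \<psi> (z / 2) * \<phi> (z / 2)\<bar> \<le> C3 * \<bar>sinc z\<bar> \<and>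
     \<bar>(cos z + 1) * \<psi> (z / 2)\<bar> \<le> C4 * \<bar>sinc z\<bar> \<and>
     \<bar>sinc z - 1 / 2 * (cos z + 1) * \<psi> (z / 2)\<bar> \<le> C5 * z\<^sup>2 * \<bar>sinc z\<bar> \<and>
     \<bar>sinc z - \<phi> (z / 2)\<bar> \<le> C6 * \<bar>z * sin (z / 2)\<bar> \<and>
     \<bar>\<psi> z\<bar> \<le> C7 \<and>
     \<bar>(sinc (z / 2))\<^sup>2 - sinc z * \<phi> (z / 2)\<bar> \<le> C8 * (sin (z / 2))\<^sup>2)"

definition initial_bounds ::
  "real \<Rightarrow> real \<Rightarrow> real Matrix.mat \<Rightarrow> real Matrix.mat \<Rightarrow> real Matrix.mat \<Rightarrow>
   real Matrix.vec \<Rightarrow> real Matrix.vec \<Rightarrow> real Matrix.vec \<Rightarrow> bool"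
  where
  "initial_bounds H0 C4 CE CB \<Omega> p0 e0 b0 \<longleftrightarrow> (let G = - (CB * CE) in
     (vec_norm (\<Omega> *\<^sub>v e0))\<^sup>2 \<le> 2 / 3 * H0 \<and>
     (vec_norm (CB *\<^sub>v b0))\<^sup>2 \<le> 1 / 3 * min 1 (4 / C4\<^sup>2) * H0 \<and>
     (vec_norm (\<Omega> *\<^sub>v (\<Omega> *\<^sub>v p0)))\<^sup>2 \<le> 1 / 3 * H0 \<and>
     - (e0 \<bullet> (G *\<^sub>v e0)) = (vec_norm (CE *\<^sub>v e0))\<^sup>2 \<and>
     (vec_norm (CE *\<^sub>v e0))\<^sup>2 \<le> 2 * H0 \<and>
     (vec_norm e0)\<^sup>2 \<le> H0 \<and>
     (vec_norm b0)\<^sup>2 \<le> H0 \<and>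
     (vec_norm (\<Omega> *\<^sub>v (\<Omega> *\<^sub>v (CB *\<^sub>v b0))))\<^sup>2 \<le> H0)"

text \<open>The type of vectors carries no topology, so curves are differentiated componentwise.\<close>

definition has_vec_deriv ::
  "(real \<Rightarrow> real Matrix.vec) \<Rightarrow> real Matrix.vec \<Rightarrow> nat \<Rightarrow> real \<Rightarrow> real set \<Rightarrow> bool" where
  "has_vec_deriv x v n t S \<longleftrightarrow> v \<in> carrier_vec n \<and> (\<forall>s \<in> S. x s \<in> carrier_vec n) \<and>
     (\<forall>i < n. ((\<lambda>s. x s $ i) has_real_derivative v $ i) (at t within S))"

definition exact_solution ::
  "nat \<Rightarrow> nat \<Rightarrow> real Matrix.mat \<Rightarrow> real Matrix.mat \<Rightarrow> real Matrix.mat \<Rightarrow> real \<Rightarrow> real \<Rightarrow>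
   real Matrix.vec \<Rightarrow> real Matrix.vec \<Rightarrow> real Matrix.vec \<Rightarrow>
   (real \<Rightarrow> real Matrix.vec) \<Rightarrow> (real \<Rightarrow> real Matrix.vec) \<Rightarrow> (real \<Rightarrow> real Matrix.vec) \<Rightarrow> bool"
  where
  "exact_solution N M CE CB \<Omega> t0 T p0 e0 b0 p e b \<longleftrightarrow>
     p t0 = p0 \<and> e t0 = e0 \<and> b t0 = b0 \<and>
     (\<forall>t \<in> {t0..T}.
        has_vec_deriv p (e t) N t {t0..T} \<and>
        has_vec_deriv e (CB *\<^sub>v b t - \<Omega> *\<^sub>v (\<Omega> *\<^sub>v p t)) N t {t0..T} \<and>
        has_vec_deriv b (- (CE *\<^sub>v e t)) M t {t0..T})"

text \<open>One step of the triple splitting scheme, without filters acting on the \<open>b\<close> component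
  (\<open>\<phi>\<^sub>B \<equiv> \<psi>\<^sub>B \<equiv> 1\<close>).\<close>

definition triple_step ::
  "real \<Rightarrow> real Matrix.mat \<Rightarrow> real Matrix.mat \<Rightarrow> real Matrix.mat \<Rightarrow> (real \<Rightarrow> real) \<Rightarrow> (real \<Rightarrow> real) \<Rightarrow>
   real Matrix.vec \<times> real Matrix.vec \<times> real Matrix.vec \<Rightarrow>
   real Matrix.vec \<times> real Matrix.vec \<times> real Matrix.vec"
  where
  "triple_step \<tau> CE CB \<Omega> \<psi> \<phi> = (\<lambda>(p, e, b).
     let \<Psi> = diag_fun \<psi> ((\<tau> / 2) \<cdot>\<^sub>m \<Omega>);
         \<Phi> = diag_fun \<phi> ((\<tau> / 2) \<cdot>\<^sub>m \<Omega>);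
         Cos = diag_fun cos (\<tau> \<cdot>\<^sub>m \<Omega>);
         Sin = diag_fun sin (\<tau> \<cdot>\<^sub>m \<Omega>);
         Sinc = diag_fun sinc (\<tau> \<cdot>\<^sub>m \<Omega>);
         b_half = b - (\<tau> / 2) \<cdot>\<^sub>v (CE *\<^sub>v (\<Phi> *\<^sub>v e));
         e_plus = e + (\<tau> / 2) \<cdot>\<^sub>v (\<Psi> *\<^sub>v (CB *\<^sub>v b_half));
         p_new = Cos *\<^sub>v p + \<tau> \<cdot>\<^sub>v (Sinc *\<^sub>v e_plus);
         e_minus = Cos *\<^sub>v e_plus - \<Omega> *\<^sub>v (Sin *\<^sub>v p);
         e_new = e_minus + (\<tau> / 2) \<cdot>\<^sub>v (\<Psi> *\<^sub>v (CB *\<^sub>v b_half));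
         b_new = b_half - (\<tau> / 2) \<cdot>\<^sub>v (CE *\<^sub>v (\<Phi> *\<^sub>v e_new))
     in (p_new, e_new, b_new))"

end

theory Submission
  imports Defs
begin

text \<open>
  Let \<open>P\<close> be the projection onto the coordinates of frequency \<open>\<omega>\<close>, \<open>Q = 1 - P\<close>, \<open>z = \<omega> \<tau>\<close> and
  \<open>G = - C\<^sub>B C\<^sub>E\<close>. The exact \<open>e\<close> solves \<open>e'' = - \<Omega>\<^sup>2 e + G e\<close>, and its energy
  \<open>\<parallel>e'\<parallel>\<^sup>2 + \<parallel>\<Omega> e\<parallel>\<^sup>2 - \<langle>e, G e\<rangle>\<close> is conserved. This bounds \<open>e\<close>, \<open>e'\<close>, \<open>\<omega> P e\<close> and \<open>b\<close> by a constant
  \<open>K\<close> that is independent of \<open>\<omega>\<close>, but \<open>P e''\<close> is of size \<open>\<omega>\<close>, so Taylor expansion is of no use. Instead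
  \<open>G e\<close> is treated as a bounded perturbation of a harmonic oscillator (\<open>perturbed_oscillator\<close>); this gives
  expansions of the exact solution with trigonometric coefficients and remainders bounded independently
  of \<open>\<omega>\<close>.

  Local errors of size \<open>\<tau>\<^sup>3\<close> are not available for all parts; the terms that are larger have to cancel
  over many steps. There are three mechanisms; in them \<open>K\<close> also bounds the filter constants.

  \<^item> Sums of \<open>P e(t\<^sub>n)\<close>, which drive the errors of \<open>b\<close> and of \<open>Q e\<close>, stay bounded because up to \<open>O(\<tau>)\<close>
    the vector \<open>2 \<omega> sin(z/2) P e(t\<^sub>n)\<close> is the difference of \<open>- P e'\<close> at the neighbouring midpoints; the
    filter \<open>\<phi>\<^sub>E\<close> compensates the factor \<open>sin(z/2)\<close> (\<open>b_rest_step\<close>).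

  \<^item> Elimination of \<open>p\<close> and \<open>b\<close> turns the scheme for \<open>P e\<close> into a two-step trigonometric method
    (\<open>P_en_two_step\<close>). Its largest defect is \<open>\<tau>\<^sup>2 r P G Q e\<close> with \<open>\<bar>r\<bar> \<le> K sin\<^sup>2(z/2)\<close>. Since \<open>Q e\<close> varies
    slowly, the recursion follows the quasi-stationary solution \<open>\<tau>\<^sup>2 r / (2 - 2 cos z) P G Q e\<close>, which is
    \<open>O(\<tau>\<^sup>2)\<close>; subtracting it leaves \<open>O(\<tau>\<^sup>4)\<close> (\<open>e_rest_step\<close>). The defect from \<open>P e\<close> has a factor
    \<open>z sin z\<close>, which pays for the \<open>1 / sin z\<close> of the discrete variation-of-constants formula and for
    \<open>\<parallel>P e\<parallel> \<le> K / \<omega>\<close>. In the first step, \<open>\<Omega>\<^sup>2 C\<^sub>B b\<^sub>0\<close> being bounded makes \<open>P C\<^sub>B b\<^sub>0\<close> small.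

  \<^item> The error of \<open>P p\<close> is multiplied by \<open>cos z\<close> in each step, so it is not amplified. It is driven by
    the different stationary responses \<open>P C\<^sub>B b / \<omega>\<^sup>2\<close> and \<open>\<kappa> P C\<^sub>B b / \<omega>\<^sup>2\<close> of the exact and the numerical
    oscillator to the slow force, and \<open>\<bar>1 - \<kappa>\<bar> \<le> K z\<^sup>2\<close> makes their difference \<open>O(\<tau>\<^sup>2)\<close> (\<open>P_p_err_bound\<close>).

  The bounds for \<open>Q e\<close>, \<open>P e\<close> and the half-step values of \<open>b\<close> involve \<open>\<tau>\<close> times the sum of the earlier
  errors of \<open>e\<close>; a discrete Gronwall argument closes them (\<open>e_error\<close>), and \<open>b_error\<close> and \<open>p_error\<close> follow.

  All of this takes place in abstract normed and inner product spaces. Real vectors of all dimensions embed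
  isometrically into one such space, that of finitely supported sequences, where curves can be
  differentiated as a whole.
\<close>

section \<open>Filter functions\<close>

lemma abs_one_minus_cos_le: "\<bar>1 - cos x\<bar> \<le> x\<^sup>2 / 2" for x :: real
proof -
  have "1 - cos x = 2 * (sin (x/2))\<^sup>2"
    using cos_double_sin[of "x/2"] by simp
  moreover have "(sin (x/2))\<^sup>2 \<le> (x/2)\<^sup>2"
    using abs_sin_x_le_abs_x[of "x/2"] by (metis abs_le_square_iff)
  ultimately show ?thesis by (simp add: power_divide)
qed

lemma abs_sinc_le_one: "\<bar>sinc x\<bar> \<le> 1"
  using abs_sin_x_le_abs_x[of x] by (auto simp: divide_simps)

lemma abs_one_minus_sinc_le: "\<bar>1 - sinc x\<bar> \<le> x\<^sup>2 / 2"
proof -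
  have pos: "\<bar>y - sin y\<bar> \<le> \<bar>y\<bar> * (y\<^sup>2 / 2)" if y: "y > 0" for y :: real
  proof -
    have "\<exists>t>0. t < y \<and> (y - sin y) - (0 - sin 0) = (y - 0) * (1 - cos t)"
      using y by (intro MVT2) (auto intro!: derivative_eq_intros)
    then obtain t where t: "0 < t" "t < y" "y - sin y = y * (1 - cos t)" by auto
    have "\<bar>1 - cos t\<bar> \<le> t\<^sup>2 / 2" by (rule abs_one_minus_cos_le)
    also have "\<dots> \<le> y\<^sup>2 / 2" using t by (simp add: power_mono)
    finally show ?thesis using t y by (simp add: abs_mult mult_left_mono)
  qed
  show ?thesis
  proof (cases "x = 0")
    case False
    have "\<bar>x - sin x\<bar> \<le> \<bar>x\<bar> * (x\<^sup>2 / 2)"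
      using pos[of x] pos[of "-x"] False by (cases "x > 0") auto
    moreover have "1 - sinc x = (x - sin x) / x" using False by (simp add: diff_divide_distrib)
    ultimately show ?thesis using False by (simp add: abs_divide divide_le_eq mult.commute)
  qed simp
qed

text \<open>The estimates for the two numbers \<open>\<psi> = \<psi>\<^sub>E(z/2)\<close> and \<open>\<phi> = \<phi>\<^sub>E(z/2)\<close> in the form in which the error
  analysis uses them. Here \<open>(cos z + 1) / 2 * \<psi>\<close> is the weight of the force in the two-step form of the
  scheme, and the inequalities after the first three compare a numerical weight with the exact one. The right-hand sides
  vanish where the resonances require it and are of the right order as \<open>z\<close> tends to 0.\<close>

definition admissible_filter_values :: "real \<Rightarrow> real \<Rightarrow> real \<Rightarrow> real \<Rightarrow> bool" where
  "admissible_filter_values K z \<psi> \<phi> \<longleftrightarrow>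
     \<bar>\<phi>\<bar> \<le> K \<and> \<bar>\<psi>\<bar> \<le> K \<and> \<bar>(cos z + 1) / 2 * \<psi>\<bar> \<le> K \<and>
     \<bar>(sin (z / 2) / (z / 2))\<^sup>2 - (cos z + 1) / 2 * \<psi>\<bar> \<le> K * (sin (z / 2))\<^sup>2 \<and>
     \<bar>sin z / z - (cos z + 1) / 2 * \<psi> * \<phi>\<bar> \<le> K * z * \<bar>sin z\<bar> \<and>
     \<bar>sin z / z - (cos z + 1) / 2 * \<psi>\<bar> \<le> K * z * \<bar>sin z\<bar> \<and>
     \<bar>sin (z / 2) / (z / 2) - \<phi>\<bar> \<le> K * z * \<bar>sin (z / 2)\<bar> \<and>
     \<bar>1 - \<phi>\<bar> \<le> K * z"

text \<open>Most of the estimates follow from \<open>\<bar>1 - sinc x\<bar> \<le> x\<^sup>2 / 2\<close> and \<open>\<bar>1 - cos x\<bar> \<le> x\<^sup>2 / 2\<close>. The bound by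
  \<open>sin\<^sup>2(z/2)\<close> needs two arguments: for \<open>z \<le> 1\<close> it is a bound by \<open>z\<^sup>2\<close>, which is consistency of the filter,
  and for \<open>z > 1\<close> both terms carry the factor \<open>sinc\<^sup>2(z/2)\<close> separately.\<close>

lemma admissible_filter_valuesI:
  fixes z \<psi> \<phi> :: real
  assumes z: "0 < z"
    and C: "0 < C1" "0 < C2" "0 < C4" "0 < C5" "0 < C6" "0 < C7"
    and F1: "\<bar>(cos z + 1) * \<psi>\<bar> \<le> C1 * (sinc (z / 2))\<^sup>2"
    and F2: "\<bar>\<phi>\<bar> \<le> C2 * \<bar>sinc (z / 2)\<bar>"
    and F4: "\<bar>(cos z + 1) * \<psi>\<bar> \<le> C4 * \<bar>sinc z\<bar>"
    and F5: "\<bar>sinc z - 1 / 2 * (cos z + 1) * \<psi>\<bar> \<le> C5 * z\<^sup>2 * \<bar>sinc z\<bar>"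
    and F6: "\<bar>sinc z - \<phi>\<bar> \<le> C6 * \<bar>z * sin (z / 2)\<bar>"
    and F7: "\<bar>\<psi>\<bar> \<le> C7"
    and K: "25 + 2 * C1 + C2 + 2 * C4 + C4 * C6 + 17 * C5 + C6 + C7 \<le> K"
  shows "admissible_filter_values K z \<psi> \<phi>"
proof -
  define \<Psi> where "\<Psi> = (cos z + 1) / 2 * \<psi>"
  have K': "c \<le> K" if "c \<le> 25 + 2 * C1 + C2 + 2 * C4 + C4 * C6 + 17 * C5 + C6 + C7" for c
    using that K by linarith
  have C46: "0 < C4 * C6" using C by simp
  have sz: "\<bar>sinc z\<bar> * z\<^sup>2 = z * \<bar>sin z\<bar>" using z by (simp add: abs_divide power2_eq_square)
  have \<Psi>1: "\<bar>\<Psi>\<bar> \<le> C1 / 2 * (sinc (z / 2))\<^sup>2" using F1 by (simp add: \<Psi>_def abs_mult)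
  have \<Psi>4: "\<bar>\<Psi>\<bar> \<le> C4 / 2 * \<bar>sinc z\<bar>" using F4 by (simp add: \<Psi>_def abs_mult)
  have \<Psi>5: "\<bar>sinc z - \<Psi>\<bar> \<le> C5 * (z * \<bar>sin z\<bar>)"
    using F5 sz by (simp add: \<Psi>_def mult.assoc mult.commute[of "z\<^sup>2"])
  have half: "\<bar>sin (z / 2)\<bar> \<le> z / 2" using abs_sin_x_le_abs_x[of "z/2"] z by simp
  have phi_half: "\<bar>sinc z - \<phi>\<bar> \<le> C6 * (z * \<bar>sin (z / 2)\<bar>)" using F6 z by (simp add: abs_mult)
  have a1: "\<bar>\<phi>\<bar> \<le> K"
  proof -
    have "C2 * \<bar>sinc (z / 2)\<bar> \<le> C2 * 1" using abs_sinc_le_one[of "z/2"] C by (intro mult_left_mono) auto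
    then show ?thesis using F2 K' C C46 by (intro K') linarith
  qed
  have a2: "\<bar>\<psi>\<bar> \<le> K" using F7 C C46 by (intro K') linarith
  have a3: "\<bar>\<Psi>\<bar> \<le> K"
  proof -
    have "C4 / 2 * \<bar>sinc z\<bar> \<le> C4 / 2 * 1" using abs_sinc_le_one[of z] C by (intro mult_left_mono) auto
    then show ?thesis using \<Psi>4 C C46 by (intro K') linarith
  qed
  have a6: "\<bar>sinc z - \<Psi>\<bar> \<le> K * z * \<bar>sin z\<bar>"
  proof -
    have "C5 * (z * \<bar>sin z\<bar>) \<le> K * (z * \<bar>sin z\<bar>)"
      using z C C46 by (intro mult_right_mono K') auto
    then show ?thesis using \<Psi>5 by (simp add: mult.assoc)
  qed
  have phi_sq: "\<bar>1 - \<phi>\<bar> \<le> (1 + C6) / 2 * z\<^sup>2"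
  proof -
    have "C6 * (z * \<bar>sin (z / 2)\<bar>) \<le> C6 * (z * (z / 2))"
      using half z C by (intro mult_left_mono) auto
    also have "\<dots> = C6 / 2 * z\<^sup>2" by (simp add: power2_eq_square)
    finally have "\<bar>1 - \<phi>\<bar> \<le> z\<^sup>2 / 2 + C6 / 2 * z\<^sup>2"
      using abs_one_minus_sinc_le[of z] phi_half by linarith
    then show ?thesis by (simp add: algebra_simps add_divide_distrib)
  qed
  have a5: "\<bar>sinc z - \<Psi> * \<phi>\<bar> \<le> K * z * \<bar>sin z\<bar>"
  proof -
    have "\<bar>\<Psi> * (1 - \<phi>)\<bar> \<le> (C4 / 2 * \<bar>sinc z\<bar>) * ((1 + C6) / 2 * z\<^sup>2)"
      unfolding abs_mult using \<Psi>4 phi_sq C by (intro mult_mono) auto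
    also have "\<dots> = C4 / 2 * ((1 + C6) / 2) * (\<bar>sinc z\<bar> * z\<^sup>2)" by (simp add: algebra_simps)
    also have "\<dots> = C4 / 2 * ((1 + C6) / 2) * (z * \<bar>sin z\<bar>)" by (simp only: sz)
    finally have "\<bar>\<Psi> * (1 - \<phi>)\<bar> \<le> (C4 + C4 * C6) / 4 * (z * \<bar>sin z\<bar>)" by (simp add: field_simps)
    moreover have "sinc z - \<Psi> * \<phi> = (sinc z - \<Psi>) + \<Psi> * (1 - \<phi>)" by (simp add: algebra_simps)
    ultimately have "\<bar>sinc z - \<Psi> * \<phi>\<bar> \<le> C5 * (z * \<bar>sin z\<bar>) + (C4 + C4 * C6) / 4 * (z * \<bar>sin z\<bar>)"
      using \<Psi>5 by linarith
    also have "\<dots> = (C5 + (C4 + C4 * C6) / 4) * (z * \<bar>sin z\<bar>)" by (simp add: algebra_simps)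
    also have "\<dots> \<le> K * (z * \<bar>sin z\<bar>)"
      using z C C46 by (intro mult_right_mono K') auto
    finally show ?thesis by (simp add: mult.assoc)
  qed
  have a7: "\<bar>sinc (z / 2) - \<phi>\<bar> \<le> K * z * \<bar>sin (z / 2)\<bar>"
  proof -
    have "sin z = 2 * sin (z / 2) * cos (z / 2)" using sin_double[of "z/2"] by simp
    then have "sinc (z / 2) - sinc z = 2 * sin (z / 2) / z * (1 - cos (z / 2))"
      using z by (simp add: field_simps)
    then have "\<bar>sinc (z / 2) - sinc z\<bar> = 2 * \<bar>sin (z / 2)\<bar> / z * \<bar>1 - cos (z / 2)\<bar>"
      using z by (simp add: abs_mult)
    also have "\<dots> \<le> 2 * \<bar>sin (z / 2)\<bar> / z * ((z / 2)\<^sup>2 / 2)"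
      using abs_one_minus_cos_le[of "z/2"] z by (intro mult_left_mono) auto
    also have "\<dots> = 1/4 * (z * \<bar>sin (z / 2)\<bar>)" using z by (simp add: field_simps power2_eq_square)
    finally have "\<bar>sinc (z / 2) - \<phi>\<bar> \<le> (1/4 + C6) * (z * \<bar>sin (z / 2)\<bar>)"
      using phi_half by (simp only: distrib_right)
    also have "\<dots> \<le> K * (z * \<bar>sin (z / 2)\<bar>)"
      using z C C46 by (intro mult_right_mono K') auto
    finally show ?thesis by (simp add: mult.assoc)
  qed
  have a8: "\<bar>1 - \<phi>\<bar> \<le> K * z"
  proof -
    have "\<bar>1 - sinc z\<bar> \<le> z"
    proof (cases "z \<le> 2")
      case True
      then have "z * z \<le> z * 2" using z by (intro mult_left_mono) auto
      then show ?thesis using abs_one_minus_sinc_le[of z] by (simp add: power2_eq_square)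
    next
      case False
      then show ?thesis using abs_sinc_le_one[of z] by linarith
    qed
    moreover have "C6 * (z * \<bar>sin (z / 2)\<bar>) \<le> C6 * (z * 1)"
      using z C by (intro mult_left_mono) auto
    ultimately have "\<bar>1 - \<phi>\<bar> \<le> (1 + C6) * z" using phi_half by (simp add: algebra_simps)
    also have "\<dots> \<le> K * z" using z C C46 by (intro mult_right_mono K') auto
    finally show ?thesis .
  qed
  have a4: "\<bar>(sinc (z / 2))\<^sup>2 - \<Psi>\<bar> \<le> K * (sin (z / 2))\<^sup>2"
  proof (cases "z \<le> 1")
    case True
    have "(z / 2)\<^sup>2 / 2 \<le> (1 / 2)\<^sup>2 / 2"
      using True z by (intro divide_right_mono power_mono) auto
    also have "\<dots> = 1 / 8" by (simp add: power2_eq_square)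
    finally have "\<bar>1 - sinc (z / 2)\<bar> \<le> 1 / 8"
      using abs_one_minus_sinc_le[of "z/2"] by (rule order_trans[rotated])
    then have "1 - sinc (z / 2) \<le> 1 / 8" by linarith
    then have "7 / 8 \<le> sin (z / 2) / (z / 2)" using z by simp
    then have "7 / 8 * (z / 2) \<le> sin (z / 2)" using z by (simp only: le_divide_eq)
    then have "z / 4 \<le> sin (z / 2)" using z by simp
    then have "(z / 4)\<^sup>2 \<le> (sin (z / 2))\<^sup>2" using z by (intro power_mono) auto
    then have zs: "z\<^sup>2 \<le> 16 * (sin (z / 2))\<^sup>2" by (simp add: power_divide)
    have "\<bar>1 - (sinc (z / 2))\<^sup>2\<bar> = \<bar>1 - sinc (z / 2)\<bar> * \<bar>1 + sinc (z / 2)\<bar>"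
      by (simp only: abs_mult[symmetric]) (simp add: algebra_simps power2_eq_square)
    also have "\<dots> \<le> ((z / 2)\<^sup>2 / 2) * 2"
      using abs_one_minus_sinc_le[of "z/2"] abs_sinc_le_one[of "z/2"] by (intro mult_mono) auto
    finally have "\<bar>1 - (sinc (z / 2))\<^sup>2\<bar> \<le> z\<^sup>2 / 4" by (simp add: power_divide)
    moreover have "C5 * (z * \<bar>sin z\<bar>) \<le> C5 * z\<^sup>2"
      using abs_sin_x_le_abs_x[of z] z C by (auto intro!: mult_left_mono simp: power2_eq_square)
    ultimately have "\<bar>(sinc (z / 2))\<^sup>2 - \<Psi>\<bar> \<le> (1 + C5) * z\<^sup>2"
      using abs_one_minus_sinc_le[of z] \<Psi>5 zero_le_power2[of z] unfolding distrib_right by linarith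
    also have "\<dots> \<le> (1 + C5) * (16 * (sin (z / 2))\<^sup>2)" using zs C by (intro mult_left_mono) auto
    also have "\<dots> = (16 + 16 * C5) * (sin (z / 2))\<^sup>2" by (simp add: algebra_simps)
    also have "\<dots> \<le> K * (sin (z / 2))\<^sup>2" using C C46 by (intro mult_right_mono K') auto
    finally show ?thesis .
  next
    case False
    have "(sinc (z / 2))\<^sup>2 = 4 * (sin (z / 2))\<^sup>2 / z\<^sup>2" using z by (simp add: power_divide power_mult_distrib)
    also have "\<dots> \<le> 4 * (sin (z / 2))\<^sup>2 / 1"
      using False by (intro divide_left_mono) auto
    finally have s4: "(sinc (z / 2))\<^sup>2 \<le> 4 * (sin (z / 2))\<^sup>2" by simp
    have "\<bar>(sinc (z / 2))\<^sup>2 - \<Psi>\<bar> \<le> (1 + C1 / 2) * (sinc (z / 2))\<^sup>2"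
      using \<Psi>1 zero_le_power2[of "sinc (z/2)"] unfolding distrib_right by linarith
    also have "\<dots> \<le> (1 + C1 / 2) * (4 * (sin (z / 2))\<^sup>2)" using s4 C by (intro mult_left_mono) auto
    also have "\<dots> = (4 + 2 * C1) * (sin (z / 2))\<^sup>2" by (simp add: algebra_simps)
    also have "\<dots> \<le> K * (sin (z / 2))\<^sup>2" using C C46 by (intro mult_right_mono K') auto
    finally show ?thesis .
  qed
  show ?thesis
    using a1 a2 a3 a4 a5 a6 a7 a8 z
    unfolding admissible_filter_values_def \<Psi>_def[symmetric] by simp
qed

section \<open>Perturbed oscillators\<close>

lemma norm_diff_mono: "norm a \<le> r \<Longrightarrow> norm b \<le> s \<Longrightarrow> norm (a - b) \<le> r + s"
  using norm_triangle_ineq4[of a b] by linarith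

lemma vector_derivative_bound_interval:
  fixes g :: "real \<Rightarrow> 'a::real_normed_vector"
  assumes deriv: "\<And>r. r \<in> {a..b} \<Longrightarrow> (g has_vector_derivative g' r) (at r within {a..b})"
    and bound: "\<And>r. r \<in> {a..b} \<Longrightarrow> norm (g' r) \<le> C"
    and s: "s \<in> {a..b}" and t: "t \<in> {a..b}"
  shows "norm (g s - g t) \<le> C * \<bar>s - t\<bar>"
proof -
  have "norm (g s - g t) \<le> C * norm (s - t)"
  proof (rule differentiable_bound[of "{a..b}" g "\<lambda>r h. h *\<^sub>R g' r"])
    show "(g has_derivative (\<lambda>h. h *\<^sub>R g' r)) (at r within {a..b})" if "r \<in> {a..b}" for r
      using deriv[OF that] by (simp add: has_vector_derivative_def)
    show "onorm (\<lambda>h. h *\<^sub>R g' r) \<le> C" if "r \<in> {a..b}" for r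
      using bound[OF that] by (intro onorm_le) (simp add: mult.commute[of C] mult_left_mono)
  qed (use s t in auto)
  then show ?thesis by simp
qed

text \<open>The solution of \<open>y'' = - l\<^sup>2 y\<close> with \<open>y(0) = 0\<close>, \<open>y'(0) = 1\<close>. The frequency \<open>l = 0\<close> is included so that the
  slow components need no separate treatment.\<close>

definition osc_sin :: "real \<Rightarrow> real \<Rightarrow> real" where
  "osc_sin l s = (if l = 0 then s else sin (l * s) / l)"

lemma osc_sin_zero [simp]: "osc_sin l 0 = 0"
  by (simp add: osc_sin_def)

lemma abs_osc_sin_le: "\<bar>osc_sin l s\<bar> \<le> \<bar>s\<bar>"
  using abs_sin_x_le_abs_x[of "l * s"] by (auto simp: osc_sin_def abs_mult divide_le_eq mult.commute)

lemma has_real_derivative_osc_sin: "(osc_sin l has_real_derivative cos (l * s)) (at s within S)"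
proof (cases "l = 0")
  case True
  have "osc_sin l = (\<lambda>s. s)" using True by (auto simp: osc_sin_def fun_eq_iff)
  then show ?thesis using True by simp
next
  case False
  have "((\<lambda>s. sin (l * s) / l) has_real_derivative cos (l * s)) (at s within S)"
    using False by (auto intro!: derivative_eq_intros)
  moreover have "osc_sin l = (\<lambda>s. sin (l * s) / l)" using False by (auto simp: osc_sin_def fun_eq_iff)
  ultimately show ?thesis by simp
qed

text \<open>The variation-of-constants formula without integrals: the curve
  \<open>cos (l (s - r)) x(r) + osc_sin l (s - r) v(r)\<close> is constant in \<open>r\<close> for the unperturbed oscillator, has
  derivative \<open>osc_sin l (s - r) f(r)\<close> in general, and runs from the unperturbed value at \<open>r = t\<close> to \<open>x(s)\<close> at
  \<open>r = s\<close>. The kernel is at most \<open>\<bar>s - t\<bar>\<close>, so the bound does not depend on \<open>l\<close>.\<close>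

lemma perturbed_oscillator:
  fixes x v :: "real \<Rightarrow> 'a::real_normed_vector"
  assumes x': "\<And>r. r \<in> {a..b} \<Longrightarrow> (x has_vector_derivative v r) (at r within {a..b})"
    and v': "\<And>r. r \<in> {a..b} \<Longrightarrow> (v has_vector_derivative f r - l\<^sup>2 *\<^sub>R x r) (at r within {a..b})"
    and f: "\<And>r. r \<in> {a..b} \<Longrightarrow> norm (f r) \<le> F"
    and s: "s \<in> {a..b}" and t: "t \<in> {a..b}"
  shows "norm (x s - (cos (l * (s - t)) *\<^sub>R x t + osc_sin l (s - t) *\<^sub>R v t)) \<le> F * (s - t)\<^sup>2"
    and "norm (v s - (cos (l * (s - t)) *\<^sub>R v t - (l * sin (l * (s - t))) *\<^sub>R x t)) \<le> F * \<bar>s - t\<bar>"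
proof -
  define J where "J = {min s t..max s t}"
  have J: "J \<subseteq> {a..b}" using s t by (auto simp: J_def)
  have xJ: "(x has_vector_derivative v r) (at r within J)"
    and vJ: "(v has_vector_derivative f r - l\<^sup>2 *\<^sub>R x r) (at r within J)" if "r \<in> J" for r
    using has_vector_derivative_within_subset[OF x' J] has_vector_derivative_within_subset[OF v' J]
      that J by auto
  have F0: "0 \<le> F" using f[OF s] norm_ge_zero order_trans by blast
  have Jd: "\<bar>s - r\<bar> \<le> \<bar>s - t\<bar>" if "r \<in> J" for r using that by (auto simp: J_def)
  have sn': "((\<lambda>r. osc_sin l (s - r)) has_real_derivative - cos (l * (s - r))) (at r within J)" for r
  proof -
    have "((\<lambda>r. s - r) has_real_derivative - 1) (at r within J)"
      by (auto intro!: derivative_eq_intros)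
    from DERIV_chain2[where f = "osc_sin l" and g = "\<lambda>r. s - r", OF has_real_derivative_osc_sin this]
    show ?thesis by simp
  qed
  have cos': "((\<lambda>r. cos (l * (s - r))) has_real_derivative l * sin (l * (s - r))) (at r within J)" for r
    by (auto intro!: derivative_eq_intros)
  have sin': "((\<lambda>r. l * sin (l * (s - r))) has_real_derivative - (l\<^sup>2 * cos (l * (s - r)))) (at r within J)" for r
    by (auto intro!: derivative_eq_intros simp: power2_eq_square)
  have lsn: "l\<^sup>2 * osc_sin l r = l * sin (l * r)" for r by (simp add: osc_sin_def power2_eq_square)
  have ep: "s \<in> {min s t..max s t}" "t \<in> {min s t..max s t}" by auto
  define g where "g r = cos (l * (s - r)) *\<^sub>R x r + osc_sin l (s - r) *\<^sub>R v r" for r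
  have "(g has_vector_derivative osc_sin l (s - r) *\<^sub>R f r) (at r within J)" if r: "r \<in> J" for r
  proof -
    have "(g has_vector_derivative (cos (l * (s - r)) *\<^sub>R v r + (l * sin (l * (s - r))) *\<^sub>R x r)
        + (osc_sin l (s - r) *\<^sub>R (f r - l\<^sup>2 *\<^sub>R x r) + (- cos (l * (s - r))) *\<^sub>R v r)) (at r within J)"
      unfolding g_def
      by (intro has_vector_derivative_add has_vector_derivative_scaleR sn' cos' xJ vJ r)
    moreover have "(cos (l * (s - r)) *\<^sub>R v r + (l * sin (l * (s - r))) *\<^sub>R x r)
        + (osc_sin l (s - r) *\<^sub>R (f r - l\<^sup>2 *\<^sub>R x r) + (- cos (l * (s - r))) *\<^sub>R v r)
        = osc_sin l (s - r) *\<^sub>R f r + (l * sin (l * (s - r)) - l\<^sup>2 * osc_sin l (s - r)) *\<^sub>R x r"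
      by (simp add: algebra_simps)
    ultimately show ?thesis by (simp add: lsn)
  qed
  moreover have "norm (osc_sin l (s - r) *\<^sub>R f r) \<le> \<bar>s - t\<bar> * F" if r: "r \<in> J" for r
    using abs_osc_sin_le[of l "s - r"] Jd[OF r] f[of r] r J F0 by (auto intro!: mult_mono)
  ultimately have "norm (g s - g t) \<le> (\<bar>s - t\<bar> * F) * \<bar>s - t\<bar>"
    using ep unfolding J_def by (rule vector_derivative_bound_interval)
  then show "norm (x s - (cos (l * (s - t)) *\<^sub>R x t + osc_sin l (s - t) *\<^sub>R v t)) \<le> F * (s - t)\<^sup>2"
    using osc_sin_zero by (simp add: g_def power2_eq_square mult.assoc mult.left_commute[of _ F])
  define k where "k r = cos (l * (s - r)) *\<^sub>R v r - (l * sin (l * (s - r))) *\<^sub>R x r" for r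
  have "(k has_vector_derivative cos (l * (s - r)) *\<^sub>R f r) (at r within J)" if r: "r \<in> J" for r
  proof -
    have "(k has_vector_derivative
        (cos (l * (s - r)) *\<^sub>R (f r - l\<^sup>2 *\<^sub>R x r) + (l * sin (l * (s - r))) *\<^sub>R v r)
        - ((l * sin (l * (s - r))) *\<^sub>R v r + (- (l\<^sup>2 * cos (l * (s - r)))) *\<^sub>R x r)) (at r within J)"
      unfolding k_def
      by (intro has_vector_derivative_diff has_vector_derivative_scaleR sin' cos' xJ vJ r)
    then show ?thesis by (simp add: algebra_simps)
  qed
  moreover have "norm (cos (l * (s - r)) *\<^sub>R f r) \<le> F" if r: "r \<in> J" for r
    using f[of r] r J F0 abs_cos_le_one[of "l * (s - r)"]
    by (auto intro!: mult_mono[of "\<bar>cos (l * (s - r))\<bar>" 1 "norm (f r)" F, simplified])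
  ultimately have "norm (k s - k t) \<le> F * \<bar>s - t\<bar>"
    using ep unfolding J_def by (rule vector_derivative_bound_interval)
  then show "norm (v s - (cos (l * (s - t)) *\<^sub>R v t - (l * sin (l * (s - t))) *\<^sub>R x t)) \<le> F * \<bar>s - t\<bar>"
    by (simp add: k_def)
qed

text \<open>The terms with \<open>v t\<close> have opposite signs on the two sides in the first combination and equal ones in
  the second, so that they cancel.\<close>

lemma perturbed_oscillator_symmetric:
  fixes x v :: "real \<Rightarrow> 'a::real_normed_vector"
  assumes x': "\<And>r. r \<in> {a..b} \<Longrightarrow> (x has_vector_derivative v r) (at r within {a..b})"
    and v': "\<And>r. r \<in> {a..b} \<Longrightarrow> (v has_vector_derivative f r - l\<^sup>2 *\<^sub>R x r) (at r within {a..b})"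
    and f: "\<And>r. r \<in> {a..b} \<Longrightarrow> norm (f r) \<le> F"
    and t: "t - h \<in> {a..b}" "t + h \<in> {a..b}" and h: "0 \<le> h"
  shows "norm (x (t + h) + x (t - h) - (2 * cos (l * h)) *\<^sub>R x t) \<le> 2 * F * h\<^sup>2"
    and "norm (v (t + h) - v (t - h) + (2 * l * sin (l * h)) *\<^sub>R x t) \<le> 2 * F * h"
proof -
  have t0: "t \<in> {a..b}" using t h by auto
  have osc_sin: "osc_sin l (- h) = - osc_sin l h" by (simp add: osc_sin_def)
  have po: "norm (x s - (cos (l * (s - t)) *\<^sub>R x t + osc_sin l (s - t) *\<^sub>R v t)) \<le> F * (s - t)\<^sup>2"
    "norm (v s - (cos (l * (s - t)) *\<^sub>R v t - (l * sin (l * (s - t))) *\<^sub>R x t)) \<le> F * \<bar>s - t\<bar>"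
    if "s \<in> {a..b}" for s
    by (rule perturbed_oscillator[OF x' v' f that t0]; assumption)+
  have "norm (x (t + h) + x (t - h) - (2 * cos (l * h)) *\<^sub>R x t)
      = norm ((x (t + h) - (cos (l * h) *\<^sub>R x t + osc_sin l h *\<^sub>R v t))
        + (x (t - h) - (cos (l * h) *\<^sub>R x t - osc_sin l h *\<^sub>R v t)))"
    by (rule arg_cong[where f = norm]) (simp add: algebra_simps scaleR_2 flip: scaleR_scaleR)
  also have "\<dots> \<le> F * h\<^sup>2 + F * h\<^sup>2"
    using po(1)[OF t(2)] po(1)[OF t(1)] by (intro norm_triangle_mono) (simp_all add: osc_sin)
  finally show "norm (x (t + h) + x (t - h) - (2 * cos (l * h)) *\<^sub>R x t) \<le> 2 * F * h\<^sup>2" by simp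
  have "norm (v (t + h) - v (t - h) + (2 * l * sin (l * h)) *\<^sub>R x t)
      = norm ((v (t + h) - (cos (l * h) *\<^sub>R v t - (l * sin (l * h)) *\<^sub>R x t))
        - (v (t - h) - (cos (l * h) *\<^sub>R v t + (l * sin (l * h)) *\<^sub>R x t)))"
    by (rule arg_cong[where f = norm]) (simp add: algebra_simps scaleR_2 flip: scaleR_scaleR)
  also have "\<dots> \<le> F * h + F * h"
    using po(2)[OF t(2)] po(2)[OF t(1)] h
    by (intro norm_diff_mono) simp_all
  finally show "norm (v (t + h) - v (t - h) + (2 * l * sin (l * h)) *\<^sub>R x t) \<le> 2 * F * h" by simp
qed

lemma has_vector_derivative_translate:
  assumes "(x has_vector_derivative d) (at (t + r) within I)" "\<And>r. r \<in> S \<Longrightarrow> t + r \<in> I"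
  shows "((\<lambda>r. x (t + r)) has_vector_derivative d) (at r within S)"
proof -
  have "(x has_vector_derivative d) (at (t + r) within (\<lambda>r. t + r) ` S)"
    using assms by (auto intro: has_vector_derivative_within_subset)
  then have "((x \<circ> (\<lambda>r. t + r)) has_vector_derivative 1 *\<^sub>R d) (at r within S)"
    by (intro vector_diff_chain_within) (auto intro!: derivative_eq_intros)
  then show ?thesis by (simp add: o_def)
qed

lemma has_vector_derivative_reflect:
  assumes "(x has_vector_derivative d) (at (t - r) within I)" "\<And>r. r \<in> S \<Longrightarrow> t - r \<in> I"
  shows "((\<lambda>r. x (t - r)) has_vector_derivative - d) (at r within S)"
proof -
  have "(x has_vector_derivative d) (at (t - r) within (\<lambda>r. t - r) ` S)"
    using assms by (auto intro: has_vector_derivative_within_subset)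
  then have "((x \<circ> (\<lambda>r. t - r)) has_vector_derivative (-1) *\<^sub>R d) (at r within S)"
    by (intro vector_diff_chain_within) (auto intro!: derivative_eq_intros)
  then show ?thesis by (simp add: o_def)
qed

section \<open>Linear two-step recursions\<close>

text \<open>The fundamental solution \<open>sin (k z) / sin z\<close> of \<open>x (k + 2) = 2 cos z x (k + 1) - x k\<close>. The recursion defines
  it also where \<open>sin z = 0\<close>, and makes the bound by \<open>k\<close> obvious.\<close>

primrec cheb :: "real \<Rightarrow> nat \<Rightarrow> real" where
  "cheb z 0 = 0"
| "cheb z (Suc k) = cos z * cheb z k + cos (real k * z)"

lemma cheb_mult_sin: "cheb z k * sin z = sin (real k * z)"
  by (induction k) (simp_all add: algebra_simps sin_add)

lemma cheb_three_term: "cheb z (Suc (Suc k)) = 2 * cos z * cheb z (Suc k) - cheb z k"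
proof -
  have "cos z * cos z = 1 - sin z * sin z"
    using sin_cos_squared_add[of z] by (simp add: power2_eq_square)
  then have "(cos z * cos z) * cheb z k = (1 - sin z * sin z) * cheb z k" by simp
  then have "cos z * (cos z * cheb z k) = cheb z k - sin z * (cheb z k * sin z)"
    by (simp add: algebra_simps)
  moreover have "cos (real (Suc k) * z) = cos z * cos (real k * z) - sin z * (cheb z k * sin z)"
    unfolding cheb_mult_sin by (simp add: distrib_right cos_add)
  ultimately show ?thesis by (simp add: algebra_simps del: of_nat_Suc)
qed

lemma abs_cheb_le: "\<bar>cheb z k\<bar> \<le> real k"
proof (induction k)
  case (Suc k)
  have "\<bar>cos z * cheb z k\<bar> \<le> \<bar>cheb z k\<bar>"
    by (simp add: abs_mult mult_left_le_one_le)
  moreover have "\<bar>cheb z (Suc k)\<bar> \<le> \<bar>cos z * cheb z k\<bar> + \<bar>cos (real k * z)\<bar>" by simp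
  ultimately show ?case using Suc abs_cos_le_one[of "real k * z"] unfolding of_nat_Suc by linarith
qed simp

lemma two_step_variation_of_constants:
  fixes x :: "nat \<Rightarrow> 'a::real_vector"
  shows "x n = cos (real n * z) *\<^sub>R x 0 + cheb z n *\<^sub>R (x 1 - cos z *\<^sub>R x 0)
    + (\<Sum>j=1..<n. cheb z (n - j) *\<^sub>R (x (Suc j) - (2 * cos z) *\<^sub>R x j + x (j - 1)))"
proof (induction n rule: less_induct)
  case (less n)
  define d where "d j = x (Suc j) - (2 * cos z) *\<^sub>R x j + x (j - 1)" for j
  consider "n = 0" | "n = 1" | k where "n = Suc (Suc k)" by (cases n; cases "n - 1") auto
  then show ?case
  proof cases
    case 3
    have cosr: "cos (real n * z) = 2 * cos z * cos (real (Suc k) * z) - cos (real k * z)"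
      using cos_add[of "real (Suc k) * z" z] cos_diff[of "real (Suc k) * z" z]
      by (simp add: 3 algebra_simps)
    have sum: "(\<Sum>j=1..<n. cheb z (n - j) *\<^sub>R d j)
      = d (Suc k) + ((2 * cos z) *\<^sub>R (\<Sum>j=1..<Suc k. cheb z (Suc k - j) *\<^sub>R d j)
        - (\<Sum>j=1..<k. cheb z (k - j) *\<^sub>R d j))"
    proof -
      have "(\<Sum>j=1..<n. cheb z (n - j) *\<^sub>R d j)
          = d (Suc k) + (\<Sum>j=1..<Suc k. cheb z (n - j) *\<^sub>R d j)"
        by (simp add: 3 add.commute)
      also have "(\<Sum>j=1..<Suc k. cheb z (n - j) *\<^sub>R d j)
          = (\<Sum>j=1..<Suc k. (2 * cos z * cheb z (Suc k - j) - cheb z (k - j)) *\<^sub>R d j)"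
      proof (rule sum.cong)
        fix j assume "j \<in> {1..<Suc k}"
        then have "n - j = Suc (Suc (k - j))" "Suc k - j = Suc (k - j)" using 3 by auto
        then show "cheb z (n - j) *\<^sub>R d j = (2 * cos z * cheb z (Suc k - j) - cheb z (k - j)) *\<^sub>R d j"
          by (simp only: cheb_three_term)
      qed simp
      also have "\<dots> = (2 * cos z) *\<^sub>R (\<Sum>j=1..<Suc k. cheb z (Suc k - j) *\<^sub>R d j)
          - (\<Sum>j=1..<Suc k. cheb z (k - j) *\<^sub>R d j)"
        by (simp only: scaleR_left_diff_distrib sum_subtractf scaleR_sum_right scaleR_scaleR)
      also have "(\<Sum>j=1..<Suc k. cheb z (k - j) *\<^sub>R d j) = (\<Sum>j=1..<k. cheb z (k - j) *\<^sub>R d j)"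
        by (cases k) auto
      finally show ?thesis .
    qed
    have i1: "x (Suc k) = cos (real (Suc k) * z) *\<^sub>R x 0 + cheb z (Suc k) *\<^sub>R (x 1 - cos z *\<^sub>R x 0)
        + (\<Sum>j=1..<Suc k. cheb z (Suc k - j) *\<^sub>R d j)"
      using less.IH[of "Suc k"] 3 by (simp add: d_def del: cheb.simps)
    have i2: "x k = cos (real k * z) *\<^sub>R x 0 + cheb z k *\<^sub>R (x 1 - cos z *\<^sub>R x 0)
        + (\<Sum>j=1..<k. cheb z (k - j) *\<^sub>R d j)"
      using less.IH[of k] 3 by (simp add: d_def del: cheb.simps)
    have "x n = d (Suc k) + (2 * cos z) *\<^sub>R x (Suc k) - x k" by (simp add: d_def 3)
    also have "\<dots> = (2 * cos z * cos (real (Suc k) * z) - cos (real k * z)) *\<^sub>R x 0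
        + (2 * cos z * cheb z (Suc k) - cheb z k) *\<^sub>R (x 1 - cos z *\<^sub>R x 0)
        + (\<Sum>j=1..<n. cheb z (n - j) *\<^sub>R d j)"
      unfolding sum
      by (subst i1, subst i2)
        (simp only: scaleR_right_distrib scaleR_left_diff_distrib scaleR_scaleR, simp only: algebra_simps)
    also have "2 * cos z * cheb z (Suc k) - cheb z k = cheb z n"
      by (simp only: 3 cheb_three_term)
    finally show ?thesis unfolding cosr d_def by simp
  qed auto
qed

text \<open>By induction, \<open>a\<close> plus \<open>h\<close> times the sum is at most \<open>a (1 + h)\<^sup>n\<close>.\<close>

lemma discrete_gronwall:
  fixes x :: "nat \<Rightarrow> real"
  assumes "\<And>n. n \<le> m \<Longrightarrow> x n \<le> a + h * (\<Sum>j<n. x j)" and "0 \<le> h" "0 \<le> a"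
  shows "n \<le> m \<Longrightarrow> x n \<le> a * exp (h * real n)"
proof -
  assume n: "n \<le> m"
  have sum: "a + h * (\<Sum>j<n. x j) \<le> a * (1 + h) ^ n" if "n \<le> m" for n
    using that
  proof (induction n)
    case (Suc n)
    have "a + h * (\<Sum>j<Suc n. x j) = (a + h * (\<Sum>j<n. x j)) + h * x n" by (simp add: algebra_simps)
    also have "\<dots> \<le> (a + h * (\<Sum>j<n. x j)) + h * (a + h * (\<Sum>j<n. x j))"
      using assms(1)[of n] Suc.prems assms(2) by (intro add_left_mono mult_left_mono) auto
    also have "\<dots> = (1 + h) * (a + h * (\<Sum>j<n. x j))" by (simp add: algebra_simps)
    also have "\<dots> \<le> (1 + h) * (a * (1 + h) ^ n)"
      using Suc assms(2) by (intro mult_left_mono) auto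
    finally show ?case by (simp add: algebra_simps)
  qed simp
  have "x n \<le> a * (1 + h) ^ n" using assms(1)[OF n] sum[OF n] by linarith
  also have "\<dots> \<le> a * exp h ^ n"
    using assms(2,3) exp_ge_add_one_self[of h] by (intro mult_left_mono power_mono) auto
  also have "\<dots> = a * exp (h * real n)" by (simp add: exp_of_nat_mult[symmetric] mult.commute)
  finally show ?thesis .
qed

section \<open>Conservation of energy\<close>

text \<open>The energy \<open>\<parallel>e'\<parallel>\<^sup>2 + \<omega>\<^sup>2 \<parallel>P e\<parallel>\<^sup>2 + \<langle>e, A B e\<rangle>\<close> is constant since \<open>e'' = - A B e - \<omega>\<^sup>2 P e\<close> and since \<open>P\<close> and
  \<open>A B\<close> are symmetric. Initially it is at most \<open>(4/3 + 2/3 + 2) H\<^sub>0\<close>.\<close>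

lemma energy_bounds:
  fixes P :: "'a::real_inner \<Rightarrow> 'a" and A :: "'b::real_normed_vector \<Rightarrow> 'a" and B :: "'a \<Rightarrow> 'b"
  assumes P: "bounded_linear P" and A: "bounded_linear A" and B: "bounded_linear B"
    and P_P: "\<And>x. P (P x) = P x" and P_sym: "\<And>x y. inner (P x) y = inner x (P y)"
    and AB_sym: "\<And>x y. inner (A (B x)) y = inner x (A (B y))"
    and AB_nonneg: "\<And>x. 0 \<le> inner x (A (B x))"
    and p': "\<And>t. t \<in> {t0..T} \<Longrightarrow> (p has_vector_derivative e t) (at t within {t0..T})"
    and e': "\<And>t. t \<in> {t0..T} \<Longrightarrow>
      (e has_vector_derivative A (b t) - \<omega>\<^sup>2 *\<^sub>R P (p t)) (at t within {t0..T})"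
    and b': "\<And>t. t \<in> {t0..T} \<Longrightarrow> (b has_vector_derivative - B (e t)) (at t within {t0..T})"
    and i1: "(norm (\<omega> *\<^sub>R P (e t0)))\<^sup>2 \<le> 2 / 3 * H0" and i2: "(norm (A (b t0)))\<^sup>2 \<le> 1 / 3 * H0"
    and i3: "(norm (\<omega>\<^sup>2 *\<^sub>R P (p t0)))\<^sup>2 \<le> 1 / 3 * H0" and i4: "inner (e t0) (A (B (e t0))) \<le> 2 * H0"
    and \<omega>: "0 < \<omega>" and t: "t \<in> {t0..T}"
  shows "norm (A (b t) - \<omega>\<^sup>2 *\<^sub>R P (p t)) \<le> 2 * sqrt H0" and "\<omega> * norm (P (e t)) \<le> 2 * sqrt H0"
proof -
  interpret P: bounded_linear P by (rule P)
  interpret A: bounded_linear A by (rule A)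
  interpret B: bounded_linear B by (rule B)
  define de where "de t = A (b t) - \<omega>\<^sup>2 *\<^sub>R P (p t)" for t
  define En where "En t = inner (de t) (de t) + (\<omega>\<^sup>2 * inner (P (e t)) (P (e t)) + inner (e t) (A (B (e t))))" for t
  note inner_deriv = bounded_bilinear.has_vector_derivative[OF bounded_bilinear_inner]
  have "(En has_vector_derivative 0) (at t within {t0..T})" if t: "t \<in> {t0..T}" for t
  proof -
    have de': "(de has_vector_derivative - A (B (e t)) - \<omega>\<^sup>2 *\<^sub>R P (e t)) (at t within {t0..T})"
    proof -
      have "(de has_vector_derivative A (- B (e t)) - (\<omega>\<^sup>2 *\<^sub>R P (e t) + 0 *\<^sub>R P (p t))) (at t within {t0..T})"
        unfolding de_def[abs_def]
        by (intro has_vector_derivative_diff has_vector_derivative_scaleR A.has_vector_derivative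
            P.has_vector_derivative b' p' t DERIV_const)
      then show ?thesis by (simp add: A.neg)
    qed
    have e1: "(e has_vector_derivative de t) (at t within {t0..T})"
      using e'[OF t] by (simp add: de_def)
    define g where "g = - A (B (e t)) - \<omega>\<^sup>2 *\<^sub>R P (e t)"
    have "(En has_vector_derivative (inner (de t) g + inner g (de t))
        + (\<omega>\<^sup>2 * (inner (P (e t)) (P (de t)) + inner (P (de t)) (P (e t)))
          + (inner (e t) (A (B (de t))) + inner (de t) (A (B (e t)))))) (at t within {t0..T})"
      unfolding En_def[abs_def] g_def
      by (intro has_vector_derivative_add has_vector_derivative_mult_right inner_deriv
          P.has_vector_derivative A.has_vector_derivative B.has_vector_derivative de' e1)
    moreover have "inner (P (e t)) (P (de t)) = inner (de t) (P (e t))"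
      using P_sym[of "e t" "P (de t)"] P_sym[of "e t" "de t"] by (simp add: P_P inner_commute)
    moreover have "inner (e t) (A (B (de t))) = inner (de t) (A (B (e t)))"
      using AB_sym[of "e t" "de t"] by (simp add: inner_commute)
    ultimately show ?thesis
      by (simp add: g_def inner_diff_right inner_diff_left inner_commute[of _ "de t"]
          inner_commute[of "P (de t)"] algebra_simps)
  qed
  then have "norm (En t - En t0) \<le> 0 * \<bar>t - t0\<bar>"
    using t by (intro vector_derivative_bound_interval[of t0 T En "\<lambda>_. 0"]) auto
  then have En: "En t = En t0" by simp
  have "(norm (de t0))\<^sup>2 \<le> 2 * (norm (A (b t0)))\<^sup>2 + 2 * (norm (\<omega>\<^sup>2 *\<^sub>R P (p t0)))\<^sup>2"
  proof -
    have "(norm (de t0))\<^sup>2 \<le> (norm (A (b t0)) + norm (\<omega>\<^sup>2 *\<^sub>R P (p t0)))\<^sup>2"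
      unfolding de_def by (intro power_mono norm_triangle_ineq4) auto
    also have "\<dots> \<le> 2 * (norm (A (b t0)))\<^sup>2 + 2 * (norm (\<omega>\<^sup>2 *\<^sub>R P (p t0)))\<^sup>2"
      using sum_squares_bound[of "norm (A (b t0))" "norm (\<omega>\<^sup>2 *\<^sub>R P (p t0))"]
      by (simp add: power2_sum)
    finally show ?thesis .
  qed
  moreover have sq: "En s = (norm (de s))\<^sup>2 + ((\<omega> * norm (P (e s)))\<^sup>2 + inner (e s) (A (B (e s))))" for s
    by (simp add: En_def power_mult_distrib dot_square_norm)
  ultimately have "En t0 \<le> 4 * H0" using i1 i2 i3 i4 \<omega> unfolding sq by (simp add: power_mult_distrib)
  then have "En t \<le> 4 * H0" by (simp only: En)
  then have "(norm (de t))\<^sup>2 \<le> 4 * H0" "(\<omega> * norm (P (e t)))\<^sup>2 \<le> 4 * H0"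
    using AB_nonneg[of "e t"] zero_le_power2[of "norm (de t)"] zero_le_power2[of "\<omega> * norm (P (e t))"]
    unfolding sq by linarith+
  then have "norm (de t) \<le> sqrt (4 * H0)" "\<omega> * norm (P (e t)) \<le> sqrt (4 * H0)"
    by (simp_all add: real_le_rsqrt)
  moreover have "sqrt (4 * H0) = 2 * sqrt H0" by (simp add: real_sqrt_mult)
  ultimately show "norm (A (b t) - \<omega>\<^sup>2 *\<^sub>R P (p t)) \<le> 2 * sqrt H0" "\<omega> * norm (P (e t)) \<le> 2 * sqrt H0"
    by (simp_all add: de_def)
qed

section \<open>Expansions of the exact solution\<close>

text \<open>For \<open>\<Omega> = \<omega> P\<close> this is the matrix function \<open>f(\<Omega>)\<close> of a function with \<open>f(0) = 1\<close>, given by its value at the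
  only other frequency. Filters, cosine and sinc are all of this kind.\<close>

definition filter_op :: "('a::real_vector \<Rightarrow> 'a) \<Rightarrow> real \<Rightarrow> 'a \<Rightarrow> 'a" where
  "filter_op P f x = (x - P x) + f *\<^sub>R P x"

text \<open>An exact solution together with bounds by one constant \<open>K\<close>. Powers of \<open>K\<close> then measure the constants in
  all estimates; they are independent of \<open>\<omega>\<close>.\<close>

locale oscillatory_system =
  fixes P :: "'a::real_normed_vector \<Rightarrow> 'a"
    and A :: "'b::real_normed_vector \<Rightarrow> 'a"
    and B :: "'a \<Rightarrow> 'b"
    and \<omega> K t0 T :: real
    and p e :: "real \<Rightarrow> 'a" and b :: "real \<Rightarrow> 'b"
  assumes bounded_linear_P: "bounded_linear P"
    and bounded_linear_A: "bounded_linear A"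
    and bounded_linear_B: "bounded_linear B"
    and P_P [simp]: "P (P x) = P x"
    and norm_P_le: "norm (P x) \<le> norm x"
    and norm_Q_le': "norm (x - P x) \<le> norm x"
    and norm_A_le: "norm (A y) \<le> K * norm y"
    and norm_B_le: "norm (B x) \<le> K * norm x"
    and omega_pos: "0 < \<omega>" and K_ge_1: "1 \<le> K"
    and p_deriv: "t \<in> {t0..T} \<Longrightarrow> (p has_vector_derivative e t) (at t within {t0..T})"
    and e_deriv: "t \<in> {t0..T} \<Longrightarrow>
      (e has_vector_derivative A (b t) - \<omega>\<^sup>2 *\<^sub>R P (p t)) (at t within {t0..T})"
    and b_deriv: "t \<in> {t0..T} \<Longrightarrow> (b has_vector_derivative - B (e t)) (at t within {t0..T})"
    and norm_e_le: "t \<in> {t0..T} \<Longrightarrow> norm (e t) \<le> K"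
    and norm_de_le': "t \<in> {t0..T} \<Longrightarrow> norm (A (b t) - \<omega>\<^sup>2 *\<^sub>R P (p t)) \<le> K"
    and norm_Pe_le': "t \<in> {t0..T} \<Longrightarrow> \<omega> * norm (P (e t)) \<le> K"
    and norm_b_le: "t \<in> {t0..T} \<Longrightarrow> norm (b t) \<le> K"
begin

sublocale P: bounded_linear P by (rule bounded_linear_P)
sublocale A: bounded_linear A by (rule bounded_linear_A)
sublocale B: bounded_linear B by (rule bounded_linear_B)

definition Q :: "'a \<Rightarrow> 'a" where "Q x = x - P x"
definition G :: "'a \<Rightarrow> 'a" where "G x = - A (B x)"
abbreviation fil :: "real \<Rightarrow> 'a \<Rightarrow> 'a" where "fil \<equiv> filter_op P"
definition de :: "real \<Rightarrow> 'a" where "de t = A (b t) - \<omega>\<^sup>2 *\<^sub>R P (p t)"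

sublocale Q: bounded_linear Q
  unfolding Q_def[abs_def] by (intro bounded_linear_sub bounded_linear_ident bounded_linear_P)

sublocale G: bounded_linear G
  unfolding G_def[abs_def]
  by (intro bounded_linear_minus bounded_linear_compose[OF bounded_linear_A bounded_linear_B])

lemma K_pos: "0 < K" using K_ge_1 by linarith

lemma K_power_mono: "m \<le> n \<Longrightarrow> K ^ m \<le> K ^ n"
  using K_ge_1 by (intro power_increasing)

lemma norm_A_bound: "norm y \<le> c \<Longrightarrow> norm (A y) \<le> K * c"
  using order_trans[OF norm_A_le mult_left_mono] K_pos by fastforce

lemma norm_B_bound: "norm x \<le> c \<Longrightarrow> norm (B x) \<le> K * c"
  using order_trans[OF norm_B_le mult_left_mono] K_pos by fastforce

lemma Q_P [simp]: "Q (P x) = 0" by (simp add: Q_def)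

lemma Q_Q [simp]: "Q (Q x) = Q x" by (simp add: Q_def P.diff)

lemma Q_plus_P: "Q x + P x = x" by (simp add: Q_def)

lemma norm_Q_le: "norm (Q x) \<le> norm x" by (simp add: Q_def norm_Q_le')

lemma norm_G_bound: "norm x \<le> c \<Longrightarrow> norm (G x) \<le> K\<^sup>2 * c"
  using norm_A_bound[OF norm_B_bound[of x c]] by (simp add: G_def power2_eq_square mult.assoc)

lemma norm_PG_bound: "norm x \<le> c \<Longrightarrow> norm (P (G x)) \<le> K\<^sup>2 * c"
  using norm_P_le[of "G x"] norm_G_bound[of x c] by linarith

lemma norm_Pe_le: "t \<in> {t0..T} \<Longrightarrow> norm (P (e t)) \<le> K / \<omega>"
  using norm_Pe_le'[of t] omega_pos by (simp add: le_divide_eq mult.commute)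

lemma norm_de_le: "t \<in> {t0..T} \<Longrightarrow> norm (de t) \<le> K"
  using norm_de_le' by (simp add: de_def)

lemma norm_Ge_le: "t \<in> {t0..T} \<Longrightarrow> norm (G (e t)) \<le> K ^ 3"
  using norm_G_bound[OF norm_e_le[of t]] by (simp add: power3_eq_cube power2_eq_square)

lemma de_deriv:
  assumes "t \<in> {t0..T}"
  shows "(de has_vector_derivative G (e t) - \<omega>\<^sup>2 *\<^sub>R P (e t)) (at t within {t0..T})"
proof -
  have "((\<lambda>t. A (b t) - \<omega>\<^sup>2 *\<^sub>R P (p t)) has_vector_derivative
      A (- B (e t)) - (\<omega>\<^sup>2 *\<^sub>R P (e t) + 0 *\<^sub>R P (p t))) (at t within {t0..T})"
    by (intro has_vector_derivative_diff has_vector_derivative_scaleR A.has_vector_derivative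
        P.has_vector_derivative b_deriv p_deriv assms DERIV_const)
  then show ?thesis by (simp add: de_def[abs_def] G_def A.neg)
qed

lemma e_deriv_de: "t \<in> {t0..T} \<Longrightarrow> (e has_vector_derivative de t) (at t within {t0..T})"
  using e_deriv by (simp add: de_def)

lemma e_lipschitz:
  assumes "s \<in> {t0..T}" "t \<in> {t0..T}"
  shows "norm (e s - e t) \<le> K * \<bar>s - t\<bar>"
  using e_deriv_de norm_de_le assms by (rule vector_derivative_bound_interval)

lemma b_lipschitz:
  assumes "s \<in> {t0..T}" "t \<in> {t0..T}"
  shows "norm (b s - b t) \<le> K\<^sup>2 * \<bar>s - t\<bar>"
proof (rule vector_derivative_bound_interval[OF b_deriv _ assms])
  fix r assume "r \<in> {t0..T}"
  then show "norm (- B (e r)) \<le> K\<^sup>2"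
    using norm_B_bound[OF norm_e_le[of r]] by (simp add: power2_eq_square)
qed

lemma Pe_oscillator:
  assumes "t \<in> {t0..T}"
  shows "((\<lambda>t. P (e t)) has_vector_derivative P (de t)) (at t within {t0..T})"
    and "((\<lambda>t. P (de t)) has_vector_derivative P (G (e t)) - \<omega>\<^sup>2 *\<^sub>R P (e t)) (at t within {t0..T})"
    and "norm (P (G (e t))) \<le> K ^ 3"
  using P.has_vector_derivative[OF e_deriv_de[OF assms]] P.has_vector_derivative[OF de_deriv[OF assms]]
    norm_P_le[of "G (e t)"] norm_Ge_le[OF assms]
  by (simp_all add: P.diff P.scaleR)

lemma Qe_oscillator:
  assumes "t \<in> {t0..T}"
  shows "((\<lambda>t. Q (e t)) has_vector_derivative Q (de t)) (at t within {t0..T})"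
    and "((\<lambda>t. Q (de t)) has_vector_derivative Q (G (e t)) - 0\<^sup>2 *\<^sub>R Q (e t)) (at t within {t0..T})"
    and "norm (Q (G (e t))) \<le> K ^ 3"
  using Q.has_vector_derivative[OF e_deriv_de[OF assms]] Q.has_vector_derivative[OF de_deriv[OF assms]]
    norm_Q_le[of "G (e t)"] norm_Ge_le[OF assms]
  by (simp_all add: Q.diff Q.scaleR)

lemma Pe_symmetric:
  assumes "t - h \<in> {t0..T}" "t + h \<in> {t0..T}" "0 \<le> h"
  shows "norm (P (e (t + h)) + P (e (t - h)) - (2 * cos (\<omega> * h)) *\<^sub>R P (e t)) \<le> 2 * K ^ 3 * h\<^sup>2"
    and "norm (P (de (t + h)) - P (de (t - h)) + (2 * \<omega> * sin (\<omega> * h)) *\<^sub>R P (e t)) \<le> 2 * K ^ 3 * h"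
  by (rule perturbed_oscillator_symmetric[OF Pe_oscillator assms]; assumption)+

lemma Qe_symmetric:
  assumes "t - h \<in> {t0..T}" "t + h \<in> {t0..T}" "0 \<le> h"
  shows "norm (Q (e (t + h)) + Q (e (t - h)) - 2 *\<^sub>R Q (e t)) \<le> 2 * K ^ 3 * h\<^sup>2"
proof -
  have "norm (Q (e (t + h)) + Q (e (t - h)) - (2 * cos (0 * h)) *\<^sub>R Q (e t)) \<le> 2 * K ^ 3 * h\<^sup>2"
    by (rule perturbed_oscillator_symmetric(1)[OF Qe_oscillator assms])
  then show ?thesis by simp
qed

lemma e_symmetric:
  assumes "t - h \<in> {t0..T}" "t + h \<in> {t0..T}" "0 \<le> h"
  shows "norm (e (t + h) + e (t - h) - 2 *\<^sub>R (Q (e t) + cos (\<omega> * h) *\<^sub>R P (e t))) \<le> 4 * K ^ 3 * h\<^sup>2"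
proof -
  have "e (t + h) + e (t - h) - 2 *\<^sub>R (Q (e t) + cos (\<omega> * h) *\<^sub>R P (e t))
    = (Q (e (t + h)) + Q (e (t - h)) - 2 *\<^sub>R Q (e t))
      + (P (e (t + h)) + P (e (t - h)) - (2 * cos (\<omega> * h)) *\<^sub>R P (e t))"
    unfolding Q_def by (simp add: algebra_simps)
  then have "norm (e (t + h) + e (t - h) - 2 *\<^sub>R (Q (e t) + cos (\<omega> * h) *\<^sub>R P (e t)))
      \<le> 2 * K ^ 3 * h\<^sup>2 + 2 * K ^ 3 * h\<^sup>2"
    using norm_triangle_mono[OF Qe_symmetric[OF assms] Pe_symmetric(1)[OF assms]] by (simp only:)
  then show ?thesis by simp
qed

text \<open>The model for the force is \<open>G (Q a + cos (\<omega> s) P a)\<close>: a constant vector and one that oscillates in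
  resonance. The oscillator answers with \<open>(1 - cos (\<omega> s)) / \<omega>\<^sup>2\<close> and \<open>s sin (\<omega> s) / (2 \<omega>)\<close>,
  and a curve that stays within \<open>R\<close> of the model differs from the answer by the effect of a force of size
  \<open>K\<^sup>2 R\<close>.\<close>

lemma P_forced_expansion:
  assumes h: "0 \<le> h"
    and x': "\<And>s. s \<in> {0..h} \<Longrightarrow> (x has_vector_derivative v s) (at s within {0..h})"
    and v': "\<And>s. s \<in> {0..h} \<Longrightarrow>
      (v has_vector_derivative G (x s) - \<omega>\<^sup>2 *\<^sub>R P (x s)) (at s within {0..h})"
    and R: "\<And>s. s \<in> {0..h} \<Longrightarrow> norm (x s - (Q a + cos (\<omega> * s) *\<^sub>R P a)) \<le> R"
  shows "norm (P (x h) - (cos (\<omega> * h) *\<^sub>R P (x 0) + (sin (\<omega> * h) / \<omega>) *\<^sub>R P (v 0)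
      + ((1 - cos (\<omega> * h)) / \<omega>\<^sup>2) *\<^sub>R P (G (Q a)) + (h * sin (\<omega> * h) / (2 * \<omega>)) *\<^sub>R P (G (P a))))
    \<le> K\<^sup>2 * R * h\<^sup>2"
proof -
  have w0: "\<omega> \<noteq> 0" using omega_pos by simp
  define c1 where "c1 s = (1 - cos (\<omega> * s)) / \<omega>\<^sup>2" for s
  define c1' where "c1' s = sin (\<omega> * s) / \<omega>" for s
  define c2 where "c2 s = s * sin (\<omega> * s) / (2 * \<omega>)" for s
  define c2' where "c2' s = (sin (\<omega> * s) + \<omega> * s * cos (\<omega> * s)) / (2 * \<omega>)" for s
  have d1: "(c1 has_real_derivative c1' s) (at s within S)" for s S
    unfolding c1_def[abs_def] c1'_def using w0
    by (auto intro!: derivative_eq_intros simp: power2_eq_square)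
  have d1': "(c1' has_real_derivative cos (\<omega> * s)) (at s within S)" for s S
    unfolding c1'_def[abs_def] using w0 by (auto intro!: derivative_eq_intros)
  have d2: "(c2 has_real_derivative c2' s) (at s within S)" for s S
    unfolding c2_def[abs_def] c2'_def using w0
    by (auto intro!: derivative_eq_intros simp: field_simps)
  have d2': "(c2' has_real_derivative cos (\<omega> * s) - \<omega>\<^sup>2 * c2 s) (at s within S)" for s S
    unfolding c2_def c2'_def[abs_def] using w0
    by (auto intro!: derivative_eq_intros simp: field_simps power2_eq_square)
  have c1: "\<omega>\<^sup>2 * c1 s = 1 - cos (\<omega> * s)" for s using w0 by (simp add: c1_def)
  define y where "y s = P (x s) - (c1 s *\<^sub>R P (G (Q a)) + c2 s *\<^sub>R P (G (P a)))" for s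
  define w where "w s = P (v s) - (c1' s *\<^sub>R P (G (Q a)) + c2' s *\<^sub>R P (G (P a)))" for s
  define f where "f s = P (G (x s - (Q a + cos (\<omega> * s) *\<^sub>R P a)))" for s
  have y': "(y has_vector_derivative w s) (at s within {0..h})" if "s \<in> {0..h}" for s
  proof -
    have "(y has_vector_derivative P (v s) - ((c1 s *\<^sub>R 0 + c1' s *\<^sub>R P (G (Q a)))
        + (c2 s *\<^sub>R 0 + c2' s *\<^sub>R P (G (P a))))) (at s within {0..h})"
      unfolding y_def[abs_def]
      by (intro has_vector_derivative_diff has_vector_derivative_add has_vector_derivative_scaleR
          has_vector_derivative_const P.has_vector_derivative d1 d2 x' that)
    then show ?thesis by (simp add: w_def)
  qed
  have w': "(w has_vector_derivative f s - \<omega>\<^sup>2 *\<^sub>R y s) (at s within {0..h})" if "s \<in> {0..h}" for s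
  proof -
    have "(w has_vector_derivative P (G (x s) - \<omega>\<^sup>2 *\<^sub>R P (x s))
        - ((c1' s *\<^sub>R 0 + cos (\<omega> * s) *\<^sub>R P (G (Q a)))
        + (c2' s *\<^sub>R 0 + (cos (\<omega> * s) - \<omega>\<^sup>2 * c2 s) *\<^sub>R P (G (P a))))) (at s within {0..h})"
      unfolding w_def[abs_def]
      by (intro has_vector_derivative_diff has_vector_derivative_add has_vector_derivative_scaleR
          has_vector_derivative_const P.has_vector_derivative d1' d2' v' that)
    moreover have "P (G (x s) - \<omega>\<^sup>2 *\<^sub>R P (x s)) - ((c1' s *\<^sub>R 0 + cos (\<omega> * s) *\<^sub>R P (G (Q a)))
        + (c2' s *\<^sub>R 0 + (cos (\<omega> * s) - \<omega>\<^sup>2 * c2 s) *\<^sub>R P (G (P a))))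
      = P (G (x s)) - \<omega>\<^sup>2 *\<^sub>R P (x s) - cos (\<omega> * s) *\<^sub>R P (G (Q a))
        - (cos (\<omega> * s) - \<omega>\<^sup>2 * c2 s) *\<^sub>R P (G (P a))"
      by (simp add: P.diff P.scaleR)
    moreover have "\<dots> = f s - \<omega>\<^sup>2 *\<^sub>R y s"
    proof -
      have y: "\<omega>\<^sup>2 *\<^sub>R y s = \<omega>\<^sup>2 *\<^sub>R P (x s)
          - ((1 - cos (\<omega> * s)) *\<^sub>R P (G (Q a)) + (\<omega>\<^sup>2 * c2 s) *\<^sub>R P (G (P a)))"
        unfolding y_def scaleR_right_diff_distrib scaleR_right_distrib scaleR_scaleR c1 ..
      have f: "f s = P (G (x s)) - P (G (Q a)) - cos (\<omega> * s) *\<^sub>R P (G (P a))"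
        by (simp add: f_def P.diff P.add P.scaleR G.diff G.add G.scaleR)
      show ?thesis unfolding y f by (simp add: algebra_simps)
    qed
    ultimately show ?thesis by simp
  qed
  have f: "norm (f s) \<le> K\<^sup>2 * R" if "s \<in> {0..h}" for s
    unfolding f_def by (rule norm_PG_bound[OF R[OF that]])
  have "norm (y h - (cos (\<omega> * (h - 0)) *\<^sub>R y 0 + osc_sin \<omega> (h - 0) *\<^sub>R w 0)) \<le> K\<^sup>2 * R * (h - 0)\<^sup>2"
    using h by (intro perturbed_oscillator(1)[OF y' w' f]) auto
  moreover have "y 0 = P (x 0)" "w 0 = P (v 0)"
    by (simp_all add: y_def w_def c1_def c2_def c1'_def c2'_def)
  ultimately show ?thesis
    using w0 by (simp add: y_def c1_def c2_def osc_sin_def algebra_simps)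
qed

text \<open>Apply the forced expansion to the even part \<open>e (t + s) + e (t - s)\<close>. It has no initial velocity and
  stays within \<open>O(s\<^sup>2)\<close> of \<open>2 (Q e + cos (\<omega> s) P e)\<close>, which gives a remainder of fourth order.\<close>

lemma Pe_two_step:
  assumes t: "t - h \<in> {t0..T}" "t + h \<in> {t0..T}" and h: "0 \<le> h"
  shows "norm (P (e (t + h)) + P (e (t - h)) - (2 * cos (\<omega> * h)) *\<^sub>R P (e t)
      - (2 * (1 - cos (\<omega> * h)) / \<omega>\<^sup>2) *\<^sub>R P (G (Q (e t))) - (h * sin (\<omega> * h) / \<omega>) *\<^sub>R P (G (P (e t))))
    \<le> 4 * K ^ 5 * h ^ 4"
proof -
  define x where "x s = e (t + s) + e (t - s)" for s
  define v where "v s = de (t + s) - de (t - s)" for s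
  have in1: "t + s \<in> {t0..T}" and in2: "t - s \<in> {t0..T}" if "s \<in> {0..h}" for s
    using that t h by auto
  have x': "(x has_vector_derivative v s) (at s within {0..h})" if s: "s \<in> {0..h}" for s
  proof -
    have "(x has_vector_derivative de (t + s) + (- de (t - s))) (at s within {0..h})"
      unfolding x_def[abs_def]
      by (intro has_vector_derivative_add
          has_vector_derivative_translate[OF e_deriv_de[OF in1[OF s]] in1]
          has_vector_derivative_reflect[OF e_deriv_de[OF in2[OF s]] in2])
    then show ?thesis by (simp add: v_def)
  qed
  have v': "(v has_vector_derivative G (x s) - \<omega>\<^sup>2 *\<^sub>R P (x s)) (at s within {0..h})"
    if s: "s \<in> {0..h}" for s
  proof -
    have "(v has_vector_derivative (G (e (t + s)) - \<omega>\<^sup>2 *\<^sub>R P (e (t + s)))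
        - (- (G (e (t - s)) - \<omega>\<^sup>2 *\<^sub>R P (e (t - s))))) (at s within {0..h})"
      unfolding v_def[abs_def]
      by (intro has_vector_derivative_diff
          has_vector_derivative_translate[OF de_deriv[OF in1[OF s]] in1]
          has_vector_derivative_reflect[OF de_deriv[OF in2[OF s]] in2])
    then show ?thesis by (simp add: x_def G.add P.add algebra_simps)
  qed
  have R: "norm (x s - (Q (2 *\<^sub>R e t) + cos (\<omega> * s) *\<^sub>R P (2 *\<^sub>R e t))) \<le> 4 * K ^ 3 * h\<^sup>2"
    if s: "s \<in> {0..h}" for s
  proof -
    have "norm (x s - 2 *\<^sub>R (Q (e t) + cos (\<omega> * s) *\<^sub>R P (e t))) \<le> 4 * K ^ 3 * s\<^sup>2"
      unfolding x_def using s by (intro e_symmetric in1 in2) auto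
    also have "\<dots> \<le> 4 * K ^ 3 * h\<^sup>2"
      using s K_pos by (intro mult_left_mono power_mono) auto
    finally show ?thesis by (simp add: Q.scaleR P.scaleR scaleR_right_distrib mult.commute)
  qed
  have "norm (P (x h) - (cos (\<omega> * h) *\<^sub>R P (x 0) + (sin (\<omega> * h) / \<omega>) *\<^sub>R P (v 0)
      + ((1 - cos (\<omega> * h)) / \<omega>\<^sup>2) *\<^sub>R P (G (Q (2 *\<^sub>R e t)))
      + (h * sin (\<omega> * h) / (2 * \<omega>)) *\<^sub>R P (G (P (2 *\<^sub>R e t))))) \<le> K\<^sup>2 * (4 * K ^ 3 * h\<^sup>2) * h\<^sup>2"
    by (rule P_forced_expansion[OF h x' v' R])
  also have "K\<^sup>2 * (4 * K ^ 3 * h\<^sup>2) * h\<^sup>2 = 4 * K ^ 5 * h ^ 4"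
    by (simp add: power_numeral_reduce)
  also have "P (x h) - (cos (\<omega> * h) *\<^sub>R P (x 0) + (sin (\<omega> * h) / \<omega>) *\<^sub>R P (v 0)
      + ((1 - cos (\<omega> * h)) / \<omega>\<^sup>2) *\<^sub>R P (G (Q (2 *\<^sub>R e t)))
      + (h * sin (\<omega> * h) / (2 * \<omega>)) *\<^sub>R P (G (P (2 *\<^sub>R e t))))
    = P (e (t + h)) + P (e (t - h)) - (2 * cos (\<omega> * h)) *\<^sub>R P (e t)
      - (2 * (1 - cos (\<omega> * h)) / \<omega>\<^sup>2) *\<^sub>R P (G (Q (e t))) - (h * sin (\<omega> * h) / \<omega>) *\<^sub>R P (G (P (e t)))"
  proof -
    have "P (x 0) = 2 *\<^sub>R P (e t)" "P (v 0) = 0" "P (x h) = P (e (t + h)) + P (e (t - h))"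
      "P (G (Q (2 *\<^sub>R e t))) = 2 *\<^sub>R P (G (Q (e t)))" "P (G (P (2 *\<^sub>R e t))) = 2 *\<^sub>R P (G (P (e t)))"
      by (simp_all add: x_def v_def P.add P.scaleR P.zero flip: scaleR_2)
        (simp_all add: Q.scaleR G.scaleR P.scaleR)
    then show ?thesis by (simp add: mult.commute)
  qed
  finally show ?thesis .
qed

text \<open>At the initial time only one side is available and the distance to the model is \<open>O(s)\<close>, because
  \<open>P e\<close> is of size \<open>K / \<omega>\<close> and \<open>1 - cos x \<le> x\<close>. The remainder is of third order, which is enough
  for a single step.\<close>

lemma Pe_first_step:
  assumes h: "0 \<le> h" "t0 + h \<le> T"
  shows "norm (P (e (t0 + h)) - (cos (\<omega> * h) *\<^sub>R P (e t0) + (sin (\<omega> * h) / \<omega>) *\<^sub>R P (de t0)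
      + ((1 - cos (\<omega> * h)) / \<omega>\<^sup>2) *\<^sub>R P (G (Q (e t0))) + (h * sin (\<omega> * h) / (2 * \<omega>)) *\<^sub>R P (G (P (e t0)))))
    \<le> 2 * K ^ 3 * h ^ 3"
proof -
  have in1: "t0 + s \<in> {t0..T}" if "s \<in> {0..h}" for s using that h by auto
  have t0: "t0 \<in> {t0..T}" using h by auto
  have R: "norm (e (t0 + s) - (Q (e t0) + cos (\<omega> * s) *\<^sub>R P (e t0))) \<le> 2 * K * h" if s: "s \<in> {0..h}" for s
  proof -
    have "\<bar>1 - cos (\<omega> * s)\<bar> \<le> \<omega> * s"
    proof -
      have "1 - cos (\<omega> * s) = 2 * (sin (\<omega> * s / 2))\<^sup>2"
        using cos_double_sin[of "\<omega> * s / 2"] by simp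
      also have "\<dots> \<le> 2 * \<bar>sin (\<omega> * s / 2)\<bar>"
        using abs_sin_le_one[of "\<omega> * s / 2"] mult_left_mono[of "\<bar>sin (\<omega> * s / 2)\<bar>" 1 "\<bar>sin (\<omega> * s / 2)\<bar>"]
        by (simp add: power2_eq_square flip: abs_mult)
      also have "\<dots> \<le> \<omega> * s"
        using abs_sin_x_le_abs_x[of "\<omega> * s / 2"] omega_pos s by simp
      finally show ?thesis by simp
    qed
    then have "norm ((1 - cos (\<omega> * s)) *\<^sub>R P (e t0)) \<le> (\<omega> * s) * (K / \<omega>)"
      unfolding norm_scaleR using norm_Pe_le[OF t0] s omega_pos by (intro mult_mono) auto
    also have "\<dots> = K * s" using omega_pos by simp
    finally have "norm ((1 - cos (\<omega> * s)) *\<^sub>R P (e t0)) \<le> K * s" .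
    moreover have "norm (e (t0 + s) - e t0) \<le> K * s"
      using e_lipschitz[OF in1[OF s] t0] s by simp
    moreover have "e (t0 + s) - (Q (e t0) + cos (\<omega> * s) *\<^sub>R P (e t0))
        = (e (t0 + s) - e t0) + (1 - cos (\<omega> * s)) *\<^sub>R P (e t0)"
      by (simp add: Q_def algebra_simps)
    ultimately have "norm (e (t0 + s) - (Q (e t0) + cos (\<omega> * s) *\<^sub>R P (e t0))) \<le> K * s + K * s"
      by (metis norm_triangle_mono)
    also have "\<dots> \<le> 2 * K * h" using s K_pos by simp
    finally show ?thesis .
  qed
  have "norm (P (e (t0 + h)) - (cos (\<omega> * h) *\<^sub>R P (e (t0 + 0)) + (sin (\<omega> * h) / \<omega>) *\<^sub>R P (de (t0 + 0))
      + ((1 - cos (\<omega> * h)) / \<omega>\<^sup>2) *\<^sub>R P (G (Q (e t0))) + (h * sin (\<omega> * h) / (2 * \<omega>)) *\<^sub>R P (G (P (e t0)))))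
    \<le> K\<^sup>2 * (2 * K * h) * h\<^sup>2"
    by (intro P_forced_expansion[OF h(1) _ _ R]
        has_vector_derivative_translate[OF e_deriv_de[OF in1] in1]
        has_vector_derivative_translate[OF de_deriv[OF in1] in1])
  then show ?thesis by (simp add: power_numeral_reduce mult_ac)
qed

text \<open>The integral of \<open>e\<close> over a symmetric interval, with the oscillating part integrated exactly.\<close>

lemma b_half_steps:
  assumes t: "t - h \<in> {t0..T}" "t + h \<in> {t0..T}" and h: "0 \<le> h"
  shows "norm (b (t + h) - b (t - h) + B ((2 * h) *\<^sub>R Q (e t) + (2 * sin (\<omega> * h) / \<omega>) *\<^sub>R P (e t)))
    \<le> 4 * K ^ 4 * h ^ 3"
proof -
  have w0: "\<omega> \<noteq> 0" using omega_pos by simp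
  have in1: "t + s \<in> {t0..T}" and in2: "t - s \<in> {t0..T}" if "s \<in> {0..h}" for s
    using that t h by auto
  define y where "y s = b (t + s) - b (t - s) + B ((2 * s) *\<^sub>R Q (e t) + (2 * sin (\<omega> * s) / \<omega>) *\<^sub>R P (e t))" for s
  define y' where "y' s = - B (e (t + s) + e (t - s) - 2 *\<^sub>R (Q (e t) + cos (\<omega> * s) *\<^sub>R P (e t)))" for s
  have "(y has_vector_derivative y' s) (at s within {0..h})" if s: "s \<in> {0..h}" for s
  proof -
    have "((\<lambda>s. 2 * s) has_real_derivative 2) (at s within {0..h})"
      by (auto intro!: derivative_eq_intros)
    moreover have "((\<lambda>s. 2 * sin (\<omega> * s) / \<omega>) has_real_derivative 2 * cos (\<omega> * s)) (at s within {0..h})"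
      using w0 by (auto intro!: derivative_eq_intros)
    ultimately have "(y has_vector_derivative (- B (e (t + s))) - (- (- B (e (t - s))))
        + B (((2 * s) *\<^sub>R 0 + 2 *\<^sub>R Q (e t)) + ((2 * sin (\<omega> * s) / \<omega>) *\<^sub>R 0 + (2 * cos (\<omega> * s)) *\<^sub>R P (e t))))
        (at s within {0..h})"
      unfolding y_def[abs_def]
      by (intro has_vector_derivative_add has_vector_derivative_diff B.has_vector_derivative
          has_vector_derivative_scaleR has_vector_derivative_const
          has_vector_derivative_translate[OF b_deriv[OF in1[OF s]] in1]
          has_vector_derivative_reflect[OF b_deriv[OF in2[OF s]] in2])
    moreover have "(- B (e (t + s))) - (- (- B (e (t - s))))
        + B (((2 * s) *\<^sub>R 0 + 2 *\<^sub>R Q (e t)) + ((2 * sin (\<omega> * s) / \<omega>) *\<^sub>R 0 + (2 * cos (\<omega> * s)) *\<^sub>R P (e t)))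
      = y' s"
      by (simp add: y'_def B.add B.diff B.scaleR algebra_simps)
    ultimately show ?thesis by simp
  qed
  moreover have "norm (y' s) \<le> K * (4 * K ^ 3 * h\<^sup>2)" if s: "s \<in> {0..h}" for s
  proof -
    have "norm (e (t + s) + e (t - s) - 2 *\<^sub>R (Q (e t) + cos (\<omega> * s) *\<^sub>R P (e t))) \<le> 4 * K ^ 3 * s\<^sup>2"
      using s by (intro e_symmetric in1 in2) auto
    also have "\<dots> \<le> 4 * K ^ 3 * h\<^sup>2"
      using s K_pos by (intro mult_left_mono power_mono) auto
    finally show ?thesis
      unfolding y'_def norm_minus_cancel using K_pos
      by (intro order_trans[OF norm_B_le] mult_left_mono) auto
  qed
  ultimately have "norm (y h - y 0) \<le> K * (4 * K ^ 3 * h\<^sup>2) * \<bar>h - 0\<bar>"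
    using h by (intro vector_derivative_bound_interval) auto
  then show ?thesis using h by (simp add: y_def B.zero power_numeral_reduce mult_ac)
qed

lemma b_first_order:
  assumes s: "s \<in> {t0..T}" and t: "t \<in> {t0..T}"
  shows "norm (b s - b t + (s - t) *\<^sub>R B (e t)) \<le> K\<^sup>2 * (s - t)\<^sup>2"
proof -
  have b2: "((\<lambda>t. - B (e t)) has_vector_derivative - B (de r) - 0\<^sup>2 *\<^sub>R b r) (at r within {t0..T})"
    if "r \<in> {t0..T}" for r
    using has_vector_derivative_minus[OF B.has_vector_derivative[OF e_deriv_de[OF that]]] by simp
  have f: "norm (- B (de r)) \<le> K\<^sup>2" if "r \<in> {t0..T}" for r
    using norm_B_bound[OF norm_de_le[OF that]] by (simp add: power2_eq_square)
  have "norm (b s - (cos (0 * (s - t)) *\<^sub>R b t + osc_sin 0 (s - t) *\<^sub>R (- B (e t)))) \<le> K\<^sup>2 * (s - t)\<^sup>2"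
    by (rule perturbed_oscillator(1)[OF b_deriv b2 f s t])
  then show ?thesis by (simp add: osc_sin_def algebra_simps)
qed

text \<open>The midpoint rule has a third-order remainder since \<open>Q e' = Q A b\<close> and \<open>b'' = - B e'\<close> is bounded.\<close>

lemma Qe_midpoint:
  assumes t: "t - h \<in> {t0..T}" "t + h \<in> {t0..T}" and h: "0 \<le> h"
  shows "norm (Q (e (t + h)) - Q (e (t - h)) - (2 * h) *\<^sub>R Q (A (b t))) \<le> 2 * K ^ 3 * h ^ 3"
proof -
  have in1: "t + s \<in> {t0..T}" and in2: "t - s \<in> {t0..T}" if "s \<in> {0..h}" for s
    using that t h by auto
  have b2: "((\<lambda>t. - B (e t)) has_vector_derivative - B (de r) - 0\<^sup>2 *\<^sub>R b r) (at r within {t0..T})"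
    if "r \<in> {t0..T}" for r
    using has_vector_derivative_minus[OF B.has_vector_derivative[OF e_deriv_de[OF that]]] by simp
  have f: "norm (- B (de r)) \<le> K\<^sup>2" if "r \<in> {t0..T}" for r
    using norm_B_bound[OF norm_de_le[OF that]] by (simp add: power2_eq_square)
  have Qde: "Q (de s) = Q (A (b s))" for s by (simp add: de_def Q.diff Q.scaleR)
  define y where "y s = Q (e (t + s)) - Q (e (t - s)) - (2 * s) *\<^sub>R Q (A (b t))" for s
  define y' where "y' s = Q (A (b (t + s) + b (t - s) - 2 *\<^sub>R b t))" for s
  have "(y has_vector_derivative y' s) (at s within {0..h})" if s: "s \<in> {0..h}" for s
  proof -
    have "((\<lambda>s. 2 * s) has_real_derivative 2) (at s within {0..h})"
      by (auto intro!: derivative_eq_intros)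
    then have "(y has_vector_derivative Q (de (t + s)) - (- Q (de (t - s)))
        - ((2 * s) *\<^sub>R 0 + 2 *\<^sub>R Q (A (b t)))) (at s within {0..h})"
      unfolding y_def[abs_def]
      by (intro has_vector_derivative_diff has_vector_derivative_scaleR has_vector_derivative_const
          has_vector_derivative_translate[OF Qe_oscillator(1)[OF in1[OF s]] in1]
          has_vector_derivative_reflect[OF Qe_oscillator(1)[OF in2[OF s]] in2])
    then show ?thesis by (simp add: y'_def Qde Q.add Q.diff Q.scaleR A.add A.diff A.scaleR)
  qed
  moreover have "norm (y' s) \<le> K * (2 * K\<^sup>2 * h\<^sup>2)" if s: "s \<in> {0..h}" for s
  proof -
    have "norm (b (t + s) + b (t - s) - (2 * cos (0 * s)) *\<^sub>R b t) \<le> 2 * K\<^sup>2 * s\<^sup>2"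
      using s by (intro perturbed_oscillator_symmetric(1)[OF b_deriv b2 f] in1 in2) auto
    also have "\<dots> \<le> 2 * K\<^sup>2 * h\<^sup>2"
      using s K_pos by (intro mult_left_mono power_mono) auto
    finally show ?thesis
      unfolding y'_def using K_pos
      by (intro order_trans[OF norm_Q_le] order_trans[OF norm_A_le] mult_left_mono) auto
  qed
  ultimately have "norm (y h - y 0) \<le> K * (2 * K\<^sup>2 * h\<^sup>2) * \<bar>h - 0\<bar>"
    using h by (intro vector_derivative_bound_interval) auto
  then show ?thesis using h by (simp add: y_def power_numeral_reduce mult_ac)
qed

text \<open>The force \<open>A b\<close> on \<open>p\<close> is Lipschitz, so freezing it at the left end costs \<open>O(h\<^sup>3)\<close>.\<close>

lemma p_step:
  assumes h: "0 \<le> h" and t: "t \<in> {t0..T}" "t + h \<in> {t0..T}"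
  shows "norm (P (p (t + h)) - (cos (\<omega> * h) *\<^sub>R P (p t) + (sin (\<omega> * h) / \<omega>) *\<^sub>R P (e t)
      + ((1 - cos (\<omega> * h)) / \<omega>\<^sup>2) *\<^sub>R P (A (b t)))) \<le> K ^ 3 * h ^ 3" (is ?P)
    and "norm (Q (p (t + h)) - (Q (p t) + h *\<^sub>R Q (e t) + (h\<^sup>2 / 2) *\<^sub>R Q (A (b t)))) \<le> K ^ 3 * h ^ 3" (is ?Q)
proof -
  have w0: "\<omega> \<noteq> 0" using omega_pos by simp
  have sub: "{t..t + h} \<subseteq> {t0..T}" using t by auto
  have pd: "(p has_vector_derivative e r) (at r within {t..t + h})"
    and ed: "(e has_vector_derivative de r) (at r within {t..t + h})" if "r \<in> {t..t + h}" for r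
    using that sub by (auto intro: has_vector_derivative_within_subset[OF p_deriv sub]
        has_vector_derivative_within_subset[OF e_deriv_de sub])
  have Ab: "norm (A (b r - b t)) \<le> K ^ 3 * h" if r: "r \<in> {t..t + h}" for r
  proof -
    have "norm (b r - b t) \<le> K\<^sup>2 * \<bar>r - t\<bar>" using r t(1) sub by (intro b_lipschitz) auto
    also have "\<dots> \<le> K\<^sup>2 * h" using r by (intro mult_left_mono) auto
    finally have "norm (A (b r - b t)) \<le> K * (K\<^sup>2 * h)"
      using K_pos by (intro order_trans[OF norm_A_le] mult_left_mono) auto
    then show ?thesis by (simp add: power_numeral_reduce mult_ac)
  qed
  show ?P
  proof -
    define c where "c r = (1 - cos (\<omega> * (r - t))) / \<omega>\<^sup>2" for r
    define c' where "c' r = sin (\<omega> * (r - t)) / \<omega>" for r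
    have dc: "(c has_real_derivative c' r) (at r within S)" for r S
      unfolding c_def[abs_def] c'_def using w0
      by (auto intro!: derivative_eq_intros simp: power2_eq_square)
    have dc': "(c' has_real_derivative cos (\<omega> * (r - t))) (at r within S)" for r S
      unfolding c'_def[abs_def] using w0 by (auto intro!: derivative_eq_intros)
    define y where "y r = P (p r) - c r *\<^sub>R P (A (b t))" for r
    define w where "w r = P (e r) - c' r *\<^sub>R P (A (b t))" for r
    have y': "(y has_vector_derivative w r) (at r within {t..t + h})" if "r \<in> {t..t + h}" for r
    proof -
      have "(y has_vector_derivative P (e r) - (c r *\<^sub>R 0 + c' r *\<^sub>R P (A (b t)))) (at r within {t..t + h})"
        unfolding y_def[abs_def]
        by (intro has_vector_derivative_diff has_vector_derivative_scaleR dc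
            has_vector_derivative_const P.has_vector_derivative pd that)
      then show ?thesis by (simp add: w_def)
    qed
    have w': "(w has_vector_derivative P (A (b r - b t)) - \<omega>\<^sup>2 *\<^sub>R y r) (at r within {t..t + h})"
      if "r \<in> {t..t + h}" for r
    proof -
      have "(w has_vector_derivative P (de r) - (c' r *\<^sub>R 0 + cos (\<omega> * (r - t)) *\<^sub>R P (A (b t)))) (at r within {t..t + h})"
        unfolding w_def[abs_def]
        by (intro has_vector_derivative_diff has_vector_derivative_scaleR dc'
            has_vector_derivative_const P.has_vector_derivative ed that)
      moreover have "P (de r) - (c' r *\<^sub>R 0 + cos (\<omega> * (r - t)) *\<^sub>R P (A (b t)))
          = P (A (b r - b t)) - \<omega>\<^sup>2 *\<^sub>R y r"
        unfolding y_def c_def using w0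
        by (simp add: de_def P.diff P.scaleR A.diff scaleR_right_diff_distrib)
          (simp add: algebra_simps)
      ultimately show ?thesis by simp
    qed
    have f: "norm (P (A (b r - b t))) \<le> K ^ 3 * h" if "r \<in> {t..t + h}" for r
      using norm_P_le[of "A (b r - b t)"] Ab[OF that] by linarith
    have "norm (y (t + h) - (cos (\<omega> * (t + h - t)) *\<^sub>R y t + osc_sin \<omega> (t + h - t) *\<^sub>R w t))
        \<le> K ^ 3 * h * (t + h - t)\<^sup>2"
      using h by (intro perturbed_oscillator(1)[OF y' w' f]) auto
    moreover have "y t = P (p t)" "w t = P (e t)" by (simp_all add: y_def w_def c_def c'_def)
    ultimately show ?thesis
      using w0 by (simp add: y_def c_def osc_sin_def power_numeral_reduce mult_ac algebra_simps)
  qed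
  show ?Q
  proof -
    define y where "y r = Q (p r) - ((r - t)\<^sup>2 / 2) *\<^sub>R Q (A (b t))" for r
    define w where "w r = Q (e r) - (r - t) *\<^sub>R Q (A (b t))" for r
    have y': "(y has_vector_derivative w r) (at r within {t..t + h})" if "r \<in> {t..t + h}" for r
    proof -
      have "((\<lambda>r. (r - t)\<^sup>2 / 2) has_real_derivative r - t) (at r within {t..t + h})"
        by (auto intro!: derivative_eq_intros)
      then have "(y has_vector_derivative Q (e r) - (((r - t)\<^sup>2 / 2) *\<^sub>R 0 + (r - t) *\<^sub>R Q (A (b t))))
          (at r within {t..t + h})"
        unfolding y_def[abs_def]
        by (intro has_vector_derivative_diff has_vector_derivative_scaleR
            has_vector_derivative_const Q.has_vector_derivative pd that)
      then show ?thesis by (simp add: w_def)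
    qed
    have w': "(w has_vector_derivative Q (A (b r - b t)) - 0\<^sup>2 *\<^sub>R y r) (at r within {t..t + h})"
      if "r \<in> {t..t + h}" for r
    proof -
      have "((\<lambda>r. r - t) has_real_derivative 1) (at r within {t..t + h})"
        by (auto intro!: derivative_eq_intros)
      then have "(w has_vector_derivative Q (de r) - ((r - t) *\<^sub>R 0 + 1 *\<^sub>R Q (A (b t)))) (at r within {t..t + h})"
        unfolding w_def[abs_def]
        by (intro has_vector_derivative_diff has_vector_derivative_scaleR
            has_vector_derivative_const Q.has_vector_derivative ed that)
      then show ?thesis by (simp add: de_def Q.diff Q.scaleR A.diff)
    qed
    have f: "norm (Q (A (b r - b t))) \<le> K ^ 3 * h" if "r \<in> {t..t + h}" for r
      using norm_Q_le[of "A (b r - b t)"] Ab[OF that] by linarith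
    have "norm (y (t + h) - (cos (0 * (t + h - t)) *\<^sub>R y t + osc_sin 0 (t + h - t) *\<^sub>R w t))
        \<le> K ^ 3 * h * (t + h - t)\<^sup>2"
      using h by (intro perturbed_oscillator(1)[OF y' w' f]) auto
    then show ?thesis
      using h by (simp add: y_def w_def osc_sin_def power_numeral_reduce mult_ac algebra_simps)
  qed
qed

end

section \<open>Errors of the splitting scheme\<close>

text \<open>The error constants, as functions of the data bound \<open>K\<close> and the length \<open>L\<close> of the time interval: the
  estimates below produce them in this form. In \<open>const_e\<close> the exponential comes from Gronwall's lemma.\<close>

definition const_e :: "real \<Rightarrow> real \<Rightarrow> real" where
  "const_e K L = (L * K * (2 * K ^ 3 + L * K ^ 5) + L * K ^ 3 + 2 * K ^ 4 + 5 * L * K ^ 4 + 5 * L\<^sup>2 * K ^ 6)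
     * exp ((2 * L * K ^ 3 + 2 * L * K ^ 4) * L)"

definition const_b_half :: "real \<Rightarrow> real \<Rightarrow> real" where
  "const_b_half K L = 2 * K ^ 3 + L * K ^ 5 + 2 * K\<^sup>2 * (L * const_e K L)"

definition const_b :: "real \<Rightarrow> real \<Rightarrow> real" where
  "const_b K L = const_b_half K L + K ^ 3 + K\<^sup>2 * const_e K L"

definition const_p :: "real \<Rightarrow> real \<Rightarrow> real" where
  "const_p K L = 2 * K ^ 3 + 2 * L * (const_e K L + K\<^sup>2 * (K\<^sup>2 + const_b_half K L) + K ^ 3 + K ^ 4)"

text \<open>The sequence \<open>bh\<close> holds the half-step values \<open>b\<^sub>n\<^sub>+\<^sub>1\<^sub>/\<^sub>2\<close>; \<open>\<psi>\<close> and \<open>\<phi>\<close> are the values of the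
  filters at \<open>\<omega> \<tau> / 2\<close>.\<close>

locale triple_splitting = oscillatory_system P A B \<omega> K t0 T p e b
  for P :: "'a::real_normed_vector \<Rightarrow> 'a"
    and A :: "'b::real_normed_vector \<Rightarrow> 'a"
    and B :: "'a \<Rightarrow> 'b"
    and \<omega> K t0 T :: real
    and p e :: "real \<Rightarrow> 'a" and b :: "real \<Rightarrow> 'b" +
  fixes \<tau> \<psi> \<phi> :: real
    and pn en :: "nat \<Rightarrow> 'a" and bn bh :: "nat \<Rightarrow> 'b"
  assumes tau_pos: "0 < \<tau>" and tau_le_1: "\<tau> \<le> 1"
    and filters: "admissible_filter_values K (\<omega> * \<tau>) \<psi> \<phi>"
    and initial_Ab: "\<omega>\<^sup>2 * norm (P (A (b t0))) \<le> K"
    and initial: "pn 0 = p t0" "en 0 = e t0" "bn 0 = b t0"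
    and bh_def: "bh n = bn n - (\<tau> / 2) *\<^sub>R B (fil \<phi> (en n))"
    and pn_Suc: "pn (Suc n) = fil (cos (\<omega> * \<tau>)) (pn n)
      + \<tau> *\<^sub>R fil (sin (\<omega> * \<tau>) / (\<omega> * \<tau>)) (en n + (\<tau> / 2) *\<^sub>R fil \<psi> (A (bh n)))"
    and en_Suc: "en (Suc n) = fil (cos (\<omega> * \<tau>)) (en n + (\<tau> / 2) *\<^sub>R fil \<psi> (A (bh n)))
      - (\<omega> * sin (\<omega> * \<tau>)) *\<^sub>R P (pn n) + (\<tau> / 2) *\<^sub>R fil \<psi> (A (bh n))"
    and bn_Suc: "bn (Suc n) = bh n - (\<tau> / 2) *\<^sub>R B (fil \<phi> (en (Suc n)))"
begin

definition z :: real where "z = \<omega> * \<tau>"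
definition Psi :: real where "Psi = (cos z + 1) / 2 * \<psi>"
definition grid :: "nat \<Rightarrow> real" where "grid n = t0 + real n * \<tau>"
definition mid :: "nat \<Rightarrow> real" where "mid n = grid n + \<tau> / 2"
definition e_err :: "nat \<Rightarrow> 'a" where "e_err n = e (grid n) - en n"
definition b_half_err :: "nat \<Rightarrow> 'b" where "b_half_err n = b (mid n) - bh n"

definition L :: real where "L = T - t0"

lemma z_pos: "0 < z" using omega_pos tau_pos by (simp add: z_def)

lemma filter_values:
  "\<bar>\<phi>\<bar> \<le> K" "\<bar>\<psi>\<bar> \<le> K" "\<bar>Psi\<bar> \<le> K"
  "\<bar>(sin (z / 2) / (z / 2))\<^sup>2 - Psi\<bar> \<le> K * (sin (z / 2))\<^sup>2"
  "\<bar>sin z / z - Psi * \<phi>\<bar> \<le> K * z * \<bar>sin z\<bar>"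
  "\<bar>sin z / z - Psi\<bar> \<le> K * z * \<bar>sin z\<bar>"
  "\<bar>sin (z / 2) / (z / 2) - \<phi>\<bar> \<le> K * z * \<bar>sin (z / 2)\<bar>"
  "\<bar>1 - \<phi>\<bar> \<le> K * z"
  using filters unfolding admissible_filter_values_def z_def Psi_def by blast+

lemma P_fil: "P (fil f x) = f *\<^sub>R P x" by (simp add: filter_op_def P.add P.diff P.scaleR)

lemma Q_fil: "Q (fil f x) = Q x" by (simp add: Q_def P_fil) (simp add: filter_op_def)

lemma fil_eq: "fil f x = Q x + f *\<^sub>R P x" by (simp add: filter_op_def Q_def)

lemma fil_diff: "fil f (x - y) = fil f x - fil f y"
  by (simp add: filter_op_def P.diff algebra_simps)

lemma norm_fil_le: "norm (fil \<phi> x) \<le> 2 * K * norm x"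
proof -
  have "norm (fil \<phi> x) \<le> norm x + K * norm x"
    unfolding fil_eq using norm_Q_le[of x] norm_P_le[of x] filter_values(1) K_pos
    by (intro norm_triangle_mono) (auto intro!: mult_mono)
  moreover have "1 * norm x \<le> K * norm x" using K_ge_1 by (intro mult_right_mono) auto
  ultimately show ?thesis by simp
qed

lemma norm_B_fil_le: "norm (B (fil \<phi> x)) \<le> 2 * K\<^sup>2 * norm x"
  using norm_B_bound[OF norm_fil_le[of x]] by (simp add: power2_eq_square mult_ac)

lemma P_en_Suc: "P (en (Suc n)) = cos z *\<^sub>R P (en n) - (\<omega> * sin z) *\<^sub>R P (pn n) + (\<tau> * Psi) *\<^sub>R P (A (bh n))"
  unfolding en_Suc by (simp add: P.add P.diff P.scaleR P_fil z_def Psi_def algebra_simps add_divide_distrib)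

lemma Q_en_Suc: "Q (en (Suc n)) = Q (en n) + \<tau> *\<^sub>R Q (A (bh n))"
  unfolding en_Suc by (simp add: Q.add Q.diff Q.scaleR Q_fil flip: scaleR_left_distrib)

lemma P_pn_Suc: "P (pn (Suc n)) = cos z *\<^sub>R P (pn n) + (sin z / \<omega>) *\<^sub>R P (en n)
    + (\<tau> * sin z * \<psi> / (2 * \<omega>)) *\<^sub>R P (A (bh n))"
  unfolding pn_Suc using tau_pos
  by (simp add: P.add P.diff P.scaleR P_fil scaleR_right_distrib z_def)

lemma Q_pn_Suc: "Q (pn (Suc n)) = Q (pn n) + \<tau> *\<^sub>R Q (en n) + (\<tau>\<^sup>2 / 2) *\<^sub>R Q (A (bh n))"
  unfolding pn_Suc by (simp add: Q.add Q.diff Q.scaleR Q_fil scaleR_right_distrib power2_eq_square)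

lemma bh_Suc: "bh (Suc n) = bh n - \<tau> *\<^sub>R B (fil \<phi> (en (Suc n)))"
proof -
  have "\<tau> *\<^sub>R B (fil \<phi> (en (Suc n))) = (\<tau> / 2) *\<^sub>R B (fil \<phi> (en (Suc n))) + (\<tau> / 2) *\<^sub>R B (fil \<phi> (en (Suc n)))"
    by (simp flip: scaleR_left_distrib)
  then show ?thesis unfolding bh_def[of "Suc n"] bn_Suc by simp
qed

text \<open>The half steps of \<open>b\<close> satisfy \<open>bh (n + 1) - bh n = - \<tau> B \<phi> e\<^sub>n\<^sub>+\<^sub>1\<close>, and the scheme is symmetric in time. Adding
  two consecutive steps therefore eliminates \<open>p\<close> and leaves only the difference of the two kicks.\<close>

lemma P_en_two_step:
  "P (en (Suc (Suc n))) - (2 * cos z) *\<^sub>R P (en (Suc n)) + P (en n)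
    = (\<tau>\<^sup>2 * Psi) *\<^sub>R P (G (fil \<phi> (en (Suc n))))"
proof -
  define c s where "c = cos z" and "s = sin z"
  have cs: "s * s = 1 - c * c"
    using sin_cos_squared_add[of z] by (simp add: c_def s_def power2_eq_square)
  define E X U g where "E = P (en n)" and "X = P (pn n)" and "U = P (A (bh n))"
    and "g = P (G (fil \<phi> (en (Suc n))))"
  have U1: "P (A (bh (Suc n))) = U + \<tau> *\<^sub>R g"
    by (simp add: bh_Suc A.diff A.scaleR P.diff P.scaleR G_def P.neg U_def g_def)
  have E1: "P (en (Suc n)) = c *\<^sub>R E - (\<omega> * s) *\<^sub>R X + (\<tau> * Psi) *\<^sub>R U"
    by (simp add: P_en_Suc E_def X_def U_def c_def s_def)
  have X1: "P (pn (Suc n)) = c *\<^sub>R X + (s / \<omega>) *\<^sub>R E + (\<tau> * s * \<psi> / (2 * \<omega>)) *\<^sub>R U"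
    by (simp add: P_pn_Suc E_def X_def U_def c_def s_def)
  have wX1: "(\<omega> * s) *\<^sub>R P (pn (Suc n))
      = (c * (\<omega> * s)) *\<^sub>R X + (s * s) *\<^sub>R E + (\<tau> * \<psi> / 2 * (s * s)) *\<^sub>R U"
    unfolding X1 using omega_pos by (simp add: scaleR_right_distrib mult_ac)
  have cE1: "c *\<^sub>R P (en (Suc n)) = (c * c) *\<^sub>R E - (c * (\<omega> * s)) *\<^sub>R X + (c * \<tau> * Psi) *\<^sub>R U"
    unfolding E1 by (simp add: algebra_simps)
  have E2: "P (en (Suc (Suc n))) = c *\<^sub>R P (en (Suc n)) - (\<omega> * s) *\<^sub>R P (pn (Suc n))
      + (\<tau> * Psi) *\<^sub>R (U + \<tau> *\<^sub>R g)"
    unfolding P_en_Suc[of "Suc n"] U1 c_def s_def ..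
  have "P (en (Suc (Suc n))) - (2 * c) *\<^sub>R P (en (Suc n)) + E
      = E - c *\<^sub>R P (en (Suc n)) - (\<omega> * s) *\<^sub>R P (pn (Suc n)) + (\<tau> * Psi) *\<^sub>R U + (\<tau> * \<tau> * Psi) *\<^sub>R g"
  proof -
    have "(2 * c) *\<^sub>R P (en (Suc n)) = c *\<^sub>R P (en (Suc n)) + c *\<^sub>R P (en (Suc n))"
      unfolding scaleR_left_distrib[symmetric] by simp
    moreover have "(\<tau> * Psi) *\<^sub>R (U + \<tau> *\<^sub>R g) = (\<tau> * Psi) *\<^sub>R U + (\<tau> * \<tau> * Psi) *\<^sub>R g"
      by (simp add: scaleR_right_distrib mult_ac)
    ultimately show ?thesis unfolding E2 by simp
  qed
  also have "\<dots> = (1 - c * c - s * s) *\<^sub>R E + (\<tau> * Psi - c * \<tau> * Psi - \<tau> * \<psi> / 2 * (s * s)) *\<^sub>R U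
      + (\<tau> * \<tau> * Psi) *\<^sub>R g"
    unfolding cE1 wX1 by (simp add: algebra_simps)
  \<comment> \<open>\<open>(1 + c) (1 - c) = s\<^sup>2\<close>, so the force of the first step drops out\<close>
  also have "\<tau> * Psi - c * \<tau> * Psi - \<tau> * \<psi> / 2 * (s * s) = 0"
    unfolding cs Psi_def c_def[symmetric] by (simp add: field_simps)
  finally show ?thesis by (simp add: cs c_def E_def g_def power2_eq_square)
qed

lemma grid_Suc: "grid (Suc n) = grid n + \<tau>" by (simp add: grid_def algebra_simps)

lemma grid_le: "j \<le> n \<Longrightarrow> grid j \<le> grid n" using tau_pos by (simp add: grid_def)

lemma t0_le_grid: "t0 \<le> grid j" using tau_pos by (simp add: grid_def)

lemma grid_in: "grid n \<le> T \<Longrightarrow> j \<le> n \<Longrightarrow> grid j \<in> {t0..T}"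
  using grid_le[of j n] t0_le_grid[of j] by simp

lemma steps_le_L: "grid n \<le> T \<Longrightarrow> real n * \<tau> \<le> L" by (simp add: grid_def L_def)

lemma L_nonneg: "grid n \<le> T \<Longrightarrow> 0 \<le> L"
  using grid_in[of n n] by (auto simp: L_def)

text \<open>Over half a step a one-sided formula suffices. Replacing \<open>e\<close> by the filtered \<open>e\<close> costs
  \<open>\<bar>1 - \<phi>\<bar> \<parallel>P e\<parallel> \<le> K z K / \<omega> = K\<^sup>2 \<tau>\<close>.\<close>

lemma b_filtered_half_step:
  assumes s: "s \<in> {t0..T}" and t: "t \<in> {t0..T}" and st: "\<bar>s - t\<bar> = \<tau> / 2"
  shows "norm (b s - b t + (s - t) *\<^sub>R B (fil \<phi> (e t))) \<le> K ^ 3 * \<tau>\<^sup>2"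
proof -
  have "b s - b t + (s - t) *\<^sub>R B (fil \<phi> (e t))
      = (b s - b t + (s - t) *\<^sub>R B (e t)) - ((s - t) * (1 - \<phi>)) *\<^sub>R B (P (e t))"
    by (simp add: filter_op_def B.add B.diff B.scaleR algebra_simps)
  also have "norm \<dots> \<le> K\<^sup>2 * (s - t)\<^sup>2 + \<tau> / 2 * (K * z) * (K * (K / \<omega>))"
  proof (rule norm_diff_mono[OF b_first_order[OF s t]])
    show "norm (((s - t) * (1 - \<phi>)) *\<^sub>R B (P (e t))) \<le> \<tau> / 2 * (K * z) * (K * (K / \<omega>))"
      unfolding norm_scaleR abs_mult st
      using norm_B_bound[OF norm_Pe_le[OF t]] filter_values(8) tau_pos z_pos K_pos
      by (intro mult_mono) auto
  qed
  also have "(s - t)\<^sup>2 = (\<tau> / 2)\<^sup>2" by (metis st power2_abs)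
  also have "(\<tau> / 2)\<^sup>2 = \<tau>\<^sup>2 / 4" by (simp add: power_divide)
  also have "\<tau> / 2 * (K * z) * (K * (K / \<omega>)) = K ^ 3 * \<tau>\<^sup>2 / 2"
    using omega_pos by (simp add: z_def power2_eq_square power3_eq_cube)
  also have "K\<^sup>2 * (\<tau>\<^sup>2 / 4) + K ^ 3 * \<tau>\<^sup>2 / 2 \<le> K ^ 3 * \<tau>\<^sup>2"
  proof -
    have "K\<^sup>2 * \<tau>\<^sup>2 \<le> K ^ 3 * \<tau>\<^sup>2" by (intro mult_right_mono K_power_mono) auto
    moreover have "0 \<le> K\<^sup>2 * \<tau>\<^sup>2" by simp
    ultimately show ?thesis by linarith
  qed
  finally show ?thesis .
qed

section \<open>Half-step values of b and the slow part of e\<close>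

text \<open>The ratio between the weight \<open>sinc(z/2) - \<phi>\<close>, with which \<open>P e\<close> enters the defect of the half steps of
  \<open>b\<close>, and the factor \<open>2 \<omega> sin(z/2)\<close> that relates \<open>P e\<close> to differences of \<open>P e'\<close>. Where \<open>sin(z/2) = 0\<close> the
  filter bound makes both vanish, and division by zero gives the appropriate value 0.\<close>

definition b_gain :: real where "b_gain = (sin (z / 2) / (z / 2) - \<phi>) / (2 * \<omega> * sin (z / 2))"

text \<open>The half-step error without the part that telescopes.\<close>

definition b_rest :: "nat \<Rightarrow> 'b" where "b_rest n = b_half_err n - (\<tau> * b_gain) *\<^sub>R B (P (de (mid n)))"

lemma b_gain_eq: "b_gain * (2 * \<omega> * sin (z / 2)) = sin (z / 2) / (z / 2) - \<phi>"
  using filter_values(7) omega_pos by (cases "sin (z / 2) = 0") (auto simp: b_gain_def)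

lemma abs_b_gain_le: "\<bar>b_gain\<bar> \<le> K * \<tau> / 2"
proof (cases "sin (z / 2) = 0")
  case False
  have "\<bar>b_gain\<bar> = \<bar>sin (z / 2) / (z / 2) - \<phi>\<bar> / (2 * \<omega> * \<bar>sin (z / 2)\<bar>)"
    unfolding b_gain_def using omega_pos by (simp add: abs_divide abs_mult)
  also have "\<dots> \<le> (K * z * \<bar>sin (z / 2)\<bar>) / (2 * \<omega> * \<bar>sin (z / 2)\<bar>)"
    using filter_values(7) omega_pos by (intro divide_right_mono) auto
  also have "\<dots> = K * \<tau> / 2" using False omega_pos by (simp add: z_def)
  finally show ?thesis .
qed (use K_pos tau_pos in \<open>simp add: b_gain_def\<close>)

lemma mid_in: "mid n \<le> T \<Longrightarrow> j \<le> n \<Longrightarrow> mid j \<in> {t0..T}"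
  using grid_le[of j n] t0_le_grid[of j] tau_pos by (simp add: mid_def)

lemma norm_b_gain_term: "mid n \<le> T \<Longrightarrow> norm ((\<tau> * b_gain) *\<^sub>R B (P (de (mid n)))) \<le> K ^ 3 * \<tau>\<^sup>2 / 2"
proof -
  assume n: "mid n \<le> T"
  have "norm (P (de (mid n))) \<le> K"
    using norm_P_le[of "de (mid n)"] norm_de_le[OF mid_in[OF n order_refl]] by linarith
  then have "norm ((\<tau> * b_gain) *\<^sub>R B (P (de (mid n)))) \<le> \<tau> * (K * \<tau> / 2) * (K * K)"
    unfolding norm_scaleR abs_mult using abs_b_gain_le tau_pos K_pos
    by (intro mult_mono norm_B_bound) auto
  then show ?thesis by (simp add: power2_eq_square power3_eq_cube mult_ac)
qed

text \<open>\<open>b_half_steps\<close> gives the increment of \<open>b\<close> between midpoints and \<open>Pe_symmetric(2)\<close> that of \<open>P e'\<close>. With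
  the factor \<open>b_gain\<close> the terms in \<open>P e\<close> cancel exactly, and only third-order remainders and the error of
  \<open>e\<close> are left.\<close>

lemma b_rest_step:
  assumes n: "mid (Suc n) \<le> T"
  shows "norm (b_rest (Suc n) - b_rest n + \<tau> *\<^sub>R B (fil \<phi> (e_err (Suc n)))) \<le> K ^ 5 * \<tau> ^ 3"
proof -
  define t h where "t = grid (Suc n)" and "h = \<tau> / 2"
  have th: "mid (Suc n) = t + h" "mid n = t - h"
    by (simp_all add: t_def h_def mid_def grid_Suc)
  have in1: "t - h \<in> {t0..T}" "t + h \<in> {t0..T}" "0 \<le> h"
    using mid_in[OF n, of n] mid_in[OF n, of "Suc n"] tau_pos by (simp_all add: th h_def)
  have wh: "\<omega> * h = z / 2" by (simp add: z_def h_def)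
  define X where "X = b (t + h) - b (t - h) + B ((2 * h) *\<^sub>R Q (e t) + (2 * sin (z / 2) / \<omega>) *\<^sub>R P (e t))"
  define Y where "Y = P (de (t + h)) - P (de (t - h)) + (2 * \<omega> * sin (z / 2)) *\<^sub>R P (e t)"
  have X: "norm X \<le> 4 * K ^ 4 * h ^ 3"
    unfolding X_def using b_half_steps[OF in1] by (simp add: wh)
  have Y: "norm Y \<le> 2 * K ^ 3 * h"
    unfolding Y_def using Pe_symmetric(2)[OF in1] by (simp add: wh)
  have coef: "\<tau> * (b_gain * (2 * \<omega> * sin (z / 2))) = 2 * sin (z / 2) / \<omega> - \<tau> * \<phi>"
    unfolding b_gain_eq using tau_pos omega_pos by (simp add: z_def field_simps)
  have "b_rest (Suc n) - b_rest n + \<tau> *\<^sub>R B (fil \<phi> (e_err (Suc n)))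
      = (b (t + h) - b (t - h) + \<tau> *\<^sub>R B (fil \<phi> (e t)))
        - (\<tau> * b_gain) *\<^sub>R B (P (de (t + h)) - P (de (t - h)))"
    by (simp add: b_rest_def b_half_err_def th bh_Suc e_err_def fil_diff B.diff algebra_simps flip: t_def)
  also have "\<dots> = X - (\<tau> * b_gain) *\<^sub>R B Y"
  proof -
    have "(\<tau> * b_gain) *\<^sub>R B Y = (\<tau> * b_gain) *\<^sub>R B (P (de (t + h)) - P (de (t - h)))
        + (\<tau> * (b_gain * (2 * \<omega> * sin (z / 2)))) *\<^sub>R B (P (e t))"
      by (simp add: Y_def B.add B.scaleR scaleR_right_distrib mult.assoc)
    moreover have "X = (b (t + h) - b (t - h)) + (\<tau> *\<^sub>R B (Q (e t)) + (2 * sin (z / 2) / \<omega>) *\<^sub>R B (P (e t)))"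
      by (simp add: X_def h_def B.add B.scaleR)
    moreover have "\<tau> *\<^sub>R B (fil \<phi> (e t)) = \<tau> *\<^sub>R B (Q (e t)) + (\<tau> * \<phi>) *\<^sub>R B (P (e t))"
      by (simp add: fil_eq B.add B.scaleR scaleR_right_distrib)
    ultimately show ?thesis unfolding coef by (simp add: algebra_simps)
  qed
  also have "norm \<dots> \<le> 4 * K ^ 4 * h ^ 3 + \<tau> * (K * \<tau> / 2) * (K * (2 * K ^ 3 * h))"
  proof (rule norm_diff_mono[OF X])
    show "norm ((\<tau> * b_gain) *\<^sub>R B Y) \<le> \<tau> * (K * \<tau> / 2) * (K * (2 * K ^ 3 * h))"
      unfolding norm_scaleR abs_mult using abs_b_gain_le tau_pos K_pos Y
      by (intro mult_mono norm_B_bound) auto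
  qed
  also have "\<dots> = K ^ 4 * \<tau> ^ 3 / 2 + K ^ 5 * \<tau> ^ 3 / 2"
    by (simp add: h_def power_numeral_reduce mult_ac)
  also have "\<dots> \<le> K ^ 5 * \<tau> ^ 3"
  proof -
    have "K ^ 4 * \<tau> ^ 3 \<le> K ^ 5 * \<tau> ^ 3" using tau_pos by (intro mult_right_mono K_power_mono) auto
    then show ?thesis by linarith
  qed
  finally show ?thesis .
qed

lemma b_rest_bound:
  "mid n \<le> T \<Longrightarrow> norm (b_rest n) \<le> norm (b_rest 0) + real n * (K ^ 5 * \<tau> ^ 3)
    + 2 * K\<^sup>2 * \<tau> * (\<Sum>j=1..n. norm (e_err j))"
proof (induction n)
  case (Suc n)
  have n: "mid n \<le> T" using Suc.prems tau_pos by (simp add: mid_def grid_Suc)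
  have "norm (b_rest (Suc n)) = norm (b_rest n + (b_rest (Suc n) - b_rest n + \<tau> *\<^sub>R B (fil \<phi> (e_err (Suc n))))
      - \<tau> *\<^sub>R B (fil \<phi> (e_err (Suc n))))" by simp
  also have "\<dots> \<le> norm (b_rest n) + K ^ 5 * \<tau> ^ 3 + norm (\<tau> *\<^sub>R B (fil \<phi> (e_err (Suc n))))"
    by (rule norm_diff_mono[OF norm_triangle_mono[OF order_refl b_rest_step[OF Suc.prems]] order_refl])
  also have "norm (\<tau> *\<^sub>R B (fil \<phi> (e_err (Suc n)))) \<le> \<tau> * (2 * K\<^sup>2 * norm (e_err (Suc n)))"
    unfolding norm_scaleR using norm_B_fil_le tau_pos by (intro mult_mono) auto
  finally show ?case using Suc.IH[OF n] by (simp add: algebra_simps)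
qed simp

lemma b_half_err_bound:
  assumes n: "mid n \<le> T"
  shows "norm (b_half_err n) \<le> (2 * K ^ 3 + L * K ^ 5) * \<tau>\<^sup>2 + 2 * K\<^sup>2 * \<tau> * (\<Sum>j=1..n. norm (e_err j))"
proof -
  have m0: "mid 0 \<le> T" "grid 0 \<in> {t0..T}" "mid 0 \<in> {t0..T}"
    using mid_in[OF n, of 0] tau_pos by (auto simp: mid_def grid_def)
  have "b_half_err 0 = b (mid 0) - b (grid 0) + (mid 0 - grid 0) *\<^sub>R B (fil \<phi> (e (grid 0)))"
    by (simp add: b_half_err_def bh_def initial mid_def grid_def)
  then have "norm (b_half_err 0) \<le> K ^ 3 * \<tau>\<^sup>2"
    using b_filtered_half_step[OF m0(3,2)] tau_pos by (simp add: mid_def)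
  then have g0: "norm (b_rest 0) \<le> K ^ 3 * \<tau>\<^sup>2 + K ^ 3 * \<tau>\<^sup>2 / 2"
    unfolding b_rest_def using norm_b_gain_term[OF m0(1)] by (intro norm_diff_mono) auto
  have "real n * \<tau> \<le> L" using n tau_pos by (simp add: mid_def grid_def L_def)
  then have "(real n * \<tau>) * (K ^ 5 * \<tau>\<^sup>2) \<le> L * (K ^ 5 * \<tau>\<^sup>2)" using K_pos by (intro mult_right_mono) auto
  then have nL: "real n * (K ^ 5 * \<tau> ^ 3) \<le> L * K ^ 5 * \<tau>\<^sup>2"
    by (simp add: power_numeral_reduce mult_ac)
  have "norm (b_half_err n) \<le> norm (b_rest n) + norm ((\<tau> * b_gain) *\<^sub>R B (P (de (mid n))))"
    using norm_triangle_ineq[of "b_rest n" "(\<tau> * b_gain) *\<^sub>R B (P (de (mid n)))"] by (simp add: b_rest_def)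
  then show ?thesis
    using b_rest_bound[OF n] norm_b_gain_term[OF n] g0 nL by (simp add: algebra_simps)
qed

lemma mid_le: "j < n \<Longrightarrow> grid n \<le> T \<Longrightarrow> mid j \<le> T"
  using grid_le[of "Suc j" n] tau_pos by (simp add: mid_def grid_Suc)

lemma Q_e_err_step:
  assumes n: "grid (Suc n) \<le> T"
  shows "norm (Q (e_err (Suc n)) - Q (e_err n) - \<tau> *\<^sub>R Q (A (b_half_err n))) \<le> K ^ 3 * \<tau> ^ 3"
proof -
  have "mid n - \<tau> / 2 \<in> {t0..T}" "mid n + \<tau> / 2 \<in> {t0..T}" "0 \<le> \<tau> / 2"
    using grid_in[OF n, of n] grid_in[OF n, of "Suc n"] tau_pos by (simp_all add: mid_def grid_Suc)
  moreover have "mid n + \<tau> / 2 = grid (Suc n)" "mid n - \<tau> / 2 = grid n"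
    by (simp_all add: mid_def grid_Suc)
  ultimately have "norm (Q (e (grid (Suc n))) - Q (e (grid n)) - \<tau> *\<^sub>R Q (A (b (mid n)))) \<le> 2 * K ^ 3 * (\<tau> / 2) ^ 3"
    using Qe_midpoint[of "mid n" "\<tau> / 2"] by simp
  also have "\<dots> \<le> K ^ 3 * \<tau> ^ 3" using K_pos tau_pos by (simp add: power_divide)
  finally show ?thesis
    by (simp add: e_err_def b_half_err_def Q.diff A.diff Q_en_Suc algebra_simps)
qed

lemma Q_e_err_sum:
  "grid n \<le> T \<Longrightarrow> norm (Q (e_err n)) \<le> (\<Sum>j<n. \<tau> * (K * norm (b_half_err j)) + K ^ 3 * \<tau> ^ 3)"
proof (induction n)
  case 0
  then show ?case by (simp add: e_err_def initial grid_def Q.zero)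
next
  case (Suc n)
  have n: "grid n \<le> T" using Suc.prems tau_pos by (simp add: grid_Suc)
  have b: "norm (\<tau> *\<^sub>R Q (A (b_half_err n))) \<le> \<tau> * (K * norm (b_half_err n))"
    unfolding norm_scaleR using tau_pos
    by (intro mult_mono order_trans[OF norm_Q_le norm_A_le]) auto
  have "norm (Q (e_err (Suc n))) = norm ((Q (e_err n) + \<tau> *\<^sub>R Q (A (b_half_err n)))
      + (Q (e_err (Suc n)) - Q (e_err n) - \<tau> *\<^sub>R Q (A (b_half_err n))))" by simp
  also have "\<dots> \<le> norm (Q (e_err n)) + \<tau> * (K * norm (b_half_err n)) + K ^ 3 * \<tau> ^ 3"
    by (rule norm_triangle_mono[OF norm_triangle_mono[OF order_refl b] Q_e_err_step[OF Suc.prems]])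
  finally show ?case using Suc.IH[OF n] by simp
qed

lemma Q_e_err_bound:
  assumes n: "grid n \<le> T"
  shows "norm (Q (e_err n)) \<le> (L * K * (2 * K ^ 3 + L * K ^ 5) + L * K ^ 3) * \<tau>\<^sup>2
    + 2 * L * K ^ 3 * \<tau> * (\<Sum>j<n. norm (e_err j))"
proof -
  define S where "S = (\<Sum>j<n. norm (e_err j))"
  define D where "D = K * (2 * K ^ 3 + L * K ^ 5) * \<tau>\<^sup>2 + 2 * K ^ 3 * \<tau> * S + K ^ 3 * \<tau>\<^sup>2"
  have S0: "0 \<le> S" by (simp add: S_def sum_nonneg)
  have "norm (Q (e_err n)) \<le> (\<Sum>j<n. \<tau> * (K * norm (b_half_err j)) + K ^ 3 * \<tau> ^ 3)"
    by (rule Q_e_err_sum[OF n])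
  also have "\<dots> \<le> (\<Sum>j<n. \<tau> * D)"
  proof (rule sum_mono)
    fix j assume j: "j \<in> {..<n}"
    have "(\<Sum>i=1..j. norm (e_err i)) \<le> S" unfolding S_def using j by (intro sum_mono2) auto
    then have "2 * K\<^sup>2 * \<tau> * (\<Sum>i=1..j. norm (e_err i)) \<le> 2 * K\<^sup>2 * \<tau> * S"
      using tau_pos K_pos by (intro mult_left_mono) auto
    then have "norm (b_half_err j) \<le> (2 * K ^ 3 + L * K ^ 5) * \<tau>\<^sup>2 + 2 * K\<^sup>2 * \<tau> * S"
      using b_half_err_bound[OF mid_le[OF _ n, of j]] j by simp
    then have "K * norm (b_half_err j) \<le> K * ((2 * K ^ 3 + L * K ^ 5) * \<tau>\<^sup>2 + 2 * K\<^sup>2 * \<tau> * S)"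
      using K_pos by (intro mult_left_mono) auto
    then have "K * norm (b_half_err j) + K ^ 3 * \<tau>\<^sup>2 \<le> D"
      by (simp add: D_def algebra_simps power_numeral_reduce)
    then have "\<tau> * (K * norm (b_half_err j) + K ^ 3 * \<tau>\<^sup>2) \<le> \<tau> * D"
      using tau_pos by (intro mult_left_mono) auto
    then show "\<tau> * (K * norm (b_half_err j)) + K ^ 3 * \<tau> ^ 3 \<le> \<tau> * D"
      by (simp add: algebra_simps power_numeral_reduce)
  qed
  also have "\<dots> = (real n * \<tau>) * D" by simp
  also have "\<dots> \<le> L * D"
    using steps_le_L[OF n] S0 tau_pos K_pos L_nonneg[OF n] unfolding D_def
    by (intro mult_right_mono add_nonneg_nonneg mult_nonneg_nonneg) auto
  also have "L * D = (L * K * (2 * K ^ 3 + L * K ^ 5) + L * K ^ 3) * \<tau>\<^sup>2 + 2 * L * K ^ 3 * \<tau> * S"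
    unfolding D_def by (simp only: distrib_left distrib_right mult_ac add_ac)
  finally show ?thesis by (simp only: S_def)
qed

section \<open>The oscillating part of e\<close>

text \<open>The quasi-stationary solution \<open>e_corr\<close> of the error recursion: a constant force \<open>f\<close> in
  \<open>x\<^sub>n\<^sub>+\<^sub>1 - 2 cos z x\<^sub>n + x\<^sub>n\<^sub>-\<^sub>1 = f\<close> has the stationary response \<open>f / (2 - 2 cos z)\<close>. Where the denominator vanishes,
  so does the force.\<close>

definition rho :: real where "rho = ((sin (z / 2) / (z / 2))\<^sup>2 - Psi) / (2 - 2 * cos z)"
definition e_corr :: "nat \<Rightarrow> 'a" where "e_corr n = (\<tau>\<^sup>2 * rho) *\<^sub>R P (G (Q (e (grid n))))"
definition e_rest :: "nat \<Rightarrow> 'a" where "e_rest n = P (e_err n) - e_corr n"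

lemma cos_z_half: "2 - 2 * cos z = 4 * (sin (z / 2))\<^sup>2"
  using cos_double_sin[of "z / 2"] by simp

lemma rho_eq: "rho * (2 - 2 * cos z) = (sin (z / 2) / (z / 2))\<^sup>2 - Psi"
  using filter_values(4) by (cases "sin (z / 2) = 0") (auto simp: rho_def cos_z_half)

lemma abs_rho_le: "\<bar>rho\<bar> \<le> K / 4"
proof (cases "sin (z / 2) = 0")
  case False
  then have "\<bar>rho\<bar> * (4 * (sin (z / 2))\<^sup>2) \<le> K / 4 * (4 * (sin (z / 2))\<^sup>2)"
    using filter_values(4) unfolding rho_eq[symmetric] cos_z_half by (simp add: abs_mult)
  then show ?thesis using False by simp
qed (use K_pos in \<open>simp add: rho_def cos_z_half\<close>)

lemma norm_PGQ_le: "norm x \<le> c \<Longrightarrow> norm ((\<tau>\<^sup>2 * rho) *\<^sub>R P (G (Q x))) \<le> \<tau>\<^sup>2 * (K / 4) * (K\<^sup>2 * c)"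
  unfolding norm_scaleR abs_mult using abs_rho_le K_pos norm_Q_le[of x]
  by (intro mult_mono norm_PG_bound) auto

lemma norm_e_corr_le: "grid n \<le> T \<Longrightarrow> norm (e_corr n) \<le> K ^ 4 * \<tau>\<^sup>2 / 4"
  using norm_PGQ_le[OF norm_e_le[OF grid_in[of n n]]] by (simp add: e_corr_def power_numeral_reduce mult_ac)

lemma sinc_kernels:
  "2 * (1 - cos z) / \<omega>\<^sup>2 = \<tau>\<^sup>2 * (sin (z / 2) / (z / 2))\<^sup>2"
  "\<tau> * sin z / \<omega> = \<tau>\<^sup>2 * (sin z / z)"
  "sin z / \<omega> = \<tau> * (sin z / z)"
proof -
  have "2 * (1 - cos z) = 4 * (sin (z / 2))\<^sup>2" using cos_z_half by simp
  then show "2 * (1 - cos z) / \<omega>\<^sup>2 = \<tau>\<^sup>2 * (sin (z / 2) / (z / 2))\<^sup>2"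
    using tau_pos omega_pos by (simp add: z_def power_divide power_mult_distrib)
qed (use tau_pos omega_pos in \<open>simp_all add: z_def power2_eq_square\<close>)

lemma e_err_0: "e_err 0 = 0" by (simp add: e_err_def initial grid_def)

text \<open>The terms in \<open>P G Q e\<close> cancel exactly: the quasi-stationary solution starts with the right velocity
  because the scheme is symmetric. The term with \<open>P A b\<^sub>0\<close> is \<open>O(\<tau>\<^sup>3)\<close> by the bound on
  \<open>\<omega>\<^sup>2 P A b\<^sub>0\<close>.\<close>

lemma e_rest_start:
  assumes n: "grid 1 \<le> T"
  shows "norm (e_rest 1 - cos z *\<^sub>R e_rest 0) \<le> 4 * K ^ 4 * \<tau> ^ 3"
proof -
  have t0: "t0 \<in> {t0..T}" "t0 + \<tau> \<le> T" "grid 0 = t0" "grid 1 = t0 + \<tau>" "t0 + \<tau> \<in> {t0..T}"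
    using n tau_pos by (auto simp: grid_def)
  have wt: "\<omega> * \<tau> = z" by (simp add: z_def)
  define R where "R = P (e (t0 + \<tau>)) - (cos z *\<^sub>R P (e t0) + (sin z / \<omega>) *\<^sub>R P (de t0)
      + ((1 - cos z) / \<omega>\<^sup>2) *\<^sub>R P (G (Q (e t0))) + (\<tau> * sin z / (2 * \<omega>)) *\<^sub>R P (G (P (e t0))))"
  have R: "norm R \<le> 2 * K ^ 3 * \<tau> ^ 3"
    unfolding R_def using Pe_first_step[of \<tau>] t0 tau_pos by (simp add: wt)
  define U F H where "U = P (A (b t0))" and "F = P (G (Q (e t0)))" and "H = P (G (P (e t0)))"
  have de0: "(sin z / \<omega>) *\<^sub>R P (de t0) = (\<tau> * (sin z / z)) *\<^sub>R U - (\<omega> * sin z) *\<^sub>R P (p t0)"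
  proof -
    have "(sin z / \<omega>) * \<omega>\<^sup>2 = \<omega> * sin z" using omega_pos by (simp add: power2_eq_square)
    then show ?thesis
      unfolding de_def P.diff P.scaleR scaleR_right_diff_distrib scaleR_scaleR U_def sinc_kernels(3)[symmetric]
      by simp
  qed
  have half1: "(1 - cos z) / \<omega>\<^sup>2 = \<tau>\<^sup>2 / 2 * Psi + \<tau>\<^sup>2 * rho * (1 - cos z)"
  proof -
    define X where "X = (1 - cos z) / \<omega>\<^sup>2"
    have "2 * X = 2 * (1 - cos z) / \<omega>\<^sup>2" by (simp add: X_def)
    also have "\<dots> = \<tau>\<^sup>2 * (rho * (2 - 2 * cos z) + Psi)"
      unfolding sinc_kernels(1) rho_eq by simp
    finally have "X = \<tau>\<^sup>2 / 2 * Psi + \<tau>\<^sup>2 * rho * (1 - cos z)" by (simp add: algebra_simps)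
    then show ?thesis by (simp only: X_def)
  qed
  have half2: "\<tau> * sin z / (2 * \<omega>) = \<tau>\<^sup>2 / 2 * (sin z / z)"
  proof -
    have "\<tau> * sin z / (2 * \<omega>) = (\<tau> * sin z / \<omega>) / 2" by simp
    then show ?thesis unfolding sinc_kernels(2) by simp
  qed
  have bh0: "P (A (bh 0)) = U + (\<tau> / 2) *\<^sub>R (F + \<phi> *\<^sub>R H)"
    by (simp add: bh_def initial A.diff A.scaleR P.diff P.scaleR U_def F_def H_def fil_eq
        G_def B.add B.scaleR A.add P.add P.neg algebra_simps)
  have Pe: "P (e (t0 + \<tau>)) = R + (cos z *\<^sub>R P (e t0)
      + ((\<tau> * (sin z / z)) *\<^sub>R U - (\<omega> * sin z) *\<^sub>R P (p t0))
      + (\<tau>\<^sup>2 / 2 * Psi + \<tau>\<^sup>2 * rho * (1 - cos z)) *\<^sub>R F + (\<tau>\<^sup>2 / 2 * (sin z / z)) *\<^sub>R H)"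
    unfolding R_def F_def[symmetric] H_def[symmetric] de0 half1 half2 by simp
  have Pen: "P (en 1) = cos z *\<^sub>R P (e t0) - (\<omega> * sin z) *\<^sub>R P (p t0) + (\<tau> * Psi) *\<^sub>R U
      + (\<tau>\<^sup>2 / 2 * Psi) *\<^sub>R F + (\<tau>\<^sup>2 / 2 * Psi * \<phi>) *\<^sub>R H"
    using P_en_Suc[of 0] unfolding bh0
    by (simp add: initial scaleR_right_distrib power2_eq_square mult_ac)
  have Y0: "e_corr 0 = (\<tau>\<^sup>2 * rho) *\<^sub>R F" by (simp add: e_corr_def t0 F_def)
  have Y1: "e_corr 1 = (\<tau>\<^sup>2 * rho) *\<^sub>R P (G (Q (e (t0 + \<tau>) - e t0))) + (\<tau>\<^sup>2 * rho) *\<^sub>R F"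
    unfolding e_corr_def t0 F_def by (simp add: P.diff G.diff Q.diff scaleR_right_diff_distrib)
  have "e_rest 1 - cos z *\<^sub>R e_rest 0 = P (e (t0 + \<tau>)) - P (en 1) - e_corr 1 + cos z *\<^sub>R e_corr 0"
    by (simp add: e_rest_def e_err_0 P.zero e_err_def[of "Suc 0"] t0[simplified] P.diff)
  also have "\<dots> = R + (\<tau> * (sin z / z - Psi)) *\<^sub>R U + (\<tau>\<^sup>2 / 2 * (sin z / z - Psi * \<phi>)) *\<^sub>R H
      - (\<tau>\<^sup>2 * rho) *\<^sub>R P (G (Q (e (t0 + \<tau>) - e t0)))"
    unfolding Pe Pen Y0 Y1 by (simp add: algebra_simps)
  also have "norm \<dots> \<le> 2 * K ^ 3 * \<tau> ^ 3 + \<tau> * (K * z * z) * (K / \<omega>\<^sup>2)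
      + \<tau>\<^sup>2 / 2 * (K * z * 1) * (K\<^sup>2 * (K / \<omega>)) + \<tau>\<^sup>2 * (K / 4) * (K\<^sup>2 * (K * \<tau>))"
  proof (intro norm_diff_mono norm_triangle_mono R norm_PGQ_le)
    show "norm ((\<tau> * (sin z / z - Psi)) *\<^sub>R U) \<le> \<tau> * (K * z * z) * (K / \<omega>\<^sup>2)"
      unfolding norm_scaleR abs_mult
    proof (intro mult_mono)
      have "K * z * \<bar>sin z\<bar> \<le> K * z * z"
        using abs_sin_x_le_abs_x[of z] z_pos K_pos by (intro mult_left_mono) auto
      then show "\<bar>sin z / z - Psi\<bar> \<le> K * z * z" using filter_values(6) by linarith
      show "norm U \<le> K / \<omega>\<^sup>2"
        using initial_Ab omega_pos by (simp add: U_def le_divide_eq mult.commute)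
    qed (use tau_pos z_pos K_pos in auto)
    show "norm ((\<tau>\<^sup>2 / 2 * (sin z / z - Psi * \<phi>)) *\<^sub>R H) \<le> \<tau>\<^sup>2 / 2 * (K * z * 1) * (K\<^sup>2 * (K / \<omega>))"
      unfolding norm_scaleR abs_mult
    proof (intro mult_mono)
      have "K * z * \<bar>sin z\<bar> \<le> K * z * 1" using z_pos K_pos by (intro mult_left_mono) auto
      then show "\<bar>sin z / z - Psi * \<phi>\<bar> \<le> K * z * 1" using filter_values(5) by linarith
      show "norm H \<le> K\<^sup>2 * (K / \<omega>)" unfolding H_def by (rule norm_PG_bound[OF norm_Pe_le[OF t0(1)]])
    qed (use tau_pos z_pos K_pos in auto)
    show "norm (e (t0 + \<tau>) - e t0) \<le> K * \<tau>"
      using e_lipschitz[OF t0(5,1)] tau_pos by simp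
  qed
  also have "\<dots> = 2 * (K ^ 3 * \<tau> ^ 3) + K\<^sup>2 * \<tau> ^ 3 + K ^ 4 * \<tau> ^ 3 / 2 + K ^ 4 * \<tau> ^ 3 / 4"
    using omega_pos by (simp add: z_def power_numeral_reduce mult_ac)
  also have "\<dots> \<le> 4 * K ^ 4 * \<tau> ^ 3"
  proof -
    have "K ^ 3 * \<tau> ^ 3 \<le> K ^ 4 * \<tau> ^ 3" "K\<^sup>2 * \<tau> ^ 3 \<le> K ^ 4 * \<tau> ^ 3"
      using tau_pos by (intro mult_right_mono K_power_mono; simp)+
    moreover have "0 \<le> K ^ 4 * \<tau> ^ 3" using tau_pos K_pos by simp
    ultimately show ?thesis by linarith
  qed
  finally show ?thesis .
qed

text \<open>The defect is split into \<open>u\<close>, which is small by itself, and \<open>sin z v\<close>, whose factor \<open>sin z\<close> cancels the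
  denominator of the fundamental solution. Subtracting \<open>e_corr\<close> replaces the force \<open>P G Q e\<close> by its second
  difference, which is \<open>O(\<tau>\<^sup>2)\<close> because \<open>Q e''\<close> is bounded.\<close>

lemma e_rest_step:
  assumes n: "grid (Suc (Suc n)) \<le> T"
  obtains u v where "e_rest (Suc (Suc n)) - (2 * cos z) *\<^sub>R e_rest (Suc n) + e_rest n = u + sin z *\<^sub>R v"
    "norm u \<le> 2 * K ^ 4 * \<tau>\<^sup>2 * norm (e_err (Suc n)) + 5 * K ^ 6 * \<tau> ^ 4" "norm v \<le> K ^ 4 * \<tau> ^ 3"
proof -
  define t where "t = grid (Suc n)"
  have grid: "grid (Suc (Suc n)) = t + \<tau>" "grid (Suc n) = t" "grid n = t - \<tau>" by (simp_all add: t_def grid_Suc)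
  have in1: "t - \<tau> \<in> {t0..T}" "t + \<tau> \<in> {t0..T}" "0 \<le> \<tau>" and t: "t \<in> {t0..T}"
    using grid_in[OF n, of n] grid_in[OF n, of "Suc n"] grid_in[OF n, of "Suc (Suc n)"] tau_pos
    by (simp_all add: grid)
  have wt: "\<omega> * \<tau> = z" by (simp add: z_def)
  define F H where "F = P (G (Q (e t)))" and "H = P (G (P (e t)))"
  define g where "g = P (G (fil \<phi> (e_err (Suc n))))"
  define D where "D = e (t + \<tau>) + e (t - \<tau>) - 2 *\<^sub>R e t"
  define R where "R = P (e (t + \<tau>)) + P (e (t - \<tau>)) - (2 * cos z) *\<^sub>R P (e t)
      - (2 * (1 - cos z) / \<omega>\<^sup>2) *\<^sub>R F - (\<tau> * sin z / \<omega>) *\<^sub>R H"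
  have R: "norm R \<le> 4 * K ^ 5 * \<tau> ^ 4"
    unfolding R_def F_def H_def using Pe_two_step[OF in1] by (simp only: wt)
  define s' where "s' = sin z / z - Psi * \<phi>"
  define v where "v = (\<tau>\<^sup>2 * (s' / sin z)) *\<^sub>R H"
  have sv: "sin z *\<^sub>R v = (\<tau>\<^sup>2 * s') *\<^sub>R H"
    using filter_values(5) by (cases "sin z = 0") (auto simp: v_def s'_def)
  have v: "norm v \<le> K ^ 4 * \<tau> ^ 3"
  proof -
    have "\<bar>s' / sin z\<bar> \<le> K * z"
      using filter_values(5) K_pos z_pos by (cases "sin z = 0") (auto simp: s'_def abs_divide divide_le_eq)
    then have "norm v \<le> \<tau>\<^sup>2 * (K * z) * (K\<^sup>2 * (K / \<omega>))"
      unfolding v_def norm_scaleR abs_mult H_def using K_pos z_pos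
      by (intro mult_mono norm_PG_bound[OF norm_Pe_le[OF t]]) auto
    also have "\<dots> = K ^ 4 * \<tau> ^ 3" using omega_pos by (simp add: z_def power_numeral_reduce mult_ac)
    finally show ?thesis .
  qed
  define u where "u = (\<tau>\<^sup>2 * Psi) *\<^sub>R g + R - (\<tau>\<^sup>2 * rho) *\<^sub>R P (G (Q D))"
  have u: "norm u \<le> 2 * K ^ 4 * \<tau>\<^sup>2 * norm (e_err (Suc n)) + 5 * K ^ 6 * \<tau> ^ 4"
  proof -
    have g: "norm ((\<tau>\<^sup>2 * Psi) *\<^sub>R g) \<le> \<tau>\<^sup>2 * K * (K\<^sup>2 * (2 * K * norm (e_err (Suc n))))"
      unfolding norm_scaleR abs_mult g_def using filter_values(3) K_pos
      by (intro mult_mono norm_PG_bound norm_fil_le) auto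
    have "Q D = Q (e (t + \<tau>)) + Q (e (t - \<tau>)) - 2 *\<^sub>R Q (e t)"
      by (simp add: D_def Q.add Q.diff Q.scaleR)
    then have "norm (Q D) \<le> 2 * K ^ 3 * \<tau>\<^sup>2" using Qe_symmetric[OF in1] by simp
    from norm_PGQ_le[OF this]
    have D: "norm ((\<tau>\<^sup>2 * rho) *\<^sub>R P (G (Q D))) \<le> \<tau>\<^sup>2 * (K / 4) * (K\<^sup>2 * (2 * K ^ 3 * \<tau>\<^sup>2))" by simp
    have "norm u \<le> \<tau>\<^sup>2 * K * (K\<^sup>2 * (2 * K * norm (e_err (Suc n)))) + 4 * K ^ 5 * \<tau> ^ 4
        + \<tau>\<^sup>2 * (K / 4) * (K\<^sup>2 * (2 * K ^ 3 * \<tau>\<^sup>2))"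
      unfolding u_def by (intro norm_diff_mono norm_triangle_mono g R D)
    also have "\<dots> = 2 * K ^ 4 * \<tau>\<^sup>2 * norm (e_err (Suc n)) + 4 * (K ^ 5 * \<tau> ^ 4) + K ^ 6 * \<tau> ^ 4 / 2"
      by (simp add: power_numeral_reduce mult_ac)
    also have "\<dots> \<le> 2 * K ^ 4 * \<tau>\<^sup>2 * norm (e_err (Suc n)) + 5 * K ^ 6 * \<tau> ^ 4"
    proof -
      have "K ^ 5 * \<tau> ^ 4 \<le> K ^ 6 * \<tau> ^ 4" by (intro mult_right_mono K_power_mono) auto
      moreover have "0 \<le> K ^ 6 * \<tau> ^ 4" by simp
      ultimately show ?thesis by linarith
    qed
    finally show ?thesis .
  qed
  have exact: "P (e (t + \<tau>)) - (2 * cos z) *\<^sub>R P (e t) + P (e (t - \<tau>))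
      = R + (\<tau>\<^sup>2 * (rho * (2 - 2 * cos z) + Psi)) *\<^sub>R F + (\<tau>\<^sup>2 * (s' + Psi * \<phi>)) *\<^sub>R H"
    unfolding R_def sinc_kernels rho_eq s'_def by simp
  have num: "P (en (Suc (Suc n))) - (2 * cos z) *\<^sub>R P (en (Suc n)) + P (en n)
      = (\<tau>\<^sup>2 * Psi) *\<^sub>R F + (\<tau>\<^sup>2 * Psi * \<phi>) *\<^sub>R H - (\<tau>\<^sup>2 * Psi) *\<^sub>R g"
  proof -
    have "en (Suc n) = e t - e_err (Suc n)" by (simp add: e_err_def grid)
    then have "P (G (fil \<phi> (en (Suc n)))) = F + \<phi> *\<^sub>R H - g"
      by (simp add: g_def F_def H_def fil_diff fil_eq[of \<phi> "e t"] G.diff G.add G.scaleR P.diff P.add P.scaleR)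
    then show ?thesis unfolding P_en_two_step
      by (simp add: scaleR_right_diff_distrib scaleR_right_distrib)
  qed
  have e_corr: "e_corr (Suc (Suc n)) - (2 * cos z) *\<^sub>R e_corr (Suc n) + e_corr n
      = (\<tau>\<^sup>2 * rho) *\<^sub>R P (G (Q D)) + (\<tau>\<^sup>2 * rho * (2 - 2 * cos z)) *\<^sub>R F"
  proof -
    have PD: "P (G (Q D)) = P (G (Q (e (t + \<tau>)))) + P (G (Q (e (t - \<tau>)))) - 2 *\<^sub>R F"
      by (simp add: D_def F_def P.add P.diff P.scaleR G.add G.diff G.scaleR Q.add Q.diff Q.scaleR)
    show ?thesis unfolding e_corr_def grid F_def[symmetric] PD by (simp add: algebra_simps)
  qed
  have "e_rest (Suc (Suc n)) - (2 * cos z) *\<^sub>R e_rest (Suc n) + e_rest n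
      = (P (e (t + \<tau>)) - (2 * cos z) *\<^sub>R P (e t) + P (e (t - \<tau>)))
        - (P (en (Suc (Suc n))) - (2 * cos z) *\<^sub>R P (en (Suc n)) + P (en n))
        - (e_corr (Suc (Suc n)) - (2 * cos z) *\<^sub>R e_corr (Suc n) + e_corr n)"
    unfolding e_rest_def e_err_def grid by (simp add: P.diff algebra_simps)
  also have "\<dots> = u + (\<tau>\<^sup>2 * s') *\<^sub>R H"
    unfolding exact num e_corr u_def by (simp add: algebra_simps)
  finally show ?thesis using that[of u v] u v unfolding sv by simp
qed

lemma norm_cheb_scaleR_le: "norm (cheb z k *\<^sub>R (u + sin z *\<^sub>R v)) \<le> real k * norm u + norm v"
proof -
  have "cheb z k *\<^sub>R (u + sin z *\<^sub>R v) = cheb z k *\<^sub>R u + sin (real k * z) *\<^sub>R v"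
    by (simp add: scaleR_right_distrib flip: cheb_mult_sin)
  moreover have "norm (cheb z k *\<^sub>R u) \<le> real k * norm u"
    unfolding norm_scaleR using abs_cheb_le by (intro mult_right_mono) auto
  moreover have "norm (sin (real k * z) *\<^sub>R v) \<le> 1 * norm v"
    unfolding norm_scaleR by (intro mult_right_mono) auto
  ultimately show ?thesis by (metis mult_1 norm_triangle_mono)
qed

text \<open>In the discrete variation-of-constants formula, a defect of size \<open>\<tau>\<^sup>4\<close> is summed over \<open>L / \<tau>\<close> steps with
  weights up to \<open>L / \<tau>\<close>, while the defect with the factor \<open>sin z\<close> has weights at most 1 and may be of size
  \<open>\<tau>\<^sup>3\<close>.\<close>

lemma P_e_err_bound:
  assumes n: "grid n \<le> T"
  shows "norm (P (e_err n)) \<le> (2 * K ^ 4 + 5 * L * K ^ 4 + 5 * L\<^sup>2 * K ^ 6) * \<tau>\<^sup>2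
    + 2 * L * K ^ 4 * \<tau> * (\<Sum>j<n. norm (e_err j))"
proof -
  have nL: "real n * \<tau> \<le> L" by (rule steps_le_L[OF n])
  have L: "0 \<le> L" by (rule L_nonneg[OF n])
  have w0: "norm (e_rest 0) \<le> K ^ 4 * \<tau>\<^sup>2 / 4"
    using norm_e_corr_le[of 0] grid_in[OF n, of 0] by (simp add: e_rest_def e_err_0 P.zero)
  have w1: "norm (cheb z n *\<^sub>R (e_rest 1 - cos z *\<^sub>R e_rest 0)) \<le> 4 * L * K ^ 4 * \<tau>\<^sup>2"
  proof (cases "n = 0")
    case False
    then have "grid 1 \<le> T" using grid_in[OF n, of 1] by simp
    from e_rest_start[OF this]
    have "norm (cheb z n *\<^sub>R (e_rest 1 - cos z *\<^sub>R e_rest 0)) \<le> real n * (4 * K ^ 4 * \<tau> ^ 3)"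
      unfolding norm_scaleR using abs_cheb_le by (intro mult_mono) auto
    also have "\<dots> = (real n * \<tau>) * (4 * K ^ 4 * \<tau>\<^sup>2)" by (simp add: power_numeral_reduce mult_ac)
    also have "\<dots> \<le> L * (4 * K ^ 4 * \<tau>\<^sup>2)" using nL by (intro mult_right_mono) auto
    finally show ?thesis by (simp add: mult_ac)
  qed (use L in simp)
  define d where "d j = e_rest (Suc j) - (2 * cos z) *\<^sub>R e_rest j + e_rest (j - 1)" for j
  define \<alpha> where "\<alpha> = 5 * L * K ^ 6 * \<tau> ^ 3 + K ^ 4 * \<tau> ^ 3"
  have \<alpha>0: "0 \<le> \<alpha>" using L tau_pos K_pos by (simp add: \<alpha>_def)
  have dj: "norm (cheb z (n - j) *\<^sub>R d j) \<le> 2 * L * K ^ 4 * \<tau> * norm (e_err j) + \<alpha>"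
    if j: "j \<in> {1..<n}" for j
  proof -
    obtain i where i: "j = Suc i" using j by (cases j) auto
    have "grid (Suc (Suc i)) \<le> T" using grid_in[OF n, of "Suc (Suc i)"] j i by simp
    then obtain u v where uv: "d j = u + sin z *\<^sub>R v"
      "norm u \<le> 2 * K ^ 4 * \<tau>\<^sup>2 * norm (e_err j) + 5 * K ^ 6 * \<tau> ^ 4" "norm v \<le> K ^ 4 * \<tau> ^ 3"
      using e_rest_step[of i] unfolding d_def i by auto
    have "norm (cheb z (n - j) *\<^sub>R d j) \<le> real (n - j) * norm u + norm v"
      unfolding uv(1) by (rule norm_cheb_scaleR_le)
    also have "\<dots> \<le> real n * (2 * K ^ 4 * \<tau>\<^sup>2 * norm (e_err j) + 5 * K ^ 6 * \<tau> ^ 4) + K ^ 4 * \<tau> ^ 3"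
      using uv(2,3) by (intro add_mono mult_mono) auto
    also have "real n * (2 * K ^ 4 * \<tau>\<^sup>2 * norm (e_err j) + 5 * K ^ 6 * \<tau> ^ 4)
        = (real n * \<tau>) * (2 * K ^ 4 * \<tau> * norm (e_err j) + 5 * K ^ 6 * \<tau> ^ 3)"
      by (simp add: power_numeral_reduce algebra_simps)
    also have "\<dots> \<le> L * (2 * K ^ 4 * \<tau> * norm (e_err j) + 5 * K ^ 6 * \<tau> ^ 3)"
      using nL tau_pos K_pos by (intro mult_right_mono) auto
    finally show ?thesis by (simp add: \<alpha>_def algebra_simps)
  qed
  have sub: "(\<Sum>j=1..<n. norm (e_err j)) \<le> (\<Sum>j<n. norm (e_err j))" by (intro sum_mono2) auto
  have "norm (\<Sum>j=1..<n. cheb z (n - j) *\<^sub>R d j) \<le> (\<Sum>j=1..<n. 2 * L * K ^ 4 * \<tau> * norm (e_err j) + \<alpha>)"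
    using dj by (rule sum_norm_le)
  also have "\<dots> = 2 * L * K ^ 4 * \<tau> * (\<Sum>j=1..<n. norm (e_err j)) + real (n - 1) * \<alpha>"
    by (simp add: sum.distrib sum_distrib_left)
  also have "\<dots> \<le> 2 * L * K ^ 4 * \<tau> * (\<Sum>j<n. norm (e_err j)) + real n * \<alpha>"
    using sub L tau_pos K_pos \<alpha>0 by (intro add_mono mult_left_mono mult_right_mono) auto
  also have "real n * \<alpha> = (real n * \<tau>) * (5 * L * K ^ 6 * \<tau>\<^sup>2 + K ^ 4 * \<tau>\<^sup>2)"
    by (simp add: \<alpha>_def power_numeral_reduce algebra_simps)
  also have "\<dots> \<le> L * (5 * L * K ^ 6 * \<tau>\<^sup>2 + K ^ 4 * \<tau>\<^sup>2)"
    using nL L K_pos by (intro mult_right_mono) auto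
  finally have s: "norm (\<Sum>j=1..<n. cheb z (n - j) *\<^sub>R d j)
      \<le> 2 * L * K ^ 4 * \<tau> * (\<Sum>j<n. norm (e_err j)) + L * (5 * L * K ^ 6 * \<tau>\<^sup>2 + K ^ 4 * \<tau>\<^sup>2)"
    by simp
  have c0: "norm (cos (real n * z) *\<^sub>R e_rest 0) \<le> K ^ 4 * \<tau>\<^sup>2 / 4"
    using w0 mult_right_mono[OF abs_cos_le_one[of "real n * z"], of "norm (e_rest 0)"] by simp
  have "norm (e_rest n) \<le> K ^ 4 * \<tau>\<^sup>2 / 4 + 4 * L * K ^ 4 * \<tau>\<^sup>2
      + (2 * L * K ^ 4 * \<tau> * (\<Sum>j<n. norm (e_err j)) + L * (5 * L * K ^ 6 * \<tau>\<^sup>2 + K ^ 4 * \<tau>\<^sup>2))"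
    unfolding two_step_variation_of_constants[of e_rest n z] d_def[symmetric]
    by (intro norm_triangle_mono c0 w1 s)
  moreover have "norm (P (e_err n)) \<le> norm (e_rest n) + K ^ 4 * \<tau>\<^sup>2 / 4"
    using norm_triangle_ineq[of "e_rest n" "e_corr n"] norm_e_corr_le[OF n] by (simp add: e_rest_def)
  moreover have "K ^ 4 * \<tau>\<^sup>2 / 4 + 4 * L * K ^ 4 * \<tau>\<^sup>2
      + (2 * L * K ^ 4 * \<tau> * (\<Sum>j<n. norm (e_err j)) + L * (5 * L * K ^ 6 * \<tau>\<^sup>2 + K ^ 4 * \<tau>\<^sup>2)) + K ^ 4 * \<tau>\<^sup>2 / 4
    = (K ^ 4 / 2 + 5 * L * K ^ 4 + 5 * L\<^sup>2 * K ^ 6) * \<tau>\<^sup>2 + 2 * L * K ^ 4 * \<tau> * (\<Sum>j<n. norm (e_err j))"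
    by (simp add: algebra_simps power2_eq_square)
  moreover have "(K ^ 4 / 2 + 5 * L * K ^ 4 + 5 * L\<^sup>2 * K ^ 6) * \<tau>\<^sup>2
      \<le> (2 * K ^ 4 + 5 * L * K ^ 4 + 5 * L\<^sup>2 * K ^ 6) * \<tau>\<^sup>2"
    using K_pos by (intro mult_right_mono) auto
  ultimately show ?thesis by linarith
qed

section \<open>Error bounds for e and b\<close>

theorem e_error:
  assumes n: "grid n \<le> T"
  shows "norm (e_err n) \<le> const_e K L * \<tau>\<^sup>2"
proof -
  have L: "0 \<le> L" by (rule L_nonneg[OF n])
  define a where "a = (L * K * (2 * K ^ 3 + L * K ^ 5) + L * K ^ 3 + 2 * K ^ 4 + 5 * L * K ^ 4 + 5 * L\<^sup>2 * K ^ 6) * \<tau>\<^sup>2"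
  define h where "h = (2 * L * K ^ 3 + 2 * L * K ^ 4) * \<tau>"
  have a0: "0 \<le> a" and h0: "0 \<le> h" using L K_pos tau_pos by (auto simp: a_def h_def)
  have "norm (e_err m) \<le> a + h * (\<Sum>j<m. norm (e_err j))" if m: "m \<le> n" for m
  proof -
    have "grid m \<le> T" using grid_in[OF n m] by simp
    then show ?thesis
      using Q_e_err_bound[of m] P_e_err_bound[of m] norm_triangle_ineq[of "Q (e_err m)" "P (e_err m)", unfolded Q_plus_P]
      by (simp add: a_def h_def algebra_simps)
  qed
  from discrete_gronwall[of n "\<lambda>n. norm (e_err n)" a h n, OF this h0 a0]
  have "norm (e_err n) \<le> a * exp (h * real n)" by simp
  also have "\<dots> \<le> a * exp ((2 * L * K ^ 3 + 2 * L * K ^ 4) * L)"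
  proof (intro mult_left_mono a0)
    have "(2 * L * K ^ 3 + 2 * L * K ^ 4) * (real n * \<tau>) \<le> (2 * L * K ^ 3 + 2 * L * K ^ 4) * L"
      using steps_le_L[OF n] L K_pos by (intro mult_left_mono) auto
    then show "exp (h * real n) \<le> exp ((2 * L * K ^ 3 + 2 * L * K ^ 4) * L)"
      by (simp add: h_def mult_ac)
  qed
  finally show ?thesis by (simp add: const_e_def a_def mult_ac)
qed

lemma const_e_nonneg: "0 \<le> L \<Longrightarrow> 0 \<le> const_e K L"
  using K_pos by (simp add: const_e_def)

lemma b_half_error:
  assumes n: "mid n \<le> T"
  shows "norm (b_half_err n) \<le> const_b_half K L * \<tau>\<^sup>2"
proof -
  have t: "grid n \<le> T" using n tau_pos by (simp add: mid_def)
  have L: "0 \<le> L" by (rule L_nonneg[OF t])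
  have "(\<Sum>j=1..n. norm (e_err j)) \<le> (\<Sum>j=1..n. const_e K L * \<tau>\<^sup>2)"
    using grid_in[OF t] by (intro sum_mono e_error) auto
  also have "\<dots> = real n * (const_e K L * \<tau>\<^sup>2)" by simp
  finally have "2 * K\<^sup>2 * \<tau> * (\<Sum>j=1..n. norm (e_err j)) \<le> 2 * K\<^sup>2 * \<tau> * (real n * (const_e K L * \<tau>\<^sup>2))"
    using tau_pos K_pos by (intro mult_left_mono) auto
  also have "\<dots> = (real n * \<tau>) * (2 * K\<^sup>2 * (const_e K L * \<tau>\<^sup>2))" by (simp add: mult_ac)
  also have "\<dots> \<le> L * (2 * K\<^sup>2 * (const_e K L * \<tau>\<^sup>2))"
    using steps_le_L[OF t] const_e_nonneg[OF L] by (intro mult_right_mono) auto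
  finally show ?thesis using b_half_err_bound[OF n] by (simp add: const_b_half_def algebra_simps)
qed

lemma const_b_half_nonneg: "0 \<le> L \<Longrightarrow> 0 \<le> const_b_half K L"
  using K_pos const_e_nonneg by (simp add: const_b_half_def)

theorem b_error:
  assumes n: "grid n \<le> T"
  shows "norm (b (grid n) - bn n) \<le> const_b K L * \<tau>\<^sup>2"
proof (cases n)
  case 0
  have L: "0 \<le> L" by (rule L_nonneg[OF n])
  have "0 \<le> const_b K L" using K_pos const_e_nonneg[OF L] const_b_half_nonneg[OF L] by (simp add: const_b_def)
  then show ?thesis using 0 by (simp add: initial grid_def)
next
  case (Suc m)
  have m: "mid m \<le> T" using mid_le[of m n] n Suc by simp
  have mt: "mid m - grid n = - (\<tau> / 2)" by (simp add: Suc mid_def grid_Suc)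
  have "b (grid n) - bn n = b_half_err m - (b (mid m) - b (grid n) + (mid m - grid n) *\<^sub>R B (fil \<phi> (e (grid n))))
      - (\<tau> / 2) *\<^sub>R B (fil \<phi> (e_err n))"
    unfolding mt by (simp add: Suc bn_Suc b_half_err_def e_err_def fil_diff B.diff scaleR_right_diff_distrib)
  also have "norm \<dots> \<le> const_b_half K L * \<tau>\<^sup>2 + K ^ 3 * \<tau>\<^sup>2 + K\<^sup>2 * const_e K L * \<tau>\<^sup>2"
  proof (intro norm_diff_mono b_half_error[OF m] b_filtered_half_step)
    show "mid m \<in> {t0..T}" "grid n \<in> {t0..T}" using mid_in[OF m order_refl] grid_in[OF n order_refl] .
    show "\<bar>mid m - grid n\<bar> = \<tau> / 2" using tau_pos by (simp add: mt)
    have "norm ((\<tau> / 2) *\<^sub>R B (fil \<phi> (e_err n))) \<le> 1 / 2 * (2 * K\<^sup>2 * (const_e K L * \<tau>\<^sup>2))"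
      unfolding norm_scaleR using tau_pos tau_le_1 e_error[OF n] K_pos
      by (intro mult_mono order_trans[OF norm_B_fil_le] mult_left_mono) auto
    then show "norm ((\<tau> / 2) *\<^sub>R B (fil \<phi> (e_err n))) \<le> K\<^sup>2 * const_e K L * \<tau>\<^sup>2" by (simp add: mult_ac)
  qed
  finally show ?thesis by (simp add: const_b_def algebra_simps)
qed

lemma b_minus_bh_bound:
  assumes n: "grid (Suc n) \<le> T"
  shows "norm (b (grid n) - bh n) \<le> (K\<^sup>2 + const_b_half K L) * \<tau>"
proof -
  have L: "0 \<le> L" by (rule L_nonneg[OF n])
  have m: "mid n \<le> T" using mid_le[of n "Suc n"] n by simp
  have "norm (b (grid n) - b (mid n)) \<le> K\<^sup>2 * \<bar>grid n - mid n\<bar>"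
    using grid_in[OF n, of n] mid_in[OF m, of n] by (intro b_lipschitz) auto
  also have "\<dots> \<le> K\<^sup>2 * \<tau>" using tau_pos by (intro mult_left_mono) (auto simp: mid_def)
  finally have 1: "norm (b (grid n) - b (mid n)) \<le> K\<^sup>2 * \<tau>" .
  have "const_b_half K L * \<tau>\<^sup>2 \<le> const_b_half K L * \<tau>"
    using const_b_half_nonneg[OF L] tau_pos tau_le_1
    by (intro mult_left_mono) (auto simp: power2_eq_square mult_left_le)
  then have 2: "norm (b_half_err n) \<le> const_b_half K L * \<tau>" using b_half_error[OF m] by linarith
  have "b (grid n) - bh n = (b (grid n) - b (mid n)) + b_half_err n" by (simp add: b_half_err_def)
  also have "norm \<dots> \<le> K\<^sup>2 * \<tau> + const_b_half K L * \<tau>" by (rule norm_triangle_mono[OF 1 2])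
  finally show ?thesis by (simp add: algebra_simps)
qed

section \<open>Error bound for p\<close>

definition p_err :: "nat \<Rightarrow> 'a" where "p_err n = p (grid n) - pn n"

text \<open>A common bound for the error that one step adds to \<open>Q p\<close> and to \<open>P p\<close>, in units of \<open>\<tau>\<^sup>3\<close>.\<close>

definition step_const :: real where
  "step_const = const_e K L + K\<^sup>2 * (K\<^sup>2 + const_b_half K L) + K ^ 3 + K ^ 4"

lemma K4: "K ^ 4 = K\<^sup>2 * K\<^sup>2" and tau3: "\<tau> ^ 3 = \<tau>\<^sup>2 * \<tau>"
  by (simp_all add: power_numeral_reduce)

lemma Q_p_err_bound: "grid n \<le> T \<Longrightarrow> norm (Q (p_err n)) \<le> real n * (step_const * \<tau> ^ 3)"
proof (induction n)
  case 0
  then show ?case by (simp add: p_err_def initial grid_def Q.zero)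
next
  case (Suc n)
  have n: "grid n \<le> T" using Suc.prems tau_pos by (simp add: grid_Suc)
  have L: "0 \<le> L" by (rule L_nonneg[OF n])
  have in1: "0 \<le> \<tau>" "grid n \<in> {t0..T}" "grid n + \<tau> \<in> {t0..T}"
    using grid_in[OF Suc.prems, of n] grid_in[OF Suc.prems, of "Suc n"] tau_pos by (simp_all add: grid_Suc)
  define R where "R = Q (p (grid n + \<tau>)) - (Q (p (grid n)) + \<tau> *\<^sub>R Q (e (grid n)) + (\<tau>\<^sup>2 / 2) *\<^sub>R Q (A (b (grid n))))"
  have R: "norm R \<le> K ^ 3 * \<tau> ^ 3" unfolding R_def by (rule p_step(2)[OF in1])
  have D: "0 \<le> K\<^sup>2 + const_b_half K L" using const_b_half_nonneg[OF L] by simp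
  have "Q (p_err (Suc n)) = Q (p_err n) + \<tau> *\<^sub>R Q (e_err n) + (\<tau>\<^sup>2 / 2) *\<^sub>R Q (A (b (grid n) - bh n)) + R"
    by (simp add: p_err_def R_def Q.diff A.diff Q_pn_Suc e_err_def grid_Suc algebra_simps)
  also have "norm \<dots> \<le> norm (Q (p_err n)) + \<tau> * (const_e K L * \<tau>\<^sup>2)
      + \<tau>\<^sup>2 * (K\<^sup>2 * ((K\<^sup>2 + const_b_half K L) * \<tau>)) + K ^ 3 * \<tau> ^ 3"
  proof (intro norm_triangle_mono order_refl R)
    show "norm (\<tau> *\<^sub>R Q (e_err n)) \<le> \<tau> * (const_e K L * \<tau>\<^sup>2)"
      unfolding norm_scaleR using tau_pos by (intro mult_mono order_trans[OF norm_Q_le e_error[OF n]]) auto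
    have "norm (A (b (grid n) - bh n)) \<le> K\<^sup>2 * ((K\<^sup>2 + const_b_half K L) * \<tau>)"
      using norm_A_bound[OF b_minus_bh_bound[OF Suc.prems]]
        mult_right_mono[OF K_power_mono[of 1 2], of "(K\<^sup>2 + const_b_half K L) * \<tau>"] D tau_pos by simp
    then show "norm ((\<tau>\<^sup>2 / 2) *\<^sub>R Q (A (b (grid n) - bh n))) \<le> \<tau>\<^sup>2 * (K\<^sup>2 * ((K\<^sup>2 + const_b_half K L) * \<tau>))"
      unfolding norm_scaleR by (intro mult_mono order_trans[OF norm_Q_le]) auto
  qed
  also have "\<dots> \<le> norm (Q (p_err n)) + step_const * \<tau> ^ 3"
  proof -
    have "step_const * \<tau> ^ 3 = \<tau> * (const_e K L * \<tau>\<^sup>2)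
      + \<tau>\<^sup>2 * (K\<^sup>2 * ((K\<^sup>2 + const_b_half K L) * \<tau>)) + K ^ 3 * \<tau> ^ 3 + K ^ 4 * \<tau> ^ 3"
      unfolding step_const_def K4 tau3 power2_eq_square by (simp only: distrib_left distrib_right mult_ac add_ac)
    moreover have "0 \<le> K ^ 4 * \<tau> ^ 3" using tau_pos K_pos by simp
    ultimately show ?thesis by linarith
  qed
  finally show ?case using Suc.IH[OF n] by (simp add: algebra_simps)
qed

text \<open>A frozen force \<open>f\<close> holds the exact oscillator at rest at \<open>f / \<omega>\<^sup>2\<close> and the numerical one at
  \<open>kappa f / \<omega>\<^sup>2\<close>; \<open>p_corr\<close> is the difference. At a resonance, \<open>sin z = 0\<close>, the quotient is 0 by
  convention, which is still within \<open>K z\<^sup>2\<close> of 1 since then \<open>z \<ge> \<pi>\<close>.\<close>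

definition kappa :: real where "kappa = Psi / (sin z / z)"
definition p_corr :: "nat \<Rightarrow> 'a" where "p_corr n = ((1 - kappa) / \<omega>\<^sup>2) *\<^sub>R P (A (b (grid n)))"

lemma abs_one_minus_kappa_le: "\<bar>1 - kappa\<bar> \<le> K * z\<^sup>2"
proof (cases "sin z = 0")
  case True
  then have "pi \<le> z" using sin_gt_zero[of z] z_pos by fastforce
  then have "1 \<le> z" using pi_gt3 by linarith
  then have "1 * 1 \<le> K * z\<^sup>2" using K_ge_1 by (intro mult_mono) auto
  then show ?thesis using True by (simp add: kappa_def)
next
  case False
  then have "1 - kappa = (sin z / z - Psi) / (sin z / z)" using z_pos
    unfolding kappa_def diff_divide_distrib by simp
  then have "\<bar>1 - kappa\<bar> = \<bar>sin z / z - Psi\<bar> / (\<bar>sin z\<bar> / z)" using z_pos by (simp add: abs_divide abs_mult)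
  also have "\<dots> \<le> (K * z * \<bar>sin z\<bar>) / (\<bar>sin z\<bar> / z)"
    using filter_values(6) z_pos by (intro divide_right_mono) auto
  also have "\<dots> = K * z\<^sup>2" using False by (simp add: power2_eq_square)
  finally show ?thesis .
qed

lemma norm_kappa_scaleR_le:
  assumes "norm y \<le> c"
  shows "norm (((1 - kappa) / \<omega>\<^sup>2) *\<^sub>R P (A y)) \<le> K\<^sup>2 * \<tau>\<^sup>2 * c"
proof -
  have "\<bar>(1 - kappa) / \<omega>\<^sup>2\<bar> \<le> K * z\<^sup>2 / \<omega>\<^sup>2"
    unfolding abs_divide using abs_one_minus_kappa_le by (simp add: divide_right_mono)
  also have "\<dots> = K * \<tau>\<^sup>2" using omega_pos by (simp add: z_def power_mult_distrib)
  finally have "norm (((1 - kappa) / \<omega>\<^sup>2) *\<^sub>R P (A y)) \<le> (K * \<tau>\<^sup>2) * (K * c)"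
    unfolding norm_scaleR using K_pos
    by (intro mult_mono order_trans[OF norm_P_le norm_A_bound[OF assms]]) auto
  then show ?thesis by (simp add: power2_eq_square mult_ac)
qed

lemma norm_p_corr_le: "grid n \<le> T \<Longrightarrow> norm (p_corr n) \<le> K ^ 3 * \<tau>\<^sup>2"
  unfolding p_corr_def using norm_kappa_scaleR_le[OF norm_b_le[OF grid_in[of n n]]]
  by (simp add: power_numeral_reduce mult_ac)

text \<open>The left-hand side is the weight with which a kick enters \<open>p\<close>. The identity says that
  \<open>kappa f / \<omega>\<^sup>2\<close> is a fixed point of the step \<open>p \<mapsto> cos z p + \<tau> sin z \<psi> / (2 \<omega>) f\<close>.\<close>

lemma kappa_kick: "\<tau> * sin z * \<psi> / (2 * \<omega>) = kappa * ((1 - cos z) / \<omega>\<^sup>2)"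
proof (cases "sin z = 0")
  case False
  have "(cos z + 1) * (1 - cos z) = (sin z)\<^sup>2"
    by (simp add: sin_squared_eq algebra_simps power2_eq_square)
  moreover have "Psi * (1 - cos z) = \<psi> / 2 * ((cos z + 1) * (1 - cos z))" by (simp add: Psi_def)
  ultimately have h: "Psi * (1 - cos z) = \<psi> / 2 * (sin z)\<^sup>2" by simp
  have "kappa * (1 - cos z) = z * (Psi * (1 - cos z)) / sin z" by (simp add: kappa_def)
  also have "\<dots> = z * \<psi> / 2 * ((sin z)\<^sup>2 / sin z)" unfolding h by simp
  also have "\<dots> = z * \<psi> / 2 * sin z" using False by (simp add: power2_eq_square)
  finally have k: "kappa * (1 - cos z) = z * \<psi> / 2 * sin z" .
  have "kappa * ((1 - cos z) / \<omega>\<^sup>2) = (kappa * (1 - cos z)) / \<omega>\<^sup>2" by simp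
  also have "\<dots> = z / \<omega>\<^sup>2 * (\<psi> / 2 * sin z)" unfolding k by simp
  also have "z / \<omega>\<^sup>2 = \<tau> / \<omega>" using omega_pos by (simp add: z_def power2_eq_square)
  finally show ?thesis by (simp add: mult_ac)
qed (simp add: kappa_def)

text \<open>After subtraction of \<open>p_corr\<close> the frozen force drops out and only its increments remain. The factor
  \<open>cos z\<close> is at most 1 in modulus, so the errors of the single steps just add up.\<close>

lemma P_p_err_bound: "grid n \<le> T \<Longrightarrow> norm (P (p_err n) - p_corr n) \<le> K ^ 3 * \<tau>\<^sup>2 + real n * (step_const * \<tau> ^ 3)"
proof (induction n)
  case 0
  then show ?case using norm_p_corr_le[of 0] by (simp add: p_err_def initial grid_def P.zero)
next
  case (Suc n)
  have n: "grid n \<le> T" using Suc.prems tau_pos by (simp add: grid_Suc)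
  have L: "0 \<le> L" by (rule L_nonneg[OF n])
  have in1: "0 \<le> \<tau>" "grid n \<in> {t0..T}" "grid n + \<tau> \<in> {t0..T}"
    using grid_in[OF Suc.prems, of n] grid_in[OF Suc.prems, of "Suc n"] tau_pos by (simp_all add: grid_Suc)
  have wt: "\<omega> * \<tau> = z" by (simp add: z_def)
  define U where "U = P (A (b (grid n)))"
  define R where "R = P (p (grid n + \<tau>)) - (cos z *\<^sub>R P (p (grid n)) + (sin z / \<omega>) *\<^sub>R P (e (grid n))
      + ((1 - cos z) / \<omega>\<^sup>2) *\<^sub>R U)"
  have R: "norm R \<le> K ^ 3 * \<tau> ^ 3" unfolding R_def U_def using p_step(1)[OF in1] by (simp only: wt)
  have D: "0 \<le> K\<^sup>2 + const_b_half K L" using const_b_half_nonneg[OF L] by simp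
  define \<mu> where "\<mu> = \<tau> * sin z * \<psi> / (2 * \<omega>)"
  have \<mu>: "\<mu> = kappa * ((1 - cos z) / \<omega>\<^sup>2)" unfolding \<mu>_def by (rule kappa_kick)
  have p1: "P (p_err (Suc n)) = cos z *\<^sub>R P (p_err n) + (sin z / \<omega>) *\<^sub>R P (e_err n)
      + \<mu> *\<^sub>R P (A (b (grid n) - bh n)) + ((1 - cos z) / \<omega>\<^sup>2 - \<mu>) *\<^sub>R U + R"
    unfolding p_err_def P.diff P_pn_Suc \<mu>_def[symmetric] R_def U_def
    by (simp add: P.diff A.diff e_err_def grid_Suc algebra_simps)
  have p2: "((1 - cos z) / \<omega>\<^sup>2 - \<mu>) *\<^sub>R U = (1 - cos z) *\<^sub>R p_corr n"
  proof -
    have "(1 - cos z) / \<omega>\<^sup>2 - \<mu> = (1 - cos z) * ((1 - kappa) / \<omega>\<^sup>2)"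
      unfolding \<mu> using omega_pos by (simp add: field_simps)
    then show ?thesis by (simp add: p_corr_def U_def)
  qed
  have p3: "p_corr (Suc n) = p_corr n + ((1 - kappa) / \<omega>\<^sup>2) *\<^sub>R P (A (b (grid (Suc n)) - b (grid n)))"
    unfolding p_corr_def A.diff P.diff scaleR_right_diff_distrib by simp
  have "P (p_err (Suc n)) - p_corr (Suc n) = cos z *\<^sub>R (P (p_err n) - p_corr n) + (sin z / \<omega>) *\<^sub>R P (e_err n)
      + \<mu> *\<^sub>R P (A (b (grid n) - bh n)) + R - ((1 - kappa) / \<omega>\<^sup>2) *\<^sub>R P (A (b (grid (Suc n)) - b (grid n)))"
    unfolding p1 p2 p3 by (simp add: algebra_simps)
  also have "norm \<dots> \<le> norm (P (p_err n) - p_corr n) + \<tau> * (const_e K L * \<tau>\<^sup>2)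
      + \<tau>\<^sup>2 * K * (K * ((K\<^sup>2 + const_b_half K L) * \<tau>)) + K ^ 3 * \<tau> ^ 3 + K\<^sup>2 * \<tau>\<^sup>2 * (K\<^sup>2 * \<tau>)"
  proof (intro norm_diff_mono norm_triangle_mono R norm_kappa_scaleR_le)
    show "norm (cos z *\<^sub>R (P (p_err n) - p_corr n)) \<le> norm (P (p_err n) - p_corr n)"
      by (simp add: mult_left_le_one_le)
    have s: "\<bar>sin z / \<omega>\<bar> \<le> \<tau>"
      using abs_sin_x_le_abs_x[of z] omega_pos z_pos
      by (simp add: abs_divide divide_le_eq z_def mult.commute)
    then show "norm ((sin z / \<omega>) *\<^sub>R P (e_err n)) \<le> \<tau> * (const_e K L * \<tau>\<^sup>2)"
      unfolding norm_scaleR using tau_pos by (intro mult_mono order_trans[OF norm_P_le e_error[OF n]]) auto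
    have "\<mu> = \<tau> / 2 * (sin z / \<omega>) * \<psi>" by (simp add: \<mu>_def)
    then have "\<bar>\<mu>\<bar> = \<tau> / 2 * \<bar>sin z / \<omega>\<bar> * \<bar>\<psi>\<bar>" using tau_pos by (simp add: abs_mult)
    also have "\<dots> \<le> \<tau> * \<tau> * K" using s filter_values(2) tau_pos K_pos by (intro mult_mono) auto
    finally have "\<bar>\<mu>\<bar> \<le> \<tau>\<^sup>2 * K" by (simp add: power2_eq_square)
    then show "norm (\<mu> *\<^sub>R P (A (b (grid n) - bh n))) \<le> \<tau>\<^sup>2 * K * (K * ((K\<^sup>2 + const_b_half K L) * \<tau>))"
      unfolding norm_scaleR using K_pos
      by (intro mult_mono order_trans[OF norm_P_le norm_A_bound[OF b_minus_bh_bound[OF Suc.prems]]]) auto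
    show "norm (b (grid (Suc n)) - b (grid n)) \<le> K\<^sup>2 * \<tau>"
      using b_lipschitz[OF in1(3,2)] tau_pos by (simp add: grid_Suc)
  qed
  also have "\<dots> = norm (P (p_err n) - p_corr n) + step_const * \<tau> ^ 3"
    unfolding step_const_def K4 tau3 power2_eq_square by (simp only: distrib_left distrib_right mult_ac add_ac)
  finally show ?case using Suc.IH[OF n] by (simp add: algebra_simps)
qed

theorem p_error:
  assumes n: "grid n \<le> T"
  shows "norm (p (grid n) - pn n) \<le> const_p K L * \<tau>\<^sup>2"
proof -
  have L: "0 \<le> L" by (rule L_nonneg[OF n])
  have "0 \<le> step_const"
    using const_e_nonneg[OF L] const_b_half_nonneg[OF L] K_pos by (simp add: step_const_def)
  then have "(real n * \<tau>) * (step_const * \<tau>\<^sup>2) \<le> L * (step_const * \<tau>\<^sup>2)"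
    using steps_le_L[OF n] by (intro mult_right_mono) auto
  then have s: "real n * (step_const * \<tau> ^ 3) \<le> L * (step_const * \<tau>\<^sup>2)"
    by (simp add: power_numeral_reduce mult_ac)
  have "p (grid n) - pn n = Q (p_err n) + ((P (p_err n) - p_corr n) + p_corr n)"
    by (simp add: Q_plus_P) (simp add: p_err_def)
  also have "norm \<dots> \<le> L * (step_const * \<tau>\<^sup>2) + ((K ^ 3 * \<tau>\<^sup>2 + L * (step_const * \<tau>\<^sup>2)) + K ^ 3 * \<tau>\<^sup>2)"
    using Q_p_err_bound[OF n] P_p_err_bound[OF n] norm_p_corr_le[OF n] s by (intro norm_triangle_mono) auto
  also have "\<dots> = const_p K L * \<tau>\<^sup>2"
    unfolding const_p_def step_const_def by (simp add: distrib_left distrib_right mult_ac)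
  finally show ?thesis .
qed

end

section \<open>Coordinate vectors in one inner product space\<close>

lemma finite_support_add:
  fixes f g :: "nat \<Rightarrow> real"
  assumes "finite {i. f i \<noteq> 0}" "finite {i. g i \<noteq> 0}"
  shows "finite {i. f i + g i \<noteq> 0}"
  using finite_UnI[OF assms] by (rule rev_finite_subset) auto

lemma finite_support_diff:
  fixes f g :: "nat \<Rightarrow> real"
  assumes "finite {i. f i \<noteq> 0}" "finite {i. g i \<noteq> 0}"
  shows "finite {i. f i - g i \<noteq> 0}"
  using finite_UnI[OF assms] by (rule rev_finite_subset) auto

text \<open>The dimensions \<open>N\<close> and \<open>M\<close> are variables, while a space with a norm and derivatives has to be a type.
  Finitely supported sequences form one inner product space that contains all \<open>\<real>\<^sup>n\<close>.\<close>

typedef fseq = "{f :: nat \<Rightarrow> real. finite {i. f i \<noteq> 0}}"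
  morphisms coord Abs_fseq
  by (rule exI[of _ "\<lambda>_. 0"]) simp

setup_lifting type_definition_fseq

lemma finite_support: "finite {i. coord x i \<noteq> 0}" using coord[of x] by simp

lemma fseq_eqI: "(\<And>i. coord x i = coord y i) \<Longrightarrow> x = y"
  by (metis coord_inject ext)

instantiation fseq :: real_vector
begin

lift_definition zero_fseq :: fseq is "\<lambda>_. 0" by simp
lift_definition plus_fseq :: "fseq \<Rightarrow> fseq \<Rightarrow> fseq" is "\<lambda>f g i. f i + g i"
  using finite_support_add .
lift_definition minus_fseq :: "fseq \<Rightarrow> fseq \<Rightarrow> fseq" is "\<lambda>f g i. f i - g i"
  using finite_support_diff .
lift_definition uminus_fseq :: "fseq \<Rightarrow> fseq" is "\<lambda>f i. - f i" by simp
lift_definition scaleR_fseq :: "real \<Rightarrow> fseq \<Rightarrow> fseq" is "\<lambda>c f i. c * f i"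
  by (erule rev_finite_subset) auto

instance
  by standard (transfer; simp add: fun_eq_iff algebra_simps)+

end

lemma coord_simps [simp]:
  "coord 0 i = 0" "coord (x + y) i = coord x i + coord y i" "coord (x - y) i = coord x i - coord y i"
  "coord (- x) i = - coord x i" "coord (c *\<^sub>R x) i = c * coord x i"
  by (transfer; simp)+

instantiation fseq :: real_inner
begin

definition inner_fseq :: "fseq \<Rightarrow> fseq \<Rightarrow> real" where
  "inner_fseq x y = (\<Sum>i | coord x i \<noteq> 0. coord x i * coord y i)"
definition norm_fseq :: "fseq \<Rightarrow> real" where "norm_fseq x = sqrt (inner x x)"
definition sgn_fseq :: "fseq \<Rightarrow> fseq" where "sgn_fseq x = x /\<^sub>R norm x"
definition dist_fseq :: "fseq \<Rightarrow> fseq \<Rightarrow> real" where "dist_fseq x y = norm (x - y)"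
definition uniformity_fseq :: "(fseq \<times> fseq) filter" where
  "uniformity_fseq = (INF e\<in>{0 <..}. principal {(x, y). dist x y < e})"
definition open_fseq :: "fseq set \<Rightarrow> bool" where
  "open_fseq U \<longleftrightarrow> (\<forall>x\<in>U. eventually (\<lambda>(x', y). x' = x \<longrightarrow> y \<in> U) uniformity)"

lemma inner_fseq_sum:
  assumes "finite S" "{i. coord x i \<noteq> 0} \<subseteq> S"
  shows "inner x y = (\<Sum>i\<in>S. coord x i * coord y i)"
  unfolding inner_fseq_def using assms by (intro sum.mono_neutral_left) auto

instance
proof
  fix x y z :: fseq and r :: real
  define S where "S = {i. coord x i \<noteq> 0} \<union> {i. coord y i \<noteq> 0} \<union> {i. coord z i \<noteq> 0}"
  have S: "finite S" unfolding S_def by (intro finite_UnI finite_support)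
  have in1: "inner u v = (\<Sum>i\<in>S. coord u i * coord v i)" if "{i. coord u i \<noteq> 0} \<subseteq> S" for u v :: fseq
    using S that by (rule inner_fseq_sum)
  have xS: "{i. coord x i \<noteq> 0} \<subseteq> S" "{i. coord y i \<noteq> 0} \<subseteq> S" "{i. coord (x + y) i \<noteq> 0} \<subseteq> S"
    "{i. coord (r *\<^sub>R x) i \<noteq> 0} \<subseteq> S"
    by (auto simp: S_def)
  show "inner x y = inner y x" by (simp add: in1 xS mult.commute)
  show "inner (x + y) z = inner x z + inner y z"
    unfolding in1[OF xS(1)] in1[OF xS(2)] in1[OF xS(3)] by (simp add: distrib_right sum.distrib)
  show "inner (r *\<^sub>R x) y = r * inner x y"
    unfolding in1[OF xS(1)] in1[OF xS(4)] by (simp add: sum_distrib_left mult.assoc)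
  show "0 \<le> inner x x" unfolding inner_fseq_def by (intro sum_nonneg) simp
  show "inner x x = 0 \<longleftrightarrow> x = 0"
  proof
    assume "inner x x = 0"
    then have "\<forall>i\<in>{i. coord x i \<noteq> 0}. coord x i * coord x i = 0"
      unfolding inner_fseq_def using finite_support[of x] by (subst (asm) sum_nonneg_eq_0_iff) auto
    then show "x = 0" by (intro fseq_eqI) auto
  qed (simp add: inner_fseq_def)
qed (fact norm_fseq_def sgn_fseq_def dist_fseq_def uniformity_fseq_def open_fseq_def)+

end

text \<open>The projection \<open>P\<close>: the frequency \<open>\<omega>\<close> belongs to the coordinates from \<open>N\<^sub>0\<close> on.\<close>

lift_definition tail :: "nat \<Rightarrow> fseq \<Rightarrow> fseq" is "\<lambda>k f i. if i < k then 0 else f i"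
  by (erule rev_finite_subset) auto

lemma coord_tail [simp]: "coord (tail k x) i = (if i < k then 0 else coord x i)"
  by transfer simp

lemma bounded_linear_tail: "bounded_linear (tail k)"
  and norm_tail_le: "norm (tail k x) \<le> norm x"
  and norm_minus_tail_le: "norm (x - tail k x) \<le> norm x"
  and tail_sym: "inner (tail k x) y = inner x (tail k y)"
proof -
  have inn: "inner u v = (\<Sum>i\<in>{i. coord x i \<noteq> 0}. coord u i * coord v i)"
    if "{i. coord u i \<noteq> 0} \<subseteq> {i. coord x i \<noteq> 0}" for x u v
    using finite_support that by (rule inner_fseq_sum)
  have sub: "{i. coord x i \<noteq> 0} \<subseteq> {i. coord x i \<noteq> 0}"
    "{i. coord (tail k x) i \<noteq> 0} \<subseteq> {i. coord x i \<noteq> 0}"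
    "{i. coord (x - tail k x) i \<noteq> 0} \<subseteq> {i. coord x i \<noteq> 0}" for x
    by auto
  have n1: "norm (tail k x) \<le> norm x" for x
    unfolding norm_fseq_def inn[OF sub(1)[of x]] inn[OF sub(2)[of x]] by (auto intro!: sum_mono)
  then show "norm (tail k x) \<le> norm x" .
  show "norm (x - tail k x) \<le> norm x"
    unfolding norm_fseq_def inn[OF sub(1)[of x]] inn[OF sub(3)[of x]] by (auto intro!: sum_mono)
  show "inner (tail k x) y = inner x (tail k y)"
    unfolding inn[OF sub(1)[of x]] inn[OF sub(2)[of x]] by (auto intro!: sum.cong)
  show "bounded_linear (tail k)"
    by (rule bounded_linear_intro[where K = 1]) (auto intro!: fseq_eqI simp: n1)
qed

lemma tail_tail [simp]: "tail k (tail k x) = tail k x"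
  by (rule fseq_eqI) simp

lift_definition emb :: "real Matrix.vec \<Rightarrow> fseq" is "\<lambda>v i. if i < dim_vec v then v $ i else 0"
proof -
  fix v :: "real Matrix.vec"
  show "finite {i. (if i < dim_vec v then v $ i else 0) \<noteq> 0}"
    by (rule finite_subset[of _ "{..<dim_vec v}"]) auto
qed

definition restr :: "nat \<Rightarrow> fseq \<Rightarrow> real Matrix.vec" where
  "restr n x = Matrix.vec n (coord x)"

lemma coord_emb: "coord (emb v) i = (if i < dim_vec v then v $ i else 0)"
  by transfer simp

lemma coord_emb_carrier: "v \<in> carrier_vec n \<Longrightarrow> coord (emb v) i = (if i < n then v $ i else 0)"
  by (auto simp: coord_emb)

lemma restr_carrier [simp]: "restr n x \<in> carrier_vec n" by (simp add: restr_def)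

lemma restr_emb: "v \<in> carrier_vec n \<Longrightarrow> restr n (emb v) = v"
  by (intro eq_vecI) (auto simp: restr_def coord_emb)

lemma emb_add: "v \<in> carrier_vec n \<Longrightarrow> w \<in> carrier_vec n \<Longrightarrow> emb (v + w) = emb v + emb w"
  by (rule fseq_eqI) (auto simp: coord_emb)

lemma emb_diff: "v \<in> carrier_vec n \<Longrightarrow> w \<in> carrier_vec n \<Longrightarrow> emb (v - w) = emb v - emb w"
  by (rule fseq_eqI) (auto simp: coord_emb)

lemma emb_uminus: "emb (- v) = - emb v"
  by (rule fseq_eqI) (auto simp: coord_emb)

lemma emb_smult: "emb (c \<cdot>\<^sub>v v) = c *\<^sub>R emb v"
  by (rule fseq_eqI) (auto simp: coord_emb)

lemma restr_add: "restr n (x + y) = restr n x + restr n y"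
  by (rule eq_vecI) (auto simp: restr_def)

lemma restr_scaleR: "restr n (c *\<^sub>R x) = c \<cdot>\<^sub>v restr n x"
  by (rule eq_vecI) (auto simp: restr_def)

lemma inner_emb:
  assumes "v \<in> carrier_vec n"
  shows "inner (emb v) x = v \<bullet> restr n x"
proof -
  have "inner (emb v) x = (\<Sum>i\<in>{0..<n}. coord (emb v) i * coord x i)"
    using assms by (intro inner_fseq_sum) (auto simp: coord_emb split: if_splits)
  also have "\<dots> = v \<bullet> restr n x"
    using assms by (simp add: scalar_prod_def restr_def coord_emb)
  finally show ?thesis .
qed

lemma norm_emb: "norm (emb v) = vec_norm v"
proof -
  have "inner (emb v) (emb v) = v \<bullet> v"
    using inner_emb[of v "dim_vec v" "emb v"] restr_emb[of v "dim_vec v"] by simp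
  then show ?thesis by (simp add: norm_fseq_def vec_norm_def)
qed

lemma vec_norm_restr_le: "vec_norm (restr n x) \<le> norm x"
proof -
  have "inner (emb (restr n x)) (emb (restr n x)) = (\<Sum>i<n. coord (emb (restr n x)) i * coord (emb (restr n x)) i)"
    by (intro inner_fseq_sum) (auto simp: coord_emb restr_def split: if_splits)
  also have "\<dots> = (\<Sum>i<n. coord x i * coord x i)" by (simp add: coord_emb restr_def)
  also have "\<dots> \<le> (\<Sum>i\<in>{..<n} \<union> {i. coord x i \<noteq> 0}. coord x i * coord x i)"
    using finite_support[of x] by (intro sum_mono2) auto
  also have "\<dots> = inner x x"
    using finite_support[of x] by (intro inner_fseq_sum[symmetric]) auto
  finally show ?thesis unfolding norm_emb[symmetric] norm_fseq_def by simp
qed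

lemma vec_norm_nonneg [simp]: "0 \<le> vec_norm v"
  by (simp flip: norm_emb)

text \<open>The supremum in the matrix norm is over a bounded set, by the Cauchy-Schwarz inequality for each row;
  otherwise it would carry no information. The rest is scaling to unit length.\<close>

lemma vec_norm_mult_mat_vec_le:
  assumes A: "A \<in> carrier_mat m n" and v: "v \<in> carrier_vec n"
  shows "vec_norm (A *\<^sub>v v) \<le> mat_norm A * vec_norm v"
proof -
  define W where "W = {vec_norm (A *\<^sub>v v) | v. v \<in> carrier_vec (dim_col A) \<and> vec_norm v \<le> 1}"
  have dim: "dim_col A = n" "dim_row A = m" using A by auto
  have bdd: "bdd_above W"
  proof (rule bdd_aboveI)
    fix r assume "r \<in> W"
    then obtain v where v: "v \<in> carrier_vec n" "vec_norm v \<le> 1" "r = vec_norm (A *\<^sub>v v)"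
      unfolding W_def dim by auto
    have entry: "\<bar>(A *\<^sub>v v) $ i\<bar> \<le> vec_norm (row A i)" if "i < m" for i
    proof -
      have "(A *\<^sub>v v) $ i = inner (emb (row A i)) (emb v)"
        using that v A by (subst inner_emb[of _ n]) (auto simp: restr_emb)
      also have "\<bar>\<dots>\<bar> \<le> norm (emb (row A i)) * norm (emb v)" by (rule Cauchy_Schwarz_ineq2)
      also have "\<dots> \<le> norm (emb (row A i)) * 1" using v by (intro mult_left_mono) (auto simp: norm_emb)
      finally show ?thesis by (simp add: norm_emb)
    qed
    have "(A *\<^sub>v v) \<bullet> (A *\<^sub>v v) = (\<Sum>i\<in>{0..<m}. (\<bar>(A *\<^sub>v v) $ i\<bar>)\<^sup>2)"
      using A by (simp add: scalar_prod_def power2_eq_square)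
    also have "\<dots> \<le> (\<Sum>i\<in>{0..<m}. (vec_norm (row A i))\<^sup>2)"
      using entry by (intro sum_mono power_mono) auto
    finally show "r \<le> sqrt (\<Sum>i\<in>{0..<m}. (vec_norm (row A i))\<^sup>2)"
      unfolding v(3) vec_norm_def[of "A *\<^sub>v v"] by simp
  qed
  show ?thesis
  proof (cases "vec_norm v = 0")
    case True
    then have "emb v = 0" by (simp flip: norm_emb)
    then have "v = 0\<^sub>v n" using restr_emb[OF v] by (auto simp: restr_def zero_vec_def)
    then have "A *\<^sub>v v = 0\<^sub>v m" using A by (intro eq_vecI) auto
    then show ?thesis using True by (simp add: vec_norm_def)
  next
    case False
    define c where "c = vec_norm v"
    have c: "0 < c" using False vec_norm_nonneg[of v] unfolding c_def by linarith
    define u where "u = (1 / c) \<cdot>\<^sub>v v"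
    have u: "u \<in> carrier_vec n" "v = c \<cdot>\<^sub>v u" using v c by (auto simp: u_def smult_smult_assoc)
    have "vec_norm u = 1" unfolding norm_emb[symmetric] u_def emb_smult using c by (simp add: norm_emb c_def)
    then have "vec_norm (A *\<^sub>v u) \<in> W" using u unfolding W_def dim by auto
    then have "vec_norm (A *\<^sub>v u) \<le> mat_norm A"
      unfolding mat_norm_def W_def[symmetric] using bdd by (rule cSup_upper)
    moreover have "A *\<^sub>v v = c \<cdot>\<^sub>v (A *\<^sub>v u)" using u A by (simp add: mult_mat_vec)
    then have "vec_norm (A *\<^sub>v v) = c * vec_norm (A *\<^sub>v u)"
      unfolding norm_emb[symmetric] using c by (simp add: emb_smult)
    ultimately show ?thesis using c by (simp add: c_def[symmetric] mult.commute mult_left_mono)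
  qed
qed

text \<open>A matrix as an operator on the whole sequence space: it ignores the coordinates beyond its width.\<close>

definition mop :: "real Matrix.mat \<Rightarrow> fseq \<Rightarrow> fseq" where
  "mop A x = emb (A *\<^sub>v restr (dim_col A) x)"

lemma mop_emb: "A \<in> carrier_mat m n \<Longrightarrow> v \<in> carrier_vec n \<Longrightarrow> mop A (emb v) = emb (A *\<^sub>v v)"
  by (auto simp: mop_def restr_emb)

lemma norm_mop_le:
  assumes "mat_norm A \<le> c" and "0 \<le> c"
  shows "norm (mop A x) \<le> c * norm x"
proof -
  have "norm (mop A x) \<le> mat_norm A * vec_norm (restr (dim_col A) x)"
    unfolding mop_def norm_emb by (rule vec_norm_mult_mat_vec_le[of _ "dim_row A" "dim_col A"]) auto
  also have "\<dots> \<le> c * norm x"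
    using assms vec_norm_restr_le vec_norm_nonneg by (intro mult_mono) auto
  finally show ?thesis .
qed

lemma bounded_linear_mop: "bounded_linear (mop A)"
proof -
  have "norm (mop A x) \<le> norm x * \<bar>mat_norm A\<bar>" for x
    using norm_mop_le[of A "\<bar>mat_norm A\<bar>" x] by (simp add: mult.commute)
  moreover have "mop A (x + y) = mop A x + mop A y" "mop A (c *\<^sub>R x) = c *\<^sub>R mop A x" for x y c
  proof -
    have A: "A \<in> carrier_mat (dim_row A) (dim_col A)" by auto
    show "mop A (x + y) = mop A x + mop A y"
      unfolding mop_def restr_add using A
      by (subst mult_add_distrib_mat_vec[OF A]) (auto intro!: emb_add[of _ "dim_row A"] mult_mat_vec_carrier[OF A])
    show "mop A (c *\<^sub>R x) = c *\<^sub>R mop A x"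
      unfolding mop_def restr_scaleR by (subst mult_mat_vec[OF A]) (auto simp: emb_smult)
  qed
  ultimately show ?thesis by (intro bounded_linear_intro)
qed

lemma inner_emb_mult_mat_sym:
  assumes S: "S \<in> carrier_mat n n" "transpose_mat S = S"
  shows "inner (emb (S *\<^sub>v restr n x)) y = inner x (emb (S *\<^sub>v restr n y))"
proof -
  have "inner (emb (S *\<^sub>v restr n x)) y = (S *\<^sub>v restr n x) \<bullet> restr n y"
    using S by (intro inner_emb) auto
  also have "\<dots> = restr n x \<bullet> (S *\<^sub>v restr n y)"
    using transpose_vec_mult_scalar[OF S(1), of "restr n y" "restr n x"] by (simp add: S(2))
  also have "\<dots> = (S *\<^sub>v restr n y) \<bullet> restr n x"
    using S by (intro comm_scalar_prod[of _ n]) auto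
  also have "\<dots> = inner (emb (S *\<^sub>v restr n y)) x"
    using S by (intro inner_emb[symmetric]) auto
  finally show ?thesis by (simp add: inner_commute)
qed

lemma coord_sum: "coord (sum f A) i = (\<Sum>a\<in>A. coord (f a) i)"
  by (induction A rule: infinite_finite_induct) auto

lemma emb_has_vector_derivative:
  assumes d: "has_vec_deriv x v n t S" and t: "t \<in> S"
  shows "((\<lambda>s. emb (x s)) has_vector_derivative emb v) (at t within S)"
proof -
  have expand: "emb w = (\<Sum>i<n. (w $ i) *\<^sub>R emb (unit_vec n i))" if w: "w \<in> carrier_vec n" for w
  proof (rule fseq_eqI)
    fix k
    have "coord (\<Sum>i<n. (w $ i) *\<^sub>R emb (unit_vec n i)) k
        = (\<Sum>i<n. if i = k then w $ i else 0)"
      unfolding coord_sum by (rule sum.cong) (auto simp: coord_emb unit_vec_def)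
    also have "\<dots> = coord (emb w) k" using w by (auto simp: coord_emb)
    finally show "coord (emb w) k = coord (\<Sum>i<n. (w $ i) *\<^sub>R emb (unit_vec n i)) k" ..
  qed
  have v: "v \<in> carrier_vec n" and x: "\<And>s. s \<in> S \<Longrightarrow> x s \<in> carrier_vec n"
    and x': "\<And>i. i < n \<Longrightarrow> ((\<lambda>s. x s $ i) has_real_derivative v $ i) (at t within S)"
    using d by (auto simp: has_vec_deriv_def)
  have "((\<lambda>s. \<Sum>i<n. (x s $ i) *\<^sub>R emb (unit_vec n i)) has_vector_derivative
      (\<Sum>i<n. (x t $ i) *\<^sub>R 0 + (v $ i) *\<^sub>R emb (unit_vec n i))) (at t within S)"
    by (intro has_vector_derivative_sum has_vector_derivative_scaleR has_vector_derivative_const x') auto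
  then have "((\<lambda>s. \<Sum>i<n. (x s $ i) *\<^sub>R emb (unit_vec n i)) has_vector_derivative emb v) (at t within S)"
    by (simp add: expand[OF v, symmetric])
  then show ?thesis
    by (rule has_vector_derivative_transform[OF t, rotated]) (rule expand[OF x])
qed

lemma emb_mat_diag:
  assumes v: "v \<in> carrier_vec n"
  shows "coord (emb (mat_diag n f *\<^sub>v v)) i = (if i < n then f i * v $ i else 0)"
proof (cases "i < n")
  case True
  have "(mat_diag n f *\<^sub>v v) $ i = (\<Sum>j\<in>{0..<n}. (if i = j then f j else 0) * v $ j)"
    using True v by (simp add: mat_diag_def scalar_prod_def)
  also have "\<dots> = (\<Sum>j\<in>{0..<n}. if i = j then f j * v $ j else 0)" by (rule sum.cong) auto
  also have "\<dots> = f i * v $ i" using True by simp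
  finally show ?thesis using True by (simp add: coord_emb mat_diag_def)
qed (simp add: coord_emb mat_diag_def)

lemma block_Omega_mat_diag: "block_Omega N0 N1 \<omega> = mat_diag (N0 + N1) (\<lambda>i. if i < N0 then 0 else \<omega>)"
  by (rule eq_matI) (auto simp: block_Omega_def mat_diag_def)

lemma emb_Omega:
  assumes "v \<in> carrier_vec (N0 + N1)"
  shows "emb (block_Omega N0 N1 \<omega> *\<^sub>v v) = \<omega> *\<^sub>R tail N0 (emb v)"
  unfolding block_Omega_mat_diag using assms
  by (intro fseq_eqI) (simp add: emb_mat_diag[OF assms] coord_emb_carrier[OF assms])

lemma diag_fun_block_Omega:
  "diag_fun f (c \<cdot>\<^sub>m block_Omega N0 N1 \<omega>) = mat_diag (N0 + N1) (\<lambda>i. if i < N0 then f 0 else f (c * \<omega>))"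
  by (rule eq_matI) (auto simp: block_Omega_mat_diag diag_fun_def mat_diag_def)

lemma emb_diag_fun:
  assumes "v \<in> carrier_vec (N0 + N1)" "f 0 = 1"
  shows "emb (diag_fun f (c \<cdot>\<^sub>m block_Omega N0 N1 \<omega>) *\<^sub>v v) = filter_op (tail N0) (f (c * \<omega>)) (emb v)"
  unfolding diag_fun_block_Omega filter_op_def using assms
  by (intro fseq_eqI) (simp add: emb_mat_diag[OF assms(1)] coord_emb_carrier[OF assms(1)])

lemma emb_Omega_sin:
  assumes v: "v \<in> carrier_vec (N0 + N1)"
  shows "emb (block_Omega N0 N1 \<omega> *\<^sub>v (diag_fun sin (c \<cdot>\<^sub>m block_Omega N0 N1 \<omega>) *\<^sub>v v))
    = (\<omega> * sin (c * \<omega>)) *\<^sub>R tail N0 (emb v)"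
proof -
  have "diag_fun sin (c \<cdot>\<^sub>m block_Omega N0 N1 \<omega>) *\<^sub>v v \<in> carrier_vec (N0 + N1)"
    unfolding diag_fun_block_Omega using v by (intro mult_mat_vec_carrier) auto
  from emb_Omega[OF this] show ?thesis
    unfolding diag_fun_block_Omega using v
    by (intro fseq_eqI) (simp add: emb_mat_diag[OF v] coord_emb_carrier[OF v])
qed

lemma diag_fun_carrier:
  "v \<in> carrier_vec (N0 + N1) \<Longrightarrow> diag_fun f (c \<cdot>\<^sub>m block_Omega N0 N1 \<omega>) *\<^sub>v v \<in> carrier_vec (N0 + N1)"
  unfolding diag_fun_block_Omega by (intro mult_mat_vec_carrier) auto

lemma block_Omega_carrier:
  "v \<in> carrier_vec (N0 + N1) \<Longrightarrow> block_Omega N0 N1 \<omega> *\<^sub>v v \<in> carrier_vec (N0 + N1)"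
  unfolding block_Omega_mat_diag by (intro mult_mat_vec_carrier) auto

text \<open>The splitting scheme read in the sequence space. The values \<open>\<psi> 0 = \<phi> 0 = 1\<close>, \<open>cos 0 = sinc 0 = 1\<close> and
  \<open>sin 0 = 0\<close> reduce every matrix function to its action on the range of \<open>P\<close>.\<close>

lemma emb_triple_step:
  fixes N0 N1 M :: nat
  defines "N \<equiv> N0 + N1"
  assumes step: "(p', e', b') = triple_step \<tau> CE CB (block_Omega N0 N1 \<omega>) \<psi> \<phi> (p, e, b)"
    and CE: "CE \<in> carrier_mat M N" and CB: "CB \<in> carrier_mat N M"
    and p: "p \<in> carrier_vec N" and e: "e \<in> carrier_vec N" and b: "b \<in> carrier_vec M"
    and \<psi>0: "\<psi> 0 = 1" and \<phi>0: "\<phi> 0 = 1" and pos: "0 < \<tau> * \<omega>"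
  defines "F \<equiv> filter_op (tail N0)"
  defines "bh \<equiv> emb b - (\<tau> / 2) *\<^sub>R mop CE (F (\<phi> (\<tau> / 2 * \<omega>)) (emb e))"
  defines "ep \<equiv> emb e + (\<tau> / 2) *\<^sub>R F (\<psi> (\<tau> / 2 * \<omega>)) (mop CB bh)"
  shows "p' \<in> carrier_vec N" "e' \<in> carrier_vec N" "b' \<in> carrier_vec M"
    and "emb p' = F (cos (\<tau> * \<omega>)) (emb p) + \<tau> *\<^sub>R F (sin (\<tau> * \<omega>) / (\<tau> * \<omega>)) ep"
    and "emb e' = F (cos (\<tau> * \<omega>)) ep - (\<omega> * sin (\<tau> * \<omega>)) *\<^sub>R tail N0 (emb p)
      + (\<tau> / 2) *\<^sub>R F (\<psi> (\<tau> / 2 * \<omega>)) (mop CB bh)"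
    and "emb b' = bh - (\<tau> / 2) *\<^sub>R mop CE (F (\<phi> (\<tau> / 2 * \<omega>)) (emb e'))"
proof -
  define \<Omega> where "\<Omega> = block_Omega N0 N1 \<omega>"
  define d where "d f c v = diag_fun f (c \<cdot>\<^sub>m \<Omega>) *\<^sub>v v" for f c and v :: "real Matrix.vec"
  define bv where "bv = b - (\<tau> / 2) \<cdot>\<^sub>v (CE *\<^sub>v d \<phi> (\<tau> / 2) e)"
  define kick where "kick = (\<tau> / 2) \<cdot>\<^sub>v d \<psi> (\<tau> / 2) (CB *\<^sub>v bv)"
  define ev where "ev = e + kick"
  have p': "p' = d cos \<tau> p + \<tau> \<cdot>\<^sub>v d sinc \<tau> ev"
    and e': "e' = (d cos \<tau> ev - \<Omega> *\<^sub>v d sin \<tau> p) + kick"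
    and b': "b' = bv - (\<tau> / 2) \<cdot>\<^sub>v (CE *\<^sub>v d \<phi> (\<tau> / 2) e')"
    using step by (simp_all add: triple_step_def Let_def d_def bv_def kick_def ev_def \<Omega>_def)
  have dc: "d f c v \<in> carrier_vec N" if "v \<in> carrier_vec N" for f c v
    using that unfolding d_def \<Omega>_def N_def by (rule diag_fun_carrier)
  have Oc: "\<Omega> *\<^sub>v v \<in> carrier_vec N" if "v \<in> carrier_vec N" for v
    using that unfolding \<Omega>_def N_def by (rule block_Omega_carrier)
  have demb: "emb (d f c v) = F (f (c * \<omega>)) (emb v)" if "v \<in> carrier_vec N" "f 0 = 1" for f c v
    using that unfolding d_def \<Omega>_def N_def F_def by (rule emb_diag_fun)
  have bvc: "bv \<in> carrier_vec M" using b CE dc[OF e] by (simp add: bv_def)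
  have kc: "kick \<in> carrier_vec N" using CB bvc dc by (simp add: kick_def)
  have evc: "ev \<in> carrier_vec N" using e kc by (simp add: ev_def)
  show p'c: "p' \<in> carrier_vec N" using p evc dc by (simp add: p')
  show e'c: "e' \<in> carrier_vec N" using p evc dc kc Oc by (simp add: e')
  show b'c: "b' \<in> carrier_vec M" using bvc e'c dc CE by (simp add: b')
  have embbv: "emb bv = bh"
    unfolding bv_def bh_def using b CE dc[OF e]
    by (simp add: emb_diff[of _ M] emb_smult demb[where f = \<phi>, OF e \<phi>0] flip: mop_emb[OF CE dc[OF e]])
  have embk: "emb kick = (\<tau> / 2) *\<^sub>R F (\<psi> (\<tau> / 2 * \<omega>)) (mop CB bh)"
    unfolding kick_def emb_smult using CB bvc \<psi>0
    by (simp add: demb mop_emb[OF CB bvc] flip: embbv)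
  have embev: "emb ev = ep" unfolding ev_def ep_def using e kc by (simp add: emb_add[of _ N] embk)
  show "emb p' = F (cos (\<tau> * \<omega>)) (emb p) + \<tau> *\<^sub>R F (sin (\<tau> * \<omega>) / (\<tau> * \<omega>)) ep"
    unfolding p' using p evc dc pos
    by (cases "\<omega> = 0") (simp_all add: emb_add[of _ N] emb_smult demb embev)
  show "emb e' = F (cos (\<tau> * \<omega>)) ep - (\<omega> * sin (\<tau> * \<omega>)) *\<^sub>R tail N0 (emb p)
      + (\<tau> / 2) *\<^sub>R F (\<psi> (\<tau> / 2 * \<omega>)) (mop CB bh)"
  proof -
    have "emb (\<Omega> *\<^sub>v d sin \<tau> p) = (\<omega> * sin (\<tau> * \<omega>)) *\<^sub>R tail N0 (emb p)"
      using p unfolding \<Omega>_def d_def N_def by (rule emb_Omega_sin)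
    then show ?thesis
      unfolding e' using p evc dc kc Oc by (simp add: emb_add[of _ N] emb_diff[of _ N] demb embev embk)
  qed
  show "emb b' = bh - (\<tau> / 2) *\<^sub>R mop CE (F (\<phi> (\<tau> / 2 * \<omega>)) (emb e'))"
    unfolding b' using bvc CE dc[OF e'c]
    by (simp add: emb_diff[of _ M] emb_smult embbv demb[where f = \<phi>, OF e'c \<phi>0] flip: mop_emb[OF CE dc[OF e'c]])
qed

section \<open>Second-order convergence\<close>

theorem theorem1:
  fixes L H0 Cc C1 C2 C3 C4 C5 C6 C7 C8 :: real
  assumes "0 < L" and "0 < H0" and "0 < Cc"
    and "0 < C1" and "0 < C2" and "0 < C3" and "0 < C4"
    and "0 < C5" and "0 < C6" and "0 < C7" and "0 < C8"
  shows "\<exists>C::real. \<forall>c0>0. \<exists>\<tau>0>0.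
    \<forall>(t0::real) (T::real) (N0::nat) (N1::nat) (N::nat) (M::nat) CE CB (\<omega>::real) \<Omega> \<psi>E \<phi>E
      p0 e0 b0 p e b (\<tau>::real) pn en bn.
      t0 < T \<longrightarrow> T - t0 = L \<longrightarrow>
      N = N0 + N1 \<longrightarrow>
      CE \<in> carrier_mat M N \<longrightarrow> CB \<in> carrier_mat N M \<longrightarrow>
      sym_pos_semidef (CB * CE) \<longrightarrow>
      1 < \<omega> \<longrightarrow> \<Omega> = block_Omega N0 N1 \<omega> \<longrightarrow>
      mat_norm CE \<le> Cc \<longrightarrow> mat_norm CB \<le> Cc \<longrightarrow>
      p0 \<in> carrier_vec N \<longrightarrow> e0 \<in> carrier_vec N \<longrightarrow> b0 \<in> carrier_vec M \<longrightarrow>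
      initial_bounds H0 C4 CE CB \<Omega> p0 e0 b0 \<longrightarrow>
      filter_function \<psi>E \<longrightarrow> filter_function \<phi>E \<longrightarrow>
      filter_bounds C1 C2 C3 C4 C5 C6 C7 C8 (on_reals \<psi>E) (on_reals \<phi>E) \<longrightarrow>
      exact_solution N M CE CB \<Omega> t0 T p0 e0 b0 p e b \<longrightarrow>
      0 < \<tau> \<longrightarrow>
      (pn 0, en 0, bn 0) = (p0, e0, b0) \<longrightarrow>
      (\<forall>n. (pn (Suc n), en (Suc n), bn (Suc n)) =
           triple_step \<tau> CE CB \<Omega> (on_reals \<psi>E) (on_reals \<phi>E) (pn n, en n, bn n)) \<longrightarrow>
      \<tau> \<le> \<tau>0 \<longrightarrow> c0 \<le> \<tau> * \<omega> \<longrightarrow>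
      (\<forall>n::nat. t0 + real n * \<tau> \<le> T \<longrightarrow>
         vec_norm (pn n - p (t0 + real n * \<tau>)) \<le> C * \<tau>\<^sup>2 \<and>
         vec_norm (en n - e (t0 + real n * \<tau>)) \<le> C * \<tau>\<^sup>2 \<and>
         vec_norm (bn n - b (t0 + real n * \<tau>)) \<le> C * \<tau>\<^sup>2)"
proof -
  define F where "F = 25 + 2 * C1 + C2 + 2 * C4 + C4 * C6 + 17 * C5 + C6 + C7"
  \<comment> \<open>The energy bounds \<open>e'\<close> and \<open>\<omega> P e\<close> by \<open>2 sqrt H0\<close>, hence
        \<open>e\<close> by \<open>sqrt H0 (1 + 2 L)\<close> and \<open>b\<close> by \<open>sqrt H0 + Cc L sqrt H0 (1 + 2 L)\<close>; \<open>K\<close>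
        exceeds all of these and the constant \<open>F\<close> for the filters.\<close>
  define K where "K = F + Cc + (1 + Cc * L) * (sqrt H0 * (3 + 2 * L))"
  define C where "C = const_p K L + const_e K L + const_b K L"
  have F: "1 \<le> F" using assms by (simp add: F_def add_pos_pos)
  have s0: "0 \<le> sqrt H0" using assms by simp
  have extra: "0 \<le> (1 + Cc * L) * (sqrt H0 * (3 + 2 * L))" using assms by simp
  have K1: "1 \<le> K" "F \<le> K" "Cc \<le> K" using F extra assms(3) unfolding K_def by linarith+
  have sK: "sqrt H0 * (3 + 2 * L) \<le> K"
  proof -
    have "1 * (sqrt H0 * (3 + 2 * L)) \<le> (1 + Cc * L) * (sqrt H0 * (3 + 2 * L))"
      using assms by (intro mult_right_mono) auto
    then show ?thesis using F assms(3) unfolding K_def by linarith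
  qed
  have main: "vec_norm (pn n - p (t0 + real n * \<tau>)) \<le> C * \<tau>\<^sup>2 \<and>
      vec_norm (en n - e (t0 + real n * \<tau>)) \<le> C * \<tau>\<^sup>2 \<and>
      vec_norm (bn n - b (t0 + real n * \<tau>)) \<le> C * \<tau>\<^sup>2"
    if sol: "exact_solution N M CE CB \<Omega> t0 T p0 e0 b0 p e b"
      and init: "initial_bounds H0 C4 CE CB \<Omega> p0 e0 b0"
      and fb: "filter_bounds C1 C2 C3 C4 C5 C6 C7 C8 (on_reals \<psi>E) (on_reals \<phi>E)"
      and t0T: "t0 < T" and TL: "T - t0 = L" and N: "N = N0 + N1"
      and CE: "CE \<in> carrier_mat M N" and CB: "CB \<in> carrier_mat N M"
      and psd: "sym_pos_semidef (CB * CE)"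
      and \<omega>: "1 < \<omega>" and \<Omega>: "\<Omega> = block_Omega N0 N1 \<omega>"
      and nCE: "mat_norm CE \<le> Cc" and nCB: "mat_norm CB \<le> Cc"
      and p0: "p0 \<in> carrier_vec N" and e0: "e0 \<in> carrier_vec N" and b0: "b0 \<in> carrier_vec M"
      and fil: "filter_function \<psi>E" "filter_function \<phi>E"
      and \<tau>: "0 < \<tau>" "\<tau> \<le> 1"
      and start: "(pn 0, en 0, bn 0) = (p0, e0, b0)"
      and step: "\<And>n. (pn (Suc n), en (Suc n), bn (Suc n)) =
           triple_step \<tau> CE CB \<Omega> (on_reals \<psi>E) (on_reals \<phi>E) (pn n, en n, bn n)"
      and n: "t0 + real n * \<tau> \<le> T"
    for t0 T :: real and N0 N1 N M :: nat and CE CB \<omega> \<Omega> \<psi>E \<phi>E p0 e0 b0 p e b \<tau> pn en bn n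
  proof -
    define S where "S = CB * CE"
    have S: "S \<in> carrier_mat N N" "transpose_mat S = S" using CE CB psd by (auto simp: S_def sym_pos_semidef_def)
    have w0: "0 < \<omega>" using \<omega> by simp
    have AB: "mop CB (mop CE x) = emb (S *\<^sub>v restr N x)" for x
      unfolding mop_def[of CE] S_def using CE by (subst mop_emb[OF CB, of "CE *\<^sub>v restr (dim_col CE) x"])
        (auto simp: assoc_mult_mat_vec[OF CB CE])
    have sol': "p t0 = p0" "e t0 = e0" "b t0 = b0"
      "\<And>t. t \<in> {t0..T} \<Longrightarrow> has_vec_deriv p (e t) N t {t0..T}"
      "\<And>t. t \<in> {t0..T} \<Longrightarrow> has_vec_deriv e (CB *\<^sub>v b t - \<Omega> *\<^sub>v (\<Omega> *\<^sub>v p t)) N t {t0..T}"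
      "\<And>t. t \<in> {t0..T} \<Longrightarrow> has_vec_deriv b (- (CE *\<^sub>v e t)) M t {t0..T}"
      using sol by (auto simp: exact_solution_def)
    have car: "p t \<in> carrier_vec N" "e t \<in> carrier_vec N" "b t \<in> carrier_vec M" if "t \<in> {t0..T}" for t
      using sol'(4,5,6)[OF that] that by (auto simp: has_vec_deriv_def)
    have t0in: "t0 \<in> {t0..T}" using t0T by simp
    have OO: "emb (\<Omega> *\<^sub>v (\<Omega> *\<^sub>v v)) = \<omega>\<^sup>2 *\<^sub>R tail N0 (emb v)" if "v \<in> carrier_vec N" for v
    proof -
      have "\<Omega> *\<^sub>v v \<in> carrier_vec (N0 + N1)" using that unfolding \<Omega> N by (rule block_Omega_carrier)
      then have "emb (\<Omega> *\<^sub>v (\<Omega> *\<^sub>v v)) = \<omega> *\<^sub>R tail N0 (emb (\<Omega> *\<^sub>v v))" unfolding \<Omega> by (rule emb_Omega)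
      also have "emb (\<Omega> *\<^sub>v v) = \<omega> *\<^sub>R tail N0 (emb v)" using that unfolding \<Omega> N by (rule emb_Omega)
      finally show ?thesis
        using bounded_linear.linear[OF bounded_linear_tail, of N0] by (simp add: linear_scale power2_eq_square)
    qed
    have Oc: "\<Omega> *\<^sub>v (\<Omega> *\<^sub>v v) \<in> carrier_vec N" if "v \<in> carrier_vec N" for v
      using that unfolding \<Omega> N by (intro block_Omega_carrier)
    define pE eE bE where "pE t = emb (p t)" and "eE t = emb (e t)" and "bE t = emb (b t)" for t
    have p': "(pE has_vector_derivative eE t) (at t within {t0..T})" if "t \<in> {t0..T}" for t
      unfolding pE_def[abs_def] eE_def using sol'(4)[OF that] that by (rule emb_has_vector_derivative)
    have e': "(eE has_vector_derivative mop CB (bE t) - \<omega>\<^sup>2 *\<^sub>R tail N0 (pE t)) (at t within {t0..T})"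
      if "t \<in> {t0..T}" for t
    proof -
      have "emb (CB *\<^sub>v b t - \<Omega> *\<^sub>v (\<Omega> *\<^sub>v p t)) = mop CB (bE t) - \<omega>\<^sup>2 *\<^sub>R tail N0 (pE t)"
        using car[OF that] CB
        by (subst emb_diff[of _ N]) (auto simp: Oc OO mop_emb[OF CB] bE_def pE_def)
      then show ?thesis
        using emb_has_vector_derivative[OF sol'(5)[OF that] that] by (simp add: eE_def[abs_def])
    qed
    have b': "(bE has_vector_derivative - mop CE (eE t)) (at t within {t0..T})" if "t \<in> {t0..T}" for t
      using emb_has_vector_derivative[OF sol'(6)[OF that] that] car[OF that]
      by (simp add: bE_def[abs_def] eE_def emb_uminus mop_emb[OF CE])
    have ib: "(vec_norm (\<Omega> *\<^sub>v e0))\<^sup>2 \<le> 2 / 3 * H0"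
      "(vec_norm (CB *\<^sub>v b0))\<^sup>2 \<le> 1 / 3 * min 1 (4 / C4\<^sup>2) * H0"
      "(vec_norm (\<Omega> *\<^sub>v (\<Omega> *\<^sub>v p0)))\<^sup>2 \<le> 1 / 3 * H0"
      "- (e0 \<bullet> (- (CB * CE) *\<^sub>v e0)) \<le> 2 * H0"
      "(vec_norm e0)\<^sup>2 \<le> H0" "(vec_norm b0)\<^sup>2 \<le> H0"
      "(vec_norm (\<Omega> *\<^sub>v (\<Omega> *\<^sub>v (CB *\<^sub>v b0))))\<^sup>2 \<le> H0"
      using init unfolding initial_bounds_def Let_def by auto
    have en: "norm (mop CB (bE t) - \<omega>\<^sup>2 *\<^sub>R tail N0 (pE t)) \<le> 2 * sqrt H0"
      "\<omega> * norm (tail N0 (eE t)) \<le> 2 * sqrt H0" if t: "t \<in> {t0..T}" for t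
    proof -
      have i1: "(norm (\<omega> *\<^sub>R tail N0 (eE t0)))\<^sup>2 \<le> 2 / 3 * H0"
        using ib(1) e0 unfolding norm_emb[symmetric] \<Omega> N eE_def sol' by (simp add: emb_Omega)
      have i2: "(norm (mop CB (bE t0)))\<^sup>2 \<le> 1 / 3 * H0"
      proof -
        have "1 / 3 * min 1 (4 / C4\<^sup>2) * H0 \<le> 1 / 3 * 1 * H0"
          using assms by (intro mult_right_mono mult_left_mono) auto
        then show ?thesis
          using ib(2) unfolding norm_emb[symmetric] bE_def sol' by (simp add: mop_emb[OF CB b0])
      qed
      have i3: "(norm (\<omega>\<^sup>2 *\<^sub>R tail N0 (pE t0)))\<^sup>2 \<le> 1 / 3 * H0"
        using ib(3) p0 unfolding norm_emb[symmetric] pE_def sol' by (simp only: OO)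
      have i4: "inner (eE t0) (mop CB (mop CE (eE t0))) \<le> 2 * H0"
      proof -
        have "inner (eE t0) (mop CB (mop CE (eE t0))) = e0 \<bullet> (S *\<^sub>v e0)"
          using S e0 by (simp add: AB eE_def sol' inner_emb[of _ N] restr_emb)
        also have "\<dots> = - (e0 \<bullet> (- (CB * CE) *\<^sub>v e0))"
          using S(1) e0 CE CB by (simp add: S_def)
        finally show ?thesis using ib(4) by simp
      qed
      have psd': "0 \<le> inner x (mop CB (mop CE x))" for x
      proof -
        have "inner (emb (S *\<^sub>v restr N x)) x = (S *\<^sub>v restr N x) \<bullet> restr N x"
          using S by (intro inner_emb) auto
        also have "\<dots> = restr N x \<bullet> (S *\<^sub>v restr N x)" using S by (intro comm_scalar_prod[of _ N]) auto
        also have "0 \<le> \<dots>" using psd S(1) unfolding sym_pos_semidef_def S_def[symmetric] by auto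
        finally show ?thesis by (simp add: AB inner_commute)
      qed
      have sym: "inner (mop CB (mop CE x)) y = inner x (mop CB (mop CE y))" for x y
        unfolding AB using S by (rule inner_emb_mult_mat_sym)
      note eb = energy_bounds[OF bounded_linear_tail bounded_linear_mop bounded_linear_mop
          tail_tail tail_sym sym psd' p' e' b' i1 i2 i3 i4 w0 t]
      show "norm (mop CB (bE t) - \<omega>\<^sup>2 *\<^sub>R tail N0 (pE t)) \<le> 2 * sqrt H0"
        and "\<omega> * norm (tail N0 (eE t)) \<le> 2 * sqrt H0"
        by (rule eb; assumption)+
    qed
    have ebound: "norm (eE t) \<le> sqrt H0 * (1 + 2 * L)" if t: "t \<in> {t0..T}" for t
    proof -
      have "norm (eE t - eE t0) \<le> 2 * sqrt H0 * \<bar>t - t0\<bar>"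
        using e' en(1) t t0in by (rule vector_derivative_bound_interval)
      also have "\<dots> \<le> 2 * sqrt H0 * L" using t TL s0 by (intro mult_left_mono) auto
      finally have "norm (eE t - eE t0) \<le> 2 * sqrt H0 * L" .
      moreover have "norm (eE t0) \<le> sqrt H0"
        using ib(5) by (simp add: eE_def sol' norm_emb real_le_rsqrt)
      ultimately have "norm ((eE t - eE t0) + eE t0) \<le> 2 * sqrt H0 * L + sqrt H0"
        by (rule norm_triangle_mono)
      then show ?thesis by (simp add: algebra_simps)
    qed
    have Cc0: "0 \<le> Cc" using assms by simp
    have nA: "norm (mop CB y) \<le> Cc * norm y" and nB: "norm (mop CE x) \<le> Cc * norm x" for x y
      using norm_mop_le[OF nCB Cc0] norm_mop_le[OF nCE Cc0] by auto
    have bbound: "norm (bE t) \<le> K" if t: "t \<in> {t0..T}" for t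
    proof -
      have "norm (- mop CE (eE r)) \<le> Cc * (sqrt H0 * (1 + 2 * L))" if "r \<in> {t0..T}" for r
        using nB[of "eE r"] mult_left_mono[OF ebound[OF that] Cc0] by simp
      with b' have "norm (bE t - bE t0) \<le> Cc * (sqrt H0 * (1 + 2 * L)) * \<bar>t - t0\<bar>"
        using t t0in by (rule vector_derivative_bound_interval)
      also have "\<dots> \<le> Cc * (sqrt H0 * (1 + 2 * L)) * L"
        using t TL s0 assms by (intro mult_left_mono) auto
      finally have "norm (bE t - bE t0) \<le> Cc * (sqrt H0 * (1 + 2 * L)) * L" .
      moreover have "norm (bE t0) \<le> sqrt H0"
        using ib(6) by (simp add: bE_def sol' norm_emb real_le_rsqrt)
      ultimately have "norm ((bE t - bE t0) + bE t0) \<le> Cc * (sqrt H0 * (1 + 2 * L)) * L + sqrt H0"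
        by (rule norm_triangle_mono)
      also have "\<dots> \<le> (1 + Cc * L) * (sqrt H0 * (3 + 2 * L))"
      proof -
        have "(1 + Cc * L) * (sqrt H0 * (3 + 2 * L))
            = Cc * (sqrt H0 * (1 + 2 * L)) * L + sqrt H0 + (2 * (1 + L) * sqrt H0 + 2 * (Cc * L * sqrt H0))"
          by (simp add: algebra_simps)
        moreover have "0 \<le> 2 * (1 + L) * sqrt H0 + 2 * (Cc * L * sqrt H0)" using assms by simp
        ultimately show ?thesis by linarith
      qed
      also have "\<dots> \<le> K" using F assms(3) unfolding K_def by linarith
      finally show ?thesis by simp
    qed
    have sK2: "2 * sqrt H0 \<le> K" "sqrt H0 * (1 + 2 * L) \<le> K" "sqrt H0 \<le> K"
    proof -
      have q: "0 \<le> sqrt H0 * L" using s0 assms(1) by simp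
      have "3 * sqrt H0 + 2 * (sqrt H0 * L) \<le> K"
        using sK by (simp only: distrib_left mult_ac)
      then have r: "2 * sqrt H0 \<le> K" "sqrt H0 + 2 * (sqrt H0 * L) \<le> K" "sqrt H0 \<le> K"
        using q s0 by linarith+
      from r(2) have "sqrt H0 * (1 + 2 * L) \<le> K"
        by (simp only: distrib_left mult_1_right mult_ac)
      with r show "2 * sqrt H0 \<le> K" "sqrt H0 * (1 + 2 * L) \<le> K" "sqrt H0 \<le> K" by blast+
    qed
    have KA: "norm (mop CB y) \<le> K * norm y" and KB: "norm (mop CE x) \<le> K * norm x" for x y
      using nA[of y] nB[of x] mult_right_mono[OF K1(3), of "norm y"] mult_right_mono[OF K1(3), of "norm x"]
      by auto
    interpret osc: oscillatory_system "tail N0" "mop CB" "mop CE" \<omega> K t0 T pE eE bE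
    proof (rule oscillatory_system.intro)
      show "norm (eE t) \<le> K" if "t \<in> {t0..T}" for t using ebound[OF that] sK2(2) by linarith
      show "norm (mop CB (bE t) - \<omega>\<^sup>2 *\<^sub>R tail N0 (pE t)) \<le> K" if "t \<in> {t0..T}" for t
        using en(1)[OF that] sK2(1) by linarith
      show "\<omega> * norm (tail N0 (eE t)) \<le> K" if "t \<in> {t0..T}" for t
        using en(2)[OF that] sK2(1) by linarith
    qed (fact tail_tail norm_tail_le norm_minus_tail_le KA KB w0 K1(1) p' e' b' bbound
        bounded_linear_tail bounded_linear_mop)+
    define \<psi> \<phi> where "\<psi> = on_reals \<psi>E (\<tau> / 2 * \<omega>)" and "\<phi> = on_reals \<phi>E (\<tau> / 2 * \<omega>)"
    have at0: "on_reals \<psi>E 0 = 1" "on_reals \<phi>E 0 = 1"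
      using fil by (simp_all add: filter_function_def on_reals_def)
    have pos: "0 < \<tau> * \<omega>" using \<tau> w0 by simp
    define pE' eE' bE' where "pE' n = emb (pn n)" and "eE' n = emb (en n)" and "bE' n = emb (bn n)" for n
    define bh where "bh n = bE' n - (\<tau> / 2) *\<^sub>R mop CE (filter_op (tail N0) \<phi> (eE' n))" for n
    have stepc: "pn n \<in> carrier_vec N \<and> en n \<in> carrier_vec N \<and> bn n \<in> carrier_vec M" for n
    proof (induction n)
      case 0
      then show ?case using start p0 e0 b0 by simp
    next
      case (Suc n)
      then show ?case
        using emb_triple_step(1-3)[OF step[of n, unfolded \<Omega>], of M] CE CB at0 pos unfolding N by blast
    qed
    note step' = emb_triple_step(4-6)[OF step[unfolded \<Omega>] CE[unfolded N] CB[unfolded N] _ _ _ at0 pos,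
        folded N \<psi>_def \<phi>_def]
    interpret num: triple_splitting "tail N0" "mop CB" "mop CE" \<omega> K t0 T pE eE bE \<tau> \<psi> \<phi> pE' eE' bE' bh
    proof (rule triple_splitting.intro, rule osc.oscillatory_system_axioms, rule triple_splitting_axioms.intro)
      show "0 < \<tau>" "\<tau> \<le> 1" by (fact \<tau>)+
      show "bh n = bE' n - (\<tau> / 2) *\<^sub>R mop CE (filter_op (tail N0) \<phi> (eE' n))" for n by (rule bh_def)
      show "pE' 0 = pE t0" "eE' 0 = eE t0" "bE' 0 = bE t0"
        using start by (simp_all add: pE'_def eE'_def bE'_def pE_def eE_def bE_def sol')
      have z: "\<omega> * \<tau> = \<tau> * \<omega>" by simp
      show "pE' (Suc n) = filter_op (tail N0) (cos (\<omega> * \<tau>)) (pE' n) + \<tau> *\<^sub>R filter_op (tail N0)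
          (sin (\<omega> * \<tau>) / (\<omega> * \<tau>)) (eE' n + (\<tau> / 2) *\<^sub>R filter_op (tail N0) \<psi> (mop CB (bh n)))" for n
        unfolding pE'_def eE'_def bh_def bE'_def z using stepc[of n] by (intro step'(1)) auto
      show "eE' (Suc n) = filter_op (tail N0) (cos (\<omega> * \<tau>)) (eE' n + (\<tau> / 2) *\<^sub>R
          filter_op (tail N0) \<psi> (mop CB (bh n))) - (\<omega> * sin (\<omega> * \<tau>)) *\<^sub>R tail N0 (pE' n)
          + (\<tau> / 2) *\<^sub>R filter_op (tail N0) \<psi> (mop CB (bh n))" for n
        unfolding pE'_def eE'_def bh_def bE'_def z using stepc[of n] by (intro step'(2)) auto
      show "bE' (Suc n) = bh n - (\<tau> / 2) *\<^sub>R mop CE (filter_op (tail N0) \<phi> (eE' (Suc n)))" for n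
        unfolding pE'_def eE'_def bh_def bE'_def z using stepc[of n] by (intro step'(3)) auto
      show "\<omega>\<^sup>2 * norm (tail N0 (mop CB (bE t0))) \<le> K"
      proof -
        have "(norm (\<omega>\<^sup>2 *\<^sub>R tail N0 (mop CB (bE t0))))\<^sup>2 \<le> H0"
          using ib(7) CB b0 unfolding norm_emb[symmetric] bE_def sol'
          by (simp only: OO mop_emb[OF CB b0] mult_mat_vec_carrier[OF CB b0])
        from order_trans[OF real_le_rsqrt[OF this] sK2(3)] show ?thesis by simp
      qed
      have fz: "\<tau> / 2 * \<omega> = \<omega> * \<tau> / 2" by simp
      show "admissible_filter_values K (\<omega> * \<tau>) \<psi> \<phi>"
        unfolding \<psi>_def \<phi>_def fz
      proof (rule admissible_filter_valuesI[of _ C1 C2 C4 C5 C6 C7])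
        note f = fb[unfolded filter_bounds_def, THEN spec]
        show "\<bar>on_reals \<psi>E (\<omega> * \<tau> / 2)\<bar> \<le> C7" using f[of "\<omega> * \<tau> / 2"] by blast
        show "0 < \<omega> * \<tau>" using w0 \<tau> by simp
      qed (use fb[unfolded filter_bounds_def, THEN spec, of "\<omega> * \<tau>"] assms K1(2)[unfolded F_def] in blast)+
    qed
    have grid: "num.grid n = t0 + real n * \<tau>" by (simp add: num.grid_def)
    have LL: "num.L = L" by (simp add: num.L_def TL)
    have nT: "num.grid n \<le> T" using n by (simp add: grid)
    have tn: "t0 + real n * \<tau> \<in> {t0..T}" using n \<tau> by simp
    have "0 \<le> L" using assms by simp
    then have nn: "0 \<le> const_e K L" "0 \<le> const_b K L" "0 \<le> const_p K L"
      using num.const_e_nonneg num.const_b_half_nonneg K1(1) unfolding LL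
      by (simp_all add: const_b_def const_p_def)
    have 1: "norm (pE (t0 + real n * \<tau>) - pE' n) \<le> C * \<tau>\<^sup>2"
      using num.p_error[OF nT] nn unfolding grid LL C_def distrib_right by (simp add: add_increasing2)
    have 2: "norm (eE (t0 + real n * \<tau>) - eE' n) \<le> C * \<tau>\<^sup>2"
      using num.e_error[OF nT] nn unfolding num.e_err_def grid LL C_def distrib_right
      by (simp add: add_increasing add_increasing2)
    have 3: "norm (bE (t0 + real n * \<tau>) - bE' n) \<le> C * \<tau>\<^sup>2"
      using num.b_error[OF nT] nn unfolding grid LL C_def distrib_right by (simp add: add_increasing)
    have "vec_norm (pn n - p (t0 + real n * \<tau>)) = norm (pE (t0 + real n * \<tau>) - pE' n)"
      "vec_norm (en n - e (t0 + real n * \<tau>)) = norm (eE (t0 + real n * \<tau>) - eE' n)"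
      "vec_norm (bn n - b (t0 + real n * \<tau>)) = norm (bE (t0 + real n * \<tau>) - bE' n)"
      using stepc[of n] car[OF tn]
      by (auto simp: norm_minus_commute pE_def eE_def bE_def pE'_def eE'_def bE'_def
          emb_diff[of _ N] emb_diff[of _ M] simp flip: norm_emb)
    then show ?thesis using 1 2 3 by simp
  qed
  show ?thesis
    by (rule exI[of _ C], intro allI impI, rule exI[of _ 1], rule conjI, simp,
        intro allI impI, rule main) (assumption | erule spec)+
qed

end
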